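(* The group generated by a very general quadratic birational transformation of $\mathbb{P}^2$ (over $\mathbb{C}$) is an infinite cyclic group $G$ that satisfies the following property (F) but does not satisfy the following property (M): (F) no non-trivial element of $G$ fixes (pointwise) a curve of positive genus; (M) $G$ is birationally conjugate to a group of automorphisms of a minimal surface.
   Context: A quadratic birational transformation is a birational self-map of $\mathbb{P}^2$ of degree $2$. "Very general" means: outside a countable union of proper subvarieties of the variety of quadratic birational transformations. The minimal (smooth projective rational) surfaces are $\mathbb{P}^2$, $\mathbb{P}^1\times\mathbb{P}^1$ and the Hirzebruch surfaces $\mathbb{F}_n$, $n\geq2$. $G\subset\mathrm{Bir}(\mathbb{P}^2)$ is birationally conjugate to $G'\subset\mathrm{Aut}(S)$ if $\varphi G\varphi^{-1}=G'$ for some birational map $\varphi:\mathbb{P}^2\dashrightarrow S$. The genus is the geometric genus (positive genus = non-rational). *)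

theory Defs
  imports "HOL-Analysis.Analysis" "HOL-Algebra.Elementary_Groups" "HOL-Algebra.Subrings"
begin

text \<open>
  Varieties over the complex numbers are treated classically, as spaces with functions: a set of
  closed points with its Zariski topology and, for each open set, the regular complex-valued
  functions on it.
\<close>

section \<open>Polynomials and the Zariski topology of affine space\<close>

text \<open>Over an infinite field, polynomials may be identified with the functions they induce.\<close>

inductive polynomial_fun :: "(complex^'n \<Rightarrow> complex) \<Rightarrow> bool" where
  const: "polynomial_fun (\<lambda>x. c)"
| coord: "polynomial_fun (\<lambda>x. x $ i)"
| add: "polynomial_fun p \<Longrightarrow> polynomial_fun q \<Longrightarrow> polynomial_fun (\<lambda>x. p x + q x)"
| mult: "polynomial_fun p \<Longrightarrow> polynomial_fun q \<Longrightarrow> polynomial_fun (\<lambda>x. p x * q x)"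

definition zariski :: "(complex^'n) topology" where
  "zariski = topology (\<lambda>U. \<exists>F. (\<forall>p\<in>F. polynomial_fun p) \<and> U = {x. \<exists>p\<in>F. p x \<noteq> 0})"

lemma istopology_zariski:
  "istopology (\<lambda>U. \<exists>F. (\<forall>p\<in>F. polynomial_fun p) \<and> U = {x::complex^'n. \<exists>p\<in>F. p x \<noteq> 0})"
  (is "istopology ?P")
proof -
  let ?D = "\<lambda>F. {x::complex^'n. \<exists>p\<in>F. p x \<noteq> 0}"
  have int: "?P (?D F \<inter> ?D G)" if "\<forall>p\<in>F. polynomial_fun p" "\<forall>p\<in>G. polynomial_fun p" for F G
  proof (intro exI conjI)
    let ?H = "(\<lambda>(p, q) x. p x * q x) ` (F \<times> G)"
    show "\<forall>r\<in>?H. polynomial_fun r"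
      using that by (auto intro: polynomial_fun.mult)
    show "?D F \<inter> ?D G = ?D ?H"
      by (rule Set.set_eqI) (simp add: Bex_def, metis)
  qed
  have un: "?P (\<Union>S\<in>K. ?D (F S))" if "\<forall>S\<in>K. \<forall>p\<in>F S. polynomial_fun p" for K :: "(complex^'n) set set" and F
  proof (intro exI conjI)
    show "\<forall>p\<in>(\<Union>S\<in>K. F S). polynomial_fun p" using that by simp
    show "(\<Union>S\<in>K. ?D (F S)) = ?D (\<Union>S\<in>K. F S)" by (rule Set.set_eqI) simp
  qed
  show ?thesis
    unfolding istopology_def
  proof (intro conjI allI impI)
    fix S T assume "?P S" "?P T"
    then show "?P (S \<inter> T)" by (elim exE conjE) (simp only: int)
  next
    fix K assume "\<forall>S\<in>K. ?P S"
    then obtain F where F: "\<forall>S\<in>K. (\<forall>p\<in>F S. polynomial_fun p) \<and> S = ?D (F S)"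
      by (rule bchoice[THEN exE])
    have eq: "?D (F S) = S" if "S \<in> K" for S
      by (rule bspec[OF F that, THEN conjunct2, symmetric])
    have "(\<Union>S\<in>K. ?D (F S)) = (\<Union>S\<in>K. S)" by (intro SUP_cong refl eq)
    moreover have "\<forall>S\<in>K. \<forall>p\<in>F S. polynomial_fun p" by (rule ballI, rule bspec[OF F, THEN conjunct1])
    ultimately show "?P (\<Union>K)" using un[of K F] by (simp only: image_ident)
  qed
qed

lemma openin_zariski:
  "openin zariski U \<longleftrightarrow> (\<exists>F. (\<forall>p\<in>F. polynomial_fun p) \<and> U = {x. \<exists>p\<in>F. p x \<noteq> 0})"
  unfolding zariski_def by (simp add: topology_inverse'[OF istopology_zariski])


section \<open>Spaces with functions\<close>

text \<open>
  \<open>regular X U f\<close> says that \<open>U\<close> is open in \<open>X\<close> and that \<open>f\<close> is a regular function on \<open>U\<close>;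
  the values of \<open>f\<close> outside \<open>U\<close> are irrelevant.
\<close>

record 'a variety =
  zar :: "'a topology"
  regular :: "'a set \<Rightarrow> ('a \<Rightarrow> complex) \<Rightarrow> bool"

abbreviation points :: "'a variety \<Rightarrow> 'a set" where
  "points X \<equiv> topspace (zar X)"

definition affine_variety :: "(complex^'n) variety" where
  "affine_variety = \<lparr>zar = zariski,
     regular = (\<lambda>U f. openin zariski U \<and>
       (\<forall>x\<in>U. \<exists>V p q. openin zariski V \<and> x \<in> V \<and> V \<subseteq> U \<and> polynomial_fun p \<and> polynomial_fun q \<and>
          (\<forall>y\<in>V. q y \<noteq> 0 \<and> f y = p y / q y)))\<rparr>"

text \<open>The structure induced on a locally closed subset.\<close>

definition subvariety :: "'a variety \<Rightarrow> 'a set \<Rightarrow> 'a variety" where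
  "subvariety X A = \<lparr>zar = subtopology (zar X) A,
     regular = (\<lambda>U f. openin (subtopology (zar X) A) U \<and>
       (\<forall>x\<in>U. \<exists>W g. x \<in> W \<and> regular X W g \<and> (\<forall>y\<in>U \<inter> W. f y = g y)))\<rparr>"

text \<open>
  The quotient of \<open>X\<close> along \<open>\<pi>\<close>: points are the values of \<open>\<pi>\<close>, and open sets and regular functions
  are those which become open or regular on \<open>X\<close> after composition with \<open>\<pi>\<close>.
\<close>

definition coinduced_topology :: "'a topology \<Rightarrow> ('a \<Rightarrow> 'b) \<Rightarrow> 'b topology" where
  "coinduced_topology T \<pi> =
     topology (\<lambda>W. W \<subseteq> \<pi> ` topspace T \<and> openin T {x \<in> topspace T. \<pi> x \<in> W})"

lemma openin_coinduced_topology: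
  "openin (coinduced_topology T \<pi>) W \<longleftrightarrow>
     W \<subseteq> \<pi> ` topspace T \<and> openin T {x \<in> topspace T. \<pi> x \<in> W}"
proof -
  have "istopology (\<lambda>W. W \<subseteq> \<pi> ` topspace T \<and> openin T {x \<in> topspace T. \<pi> x \<in> W})"
    unfolding istopology_def
  proof (intro conjI allI impI)
    fix S U
    assume "S \<subseteq> \<pi> ` topspace T \<and> openin T {x \<in> topspace T. \<pi> x \<in> S}"
      "U \<subseteq> \<pi> ` topspace T \<and> openin T {x \<in> topspace T. \<pi> x \<in> U}"
    moreover have "{x \<in> topspace T. \<pi> x \<in> S \<inter> U} =
      {x \<in> topspace T. \<pi> x \<in> S} \<inter> {x \<in> topspace T. \<pi> x \<in> U}" by blast
    ultimately show "S \<inter> U \<subseteq> \<pi> ` topspace T" "openin T {x \<in> topspace T. \<pi> x \<in> S \<inter> U}"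
      by auto
  next
    fix K
    assume K: "\<forall>S\<in>K. S \<subseteq> \<pi> ` topspace T \<and> openin T {x \<in> topspace T. \<pi> x \<in> S}"
    then show "\<Union>K \<subseteq> \<pi> ` topspace T" by blast
    have "{x \<in> topspace T. \<pi> x \<in> \<Union>K} = (\<Union>S\<in>K. {x \<in> topspace T. \<pi> x \<in> S})" by blast
    then show "openin T {x \<in> topspace T. \<pi> x \<in> \<Union>K}" using K by auto
  qed
  then show ?thesis unfolding coinduced_topology_def by (simp add: topology_inverse')
qed

definition quotient_variety :: "'a variety \<Rightarrow> ('a \<Rightarrow> 'b) \<Rightarrow> 'b variety" where
  "quotient_variety X \<pi> = \<lparr>zar = coinduced_topology (zar X) \<pi>,
     regular = (\<lambda>W f. openin (coinduced_topology (zar X) \<pi>) W \<and>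
       regular X {x \<in> points X. \<pi> x \<in> W} (f \<circ> \<pi>))\<rparr>"

definition morphism :: "'a variety \<Rightarrow> 'b variety \<Rightarrow> ('a \<Rightarrow> 'b) \<Rightarrow> bool" where
  "morphism X Y f \<longleftrightarrow> continuous_map (zar X) (zar Y) f \<and>
     (\<forall>V g. regular Y V g \<longrightarrow> regular X {x \<in> points X. f x \<in> V} (g \<circ> f))"

definition irreducible_subset :: "'a topology \<Rightarrow> 'a set \<Rightarrow> bool" where
  "irreducible_subset T C \<longleftrightarrow> C \<noteq> {} \<and> C \<subseteq> topspace T \<and>
     (\<forall>A B. closedin T A \<and> closedin T B \<and> C \<subseteq> A \<union> B \<longrightarrow> C \<subseteq> A \<or> C \<subseteq> B)"

definition krull_dim :: "'a topology \<Rightarrow> 'a set \<Rightarrow> enat" where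
  "krull_dim T C = Sup {enat n |n. \<exists>Z :: nat \<Rightarrow> 'a set.
     (\<forall>i\<le>n. closedin T (Z i) \<and> irreducible_subset T (Z i) \<and> Z i \<subseteq> C) \<and> (\<forall>i<n. Z i \<subset> Z (Suc i))}"

definition curve_in :: "'a variety \<Rightarrow> 'a set \<Rightarrow> bool" where
  "curve_in X C \<longleftrightarrow>
     closedin (zar X) C \<and> irreducible_subset (zar X) C \<and> krull_dim (zar X) C = 1"


section \<open>Rational maps\<close>

text \<open>
  A rational map between irreducible varieties is an equivalence class of pairs \<open>(U, f)\<close> with \<open>U\<close>
  nonempty open and \<open>f\<close> a morphism on \<open>U\<close>; two pairs are equivalent if they agree on the
  intersection of their domains.
\<close>

type_synonym ('a, 'b) ratmap = "('a set \<times> ('a \<Rightarrow> 'b)) set"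

definition partial_morphisms :: "'a variety \<Rightarrow> 'b variety \<Rightarrow> ('a set \<times> ('a \<Rightarrow> 'b)) set" where
  "partial_morphisms X Y =
     {(U, f). openin (zar X) U \<and> U \<noteq> {} \<and> morphism (subvariety X U) Y f}"

definition rat_class :: "'a variety \<Rightarrow> 'b variety \<Rightarrow> 'a set \<Rightarrow> ('a \<Rightarrow> 'b) \<Rightarrow> ('a, 'b) ratmap" where
  "rat_class X Y U f = {(V, g) \<in> partial_morphisms X Y. \<forall>x\<in>U \<inter> V. f x = g x}"

definition rational_maps :: "'a variety \<Rightarrow> 'b variety \<Rightarrow> ('a, 'b) ratmap set" where
  "rational_maps X Y = {rat_class X Y U f |U f. (U, f) \<in> partial_morphisms X Y}"

text \<open>\<open>rat_comp X Z \<psi> \<phi>\<close> is \<open>\<psi> \<circ> \<phi>\<close>; it is empty if the composite is nowhere defined.\<close>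

definition rat_comp ::
  "'a variety \<Rightarrow> 'c variety \<Rightarrow> ('b, 'c) ratmap \<Rightarrow> ('a, 'b) ratmap \<Rightarrow> ('a, 'c) ratmap" where
  "rat_comp X Z \<psi> \<phi> = {(W, h) \<in> partial_morphisms X Z.
     \<exists>(U, f)\<in>\<phi>. \<exists>(V, g)\<in>\<psi>. (\<exists>x\<in>U. f x \<in> V) \<and> (\<forall>x\<in>U \<inter> W. f x \<in> V \<longrightarrow> h x = g (f x))}"

definition rat_id :: "'a variety \<Rightarrow> ('a, 'a) ratmap" where
  "rat_id X = rat_class X X (points X) (\<lambda>x. x)"

definition birational_inverses ::
  "'a variety \<Rightarrow> 'b variety \<Rightarrow> ('a, 'b) ratmap \<Rightarrow> ('b, 'a) ratmap \<Rightarrow> bool" where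
  "birational_inverses X Y \<phi> \<psi> \<longleftrightarrow> \<phi> \<in> rational_maps X Y \<and> \<psi> \<in> rational_maps Y X \<and>
     rat_comp X X \<psi> \<phi> = rat_id X \<and> rat_comp Y Y \<phi> \<psi> = rat_id Y"

definition Bir :: "'a variety \<Rightarrow> ('a, 'a) ratmap monoid" where
  "Bir X = \<lparr>carrier = {\<phi>. \<exists>\<psi>. birational_inverses X X \<phi> \<psi>}, mult = rat_comp X X, one = rat_id X\<rparr>"

text \<open>The automorphisms of \<open>X\<close>, viewed as birational self-maps.\<close>

definition Aut :: "'a variety \<Rightarrow> ('a, 'a) ratmap set" where
  "Aut X = {rat_class X X (points X) f |f. morphism X X f \<and>
     (\<exists>g. morphism X X g \<and> (\<forall>x\<in>points X. g (f x) = x \<and> f (g x) = x))}"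


section \<open>Geometric genus\<close>

definition rf_pairs :: "'a variety \<Rightarrow> ('a set \<times> ('a \<Rightarrow> complex)) set" where
  "rf_pairs X = {(U, f). U \<noteq> {} \<and> regular X U f}"

definition rf_class :: "'a variety \<Rightarrow> 'a set \<Rightarrow> ('a \<Rightarrow> complex) \<Rightarrow> ('a, complex) ratmap" where
  "rf_class X U f = {(V, g) \<in> rf_pairs X. \<forall>x\<in>U \<inter> V. f x = g x}"

definition rf_lift :: "'a variety \<Rightarrow> (complex \<Rightarrow> complex \<Rightarrow> complex) \<Rightarrow>
    ('a, complex) ratmap \<Rightarrow> ('a, complex) ratmap \<Rightarrow> ('a, complex) ratmap" where
  "rf_lift X b F G = {(W, h) \<in> rf_pairs X.
     \<exists>(U, f)\<in>F. \<exists>(V, g)\<in>G. \<forall>x\<in>U \<inter> V \<inter> W. h x = b (f x) (g x)}"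

definition rf_const :: "'a variety \<Rightarrow> complex \<Rightarrow> ('a, complex) ratmap" where
  "rf_const X c = rf_class X (points X) (\<lambda>x. c)"

text \<open>The field of rational functions on an irreducible variety.\<close>

definition function_field :: "'a variety \<Rightarrow> ('a, complex) ratmap ring" where
  "function_field X = \<lparr>carrier = {rf_class X U f |U f. (U, f) \<in> rf_pairs X},
     mult = rf_lift X (*), one = rf_const X 1, zero = rf_const X 0, add = rf_lift X (+)\<rparr>"

definition derivations :: "('f, 'm) ring_scheme \<Rightarrow> 'f set \<Rightarrow> ('f \<Rightarrow> 'f) set" where
  "derivations K k = {D \<in> carrier K \<rightarrow>\<^sub>E carrier K.
     (\<forall>x\<in>carrier K. \<forall>y\<in>carrier K. D (x \<oplus>\<^bsub>K\<^esub> y) = D x \<oplus>\<^bsub>K\<^esub> D y \<and>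
        D (x \<otimes>\<^bsub>K\<^esub> y) = x \<otimes>\<^bsub>K\<^esub> D y \<oplus>\<^bsub>K\<^esub> y \<otimes>\<^bsub>K\<^esub> D x) \<and>
     (\<forall>c\<in>k. D c = \<zero>\<^bsub>K\<^esub>)}"

text \<open>
  For a finitely generated extension \<open>K / k\<close> in characteristic 0, the Kaehler differentials
  \<open>\<Omega>\<^bsub>K/k\<^esub>\<close> form a finite-dimensional \<open>K\<close>-vector space with dual the derivations, so a
  differential is determined by its values on derivations, and \<open>f dg\<close> becomes \<open>D \<mapsto> f D(g)\<close>.
  \<open>differentials K k R\<close> consists of the sums \<open>\<Sum> f\<^sub>i dg\<^sub>i\<close> with all \<open>f\<^sub>i\<close>, \<open>g\<^sub>i\<close> in \<open>R\<close>, that is, of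
  the image of \<open>\<Omega>\<^bsub>R/k\<^esub>\<close> in \<open>\<Omega>\<^bsub>K/k\<^esub>\<close>.
\<close>

definition differentials :: "('f, 'm) ring_scheme \<Rightarrow> 'f set \<Rightarrow> 'f set \<Rightarrow> (('f \<Rightarrow> 'f) \<Rightarrow> 'f) set" where
  "differentials K k R =
     {\<lambda>D\<in>derivations K k. \<Oplus>\<^bsub>K\<^esub>i\<in>{..<m}. f i \<otimes>\<^bsub>K\<^esub> D (g i) |(m::nat) f g.
        f \<in> {..<m} \<rightarrow> R \<and> g \<in> {..<m} \<rightarrow> R}"

text \<open>
  If \<open>K\<close> is a function field of one variable over the algebraically closed field \<open>k\<close>, these are the
  local rings of the points of the smooth projective curve with function field \<open>K\<close>.
\<close>

definition valuation_rings :: "('f, 'm) ring_scheme \<Rightarrow> 'f set \<Rightarrow> 'f set set" where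
  "valuation_rings K k = {R. subring R K \<and> k \<subseteq> R \<and> R \<noteq> carrier K \<and>
     (\<forall>x\<in>carrier K. x \<noteq> \<zero>\<^bsub>K\<^esub> \<longrightarrow> x \<in> R \<or> inv\<^bsub>K\<^esub> x \<in> R)}"

text \<open>The global differential forms on that smooth projective curve.\<close>

definition global_forms :: "('f, 'm) ring_scheme \<Rightarrow> 'f set \<Rightarrow> (('f \<Rightarrow> 'f) \<Rightarrow> 'f) set" where
  "global_forms K k =
     {\<omega> \<in> differentials K k (carrier K). \<forall>R\<in>valuation_rings K k. \<omega> \<in> differentials K k R}"

text \<open>The dimension over \<open>k\<close> of the space of global forms (the length of a basis \<open>b\<close>).\<close>

definition field_genus :: "('f, 'm) ring_scheme \<Rightarrow> 'f set \<Rightarrow> nat" where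
  "field_genus K k = (THE n. \<exists>b \<in> {..<n} \<rightarrow> global_forms K k.
     bij_betw (\<lambda>c. \<lambda>D\<in>derivations K k. \<Oplus>\<^bsub>K\<^esub>i\<in>{..<n}. c i \<otimes>\<^bsub>K\<^esub> b i D)
       ({..<n} \<rightarrow>\<^sub>E k) (global_forms K k))"

text \<open>The geometric genus of a curve \<open>C\<close> in \<open>X\<close>, i.e. the genus of its smooth projective model.\<close>

definition geometric_genus :: "'a variety \<Rightarrow> 'a set \<Rightarrow> nat" where
  "geometric_genus X C =
     field_genus (function_field (subvariety X C)) (range (rf_const (subvariety X C)))"


section \<open>The minimal rational surfaces\<close>

definition proj_point :: "complex^'n \<Rightarrow> (complex^'n) set" where
  "proj_point x = {c *s x |c. c \<noteq> 0}"

definition projective_space :: "(complex^'n) set variety" where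
  "projective_space = quotient_variety (subvariety affine_variety (- {0})) proj_point"

abbreviation P2 :: "(complex^3) set variety" where
  "P2 \<equiv> projective_space"

definition plane_pairs :: "(complex^4) set" where
  "plane_pairs = {v. (v $ 1 \<noteq> 0 \<or> v $ 2 \<noteq> 0) \<and> (v $ 3 \<noteq> 0 \<or> v $ 4 \<noteq> 0)}"

definition P1xP1 :: "(complex^4) set variety" where
  "P1xP1 = quotient_variety (subvariety affine_variety plane_pairs)
     (\<lambda>v. {w. \<exists>\<mu> \<rho>. \<mu> \<noteq> 0 \<and> \<rho> \<noteq> 0 \<and>
        w $ 1 = \<mu> * v $ 1 \<and> w $ 2 = \<mu> * v $ 2 \<and> w $ 3 = \<rho> * v $ 3 \<and> w $ 4 = \<rho> * v $ 4})"

text \<open>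
  The Hirzebruch surface \<open>\<bbbF>\<^sub>n = \<bbbP>(\<O> \<oplus> \<O>(n))\<close> over the projective line, as the quotient of
  \<open>(\<bbbA>\<^sup>2 - 0)\<^sup>2\<close> by a two-dimensional torus; \<open>v $ 3, v $ 4\<close> are the coordinates on the base.
\<close>

definition hirzebruch :: "nat \<Rightarrow> (complex^4) set variety" where
  "hirzebruch n = quotient_variety (subvariety affine_variety plane_pairs)
     (\<lambda>v. {w. \<exists>\<mu> \<rho>. \<mu> \<noteq> 0 \<and> \<rho> \<noteq> 0 \<and>
        w $ 1 = \<mu> * v $ 1 / \<rho> ^ n \<and> w $ 2 = \<mu> * v $ 2 \<and> w $ 3 = \<rho> * v $ 3 \<and> w $ 4 = \<rho> * v $ 4})"


section \<open>Properties (F) and (M)\<close>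

definition fixes_pointwise :: "('a, 'a) ratmap \<Rightarrow> 'a set \<Rightarrow> bool" where
  "fixes_pointwise \<phi> C \<longleftrightarrow> (\<exists>(U, f)\<in>\<phi>. U \<inter> C \<noteq> {} \<and> (\<forall>x\<in>U \<inter> C. f x = x))"

definition property_F :: "((complex^3) set, (complex^3) set) ratmap set \<Rightarrow> bool" where
  "property_F G \<longleftrightarrow> (\<forall>\<phi>\<in>G. \<phi> \<noteq> \<one>\<^bsub>Bir P2\<^esub> \<longrightarrow>
     \<not> (\<exists>C. curve_in P2 C \<and> geometric_genus P2 C > 0 \<and> fixes_pointwise \<phi> C))"

definition birationally_conjugate :: "'a variety \<Rightarrow> ('a, 'a) ratmap set \<Rightarrow>
    'b variety \<Rightarrow> ('b, 'b) ratmap set \<Rightarrow> bool" where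
  "birationally_conjugate X G Y G' \<longleftrightarrow> (\<exists>\<phi> \<psi>. birational_inverses X Y \<phi> \<psi> \<and>
     (\<lambda>g. rat_comp Y Y \<phi> (rat_comp Y X g \<psi>)) ` G = G')"

definition conjugate_to_automorphisms ::
  "((complex^3) set, (complex^3) set) ratmap set \<Rightarrow> 'b variety \<Rightarrow> bool" where
  "conjugate_to_automorphisms G S \<longleftrightarrow>
     (\<exists>G'. subgroup G' (Bir S) \<and> G' \<subseteq> Aut S \<and> birationally_conjugate P2 G S G')"

definition property_M :: "((complex^3) set, (complex^3) set) ratmap set \<Rightarrow> bool" where
  "property_M G \<longleftrightarrow> conjugate_to_automorphisms G P2 \<or> conjugate_to_automorphisms G P1xP1 \<or>
     (\<exists>n\<ge>2. conjugate_to_automorphisms G (hirzebruch n))"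


section \<open>Quadratic birational transformations\<close>

text \<open>
  A triple of quadratic forms is encoded by its coefficients \<open>c $ (i, j, k)\<close>, symmetric in \<open>j\<close> and
  \<open>k\<close>, so that each triple has exactly one coefficient vector. The symmetric vectors form a linear
  subspace of dimension 18.
\<close>

definition symmetric_coeffs :: "complex^(3 \<times> 3 \<times> 3) \<Rightarrow> bool" where
  "symmetric_coeffs c \<longleftrightarrow> (\<forall>i j k. c $ (i, j, k) = c $ (i, k, j))"

definition quadratic_forms :: "complex^(3 \<times> 3 \<times> 3) \<Rightarrow> complex^3 \<Rightarrow> complex^3" where
  "quadratic_forms c x = (\<chi> i. \<Sum>j\<in>UNIV. \<Sum>k\<in>UNIV. c $ (i, j, k) * x $ j * x $ k)"

definition no_common_factor :: "(complex^3 \<Rightarrow> complex^3) \<Rightarrow> bool" where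
  "no_common_factor F \<longleftrightarrow> (\<forall>h g. polynomial_fun h \<and> (\<forall>i. polynomial_fun (g i)) \<and>
     (\<forall>i x. F x $ i = h x * g i x) \<longrightarrow> (\<exists>a. \<forall>x. h x = a))"

text \<open>The rational map \<open>[x] \<mapsto> [F x]\<close>, defined where \<open>F x \<noteq> 0\<close>.\<close>

definition plane_map :: "(complex^3 \<Rightarrow> complex^3) \<Rightarrow> ((complex^3) set, (complex^3) set) ratmap" where
  "plane_map F = {(V, g) \<in> partial_morphisms P2 P2.
     \<forall>x. proj_point x \<in> V \<and> F x \<noteq> 0 \<longrightarrow> g (proj_point x) = proj_point (F x)}"

text \<open>
  The variety of birational transformations of degree exactly 2, as a locally closed subset of the
  projective space of coefficients (a 17-dimensional linear subspace of the full one).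
\<close>

definition quadratic_birational :: "(complex^(3 \<times> 3 \<times> 3)) set set" where
  "quadratic_birational = {proj_point c |c. symmetric_coeffs c \<and>
     no_common_factor (quadratic_forms c) \<and> plane_map (quadratic_forms c) \<in> carrier (Bir P2)}"

definition quadratic_topology :: "(complex^(3 \<times> 3 \<times> 3)) set topology" where
  "quadratic_topology = subtopology (zar projective_space) quadratic_birational"

text \<open>
  Countable unions of proper subvarieties: a proper closed subset is a finite union of irreducible
  ones, so nothing changes if the \<open>Z i\<close> are required to be irreducible.
\<close>

definition very_general :: "'a topology \<Rightarrow> ('a \<Rightarrow> bool) \<Rightarrow> bool" where
  "very_general T P \<longleftrightarrow> (\<exists>Z :: nat \<Rightarrow> 'a set. (\<forall>i. closedin T (Z i) \<and> Z i \<noteq> topspace T) \<and>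
     (\<forall>x \<in> topspace T - (\<Union>i. Z i). P x))"

end

theory Submission
  imports Defs
    "HOL-Computational_Algebra.Field_as_Ring"
    "HOL-Computational_Algebra.Polynomial_Factorial"
    "HOL-Computational_Algebra.Fundamental_Theorem_Algebra"
    "Jordan_Normal_Form.Determinant"
begin

text \<open>
  Let \<open>f = [F]\<close> be a quadratic birational map and \<open>F\<^sub>n\<close> the \<open>n\<close>-th iterate of the triple of forms
  \<open>F\<close>. If no point \<open>x\<close> of the line \<open>x + y = 5 z\<close> has \<open>F\<^sub>n x\<close> proportional to \<open>x\<close> (or zero), then
  the same holds for almost all lines \<open>x + y = \<kappa> z\<close>, because this is the non-vanishing of a
  resultant that is polynomial in \<open>\<kappa>\<close>. Hence \<open>F\<^sub>n\<close> has no common factor, so \<open>f\<^sup>n\<close> has degree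
  exactly \<open>2\<^sup>n\<close>, and the fixed points of \<open>f\<^sup>n\<close> and of \<open>f\<^sup>-\<^sup>n\<close> lie on finitely many lines of the pencil
  and contain no curve at all. The resultant is also polynomial in the coefficients of \<open>F\<close>, and it is
  nonzero for the map \<open>(x, y) \<mapsto> (y, x + y\<^sup>2)\<close>, whose periodic points are bounded by \<open>2\<close>. So
  countably many proper closed subsets are excluded.

  An automorphism of a minimal rational surface lifts to a polynomial map of its Cox ring, which is
  equivariant up to an automorphism of the torus; comparing weights bounds its degree by a constant
  depending on the surface only. If \<open>f\<close> were conjugate to such an automorphism, the degrees of all
  \<open>f\<^sup>n\<close> would be bounded.
\<close>

no_notation vec_index (infixl "$" 100)
hide_const (open) up_ring.coeff up_ring.monom module.smult
hide_fact (open) Matrix.vec_eq_iff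

section \<open>Polynomial functions\<close>

text \<open>All lines of the pencil, the line \<open>z = 0\<close> included, pass through
  \<open>[1:-1:0]\<close>. This turns finitely many lines into no curve: an irreducible curve of
  fixed points lies in one of them, but the common point also lies on \<open>x + y = 5 z\<close> and
  so is not fixed, and a closed subset of a line that misses a point of the line is finite.

  Zeros of \<open>F\<^sub>n\<close> are counted as fixed points. This makes the condition polynomial
  in the coefficients, and it lets one resultant control both the fixed points of
  \<open>f\<^sup>n\<close>, for property (F), and its base points, for the degree and hence for
  property (M).

  The exceptional sets differ with \<open>n\<close>, but a single map shows that all of them are
  proper. The Henon map does so because its periodic points are bounded uniformly in
  \<open>n\<close>: they satisfy \<open>|x + y| <= 4\<close>, so that the one line with
  \<open>\<kappa> = 5\<close> serves for every \<open>n\<close>.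

  Negative powers are handled without forms for the inverse: a fixed point of
  \<open>f\<^sup>-\<^sup>n\<close> is shown to be one of \<open>F\<^sub>n\<close>.\<close>

lemma polynomial_fun_sum:
  "(\<And>i. i \<in> I \<Longrightarrow> polynomial_fun (f i)) \<Longrightarrow> polynomial_fun (\<lambda>x. \<Sum>i\<in>I. f i x)"
  by (induction I rule: infinite_finite_induct) (auto intro: polynomial_fun.intros)

lemma polynomial_fun_prod:
  "(\<And>i. i \<in> I \<Longrightarrow> polynomial_fun (f i)) \<Longrightarrow> polynomial_fun (\<lambda>x. \<Prod>i\<in>I. f i x)"
  by (induction I rule: infinite_finite_induct) (auto intro: polynomial_fun.intros)

lemma polynomial_fun_uminus: "polynomial_fun p \<Longrightarrow> polynomial_fun (\<lambda>x. - p x)"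
  using polynomial_fun.mult[OF polynomial_fun.const[of "-1"], of p] by simp

lemma polynomial_fun_diff:
  "polynomial_fun p \<Longrightarrow> polynomial_fun q \<Longrightarrow> polynomial_fun (\<lambda>x. p x - q x)"
  using polynomial_fun.add[OF _ polynomial_fun_uminus, of p q] by simp

lemma polynomial_fun_power: "polynomial_fun p \<Longrightarrow> polynomial_fun (\<lambda>x. p x ^ n)"
  by (induction n) (auto intro: polynomial_fun.intros)

lemma polynomial_fun_comp:
  assumes "polynomial_fun p" "\<And>i. polynomial_fun (\<lambda>x. g x $ i)"
  shows "polynomial_fun (\<lambda>x. p (g x))"
  using assms(1) by induction (auto intro: polynomial_fun.intros assms(2))

lemmas polynomial_fun_intros = polynomial_fun.intros polynomial_fun_sum polynomial_fun_prod
  polynomial_fun_uminus polynomial_fun_diff polynomial_fun_power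

definition polynomial_map :: "(complex^'n \<Rightarrow> complex^'m) \<Rightarrow> bool" where
  "polynomial_map g \<longleftrightarrow> (\<forall>i. polynomial_fun (\<lambda>x. g x $ i))"

lemma polynomial_map_comp_fun:
  "polynomial_fun p \<Longrightarrow> polynomial_map g \<Longrightarrow> polynomial_fun (\<lambda>x. p (g x))"
  unfolding polynomial_map_def by (rule polynomial_fun_comp) auto

lemma polynomial_map_comp: "polynomial_map f \<Longrightarrow> polynomial_map g \<Longrightarrow> polynomial_map (\<lambda>x. f (g x))"
  using polynomial_map_comp_fun[of "\<lambda>x. f x $ i" g for i] by (auto simp: polynomial_map_def)

section \<open>Degree bounds and restriction to lines\<close>

text \<open>A polynomial function carries no preferred expression, so only upper bounds of its
  degree are recorded. Lower bounds come from univariate polynomials, after restriction to a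
  line.\<close>

inductive poly_deg_le :: "nat \<Rightarrow> (complex^'n \<Rightarrow> complex) \<Rightarrow> bool" where
  const: "poly_deg_le d (\<lambda>x. c)"
| coord: "1 \<le> d \<Longrightarrow> poly_deg_le d (\<lambda>x. x $ i)"
| add: "poly_deg_le d p \<Longrightarrow> poly_deg_le d q \<Longrightarrow> poly_deg_le d (\<lambda>x. p x + q x)"
| mult: "poly_deg_le d p \<Longrightarrow> poly_deg_le e q \<Longrightarrow> d + e \<le> k \<Longrightarrow> poly_deg_le k (\<lambda>x. p x * q x)"

lemma poly_deg_le_mono: "poly_deg_le d p \<Longrightarrow> d \<le> e \<Longrightarrow> poly_deg_le e p"
proof (induction arbitrary: e rule: poly_deg_le.induct)
  case (mult d p d' q k)
  then show ?case using poly_deg_le.mult[OF mult(1,2) order_trans[OF mult(3)]] by simp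
qed (auto intro: poly_deg_le.intros)

lemma poly_deg_le_polynomial_fun: "poly_deg_le d p \<Longrightarrow> polynomial_fun p"
  by (induction rule: poly_deg_le.induct) (auto intro: polynomial_fun.intros)

lemma polynomial_fun_poly_deg_le: "polynomial_fun p \<Longrightarrow> \<exists>d. poly_deg_le d p"
proof (induction rule: polynomial_fun.induct)
  case (add p q)
  then obtain d e where "poly_deg_le d p" "poly_deg_le e q" by blast
  then show ?case
    by (intro exI[of _ "max d e"] poly_deg_le.add) (auto elim: poly_deg_le_mono)
qed (blast intro: poly_deg_le.intros order_refl)+

lemma poly_deg_le_sum:
  "(\<And>i. i \<in> I \<Longrightarrow> poly_deg_le d (f i)) \<Longrightarrow> poly_deg_le d (\<lambda>x. \<Sum>i\<in>I. f i x)"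
  by (induction I rule: infinite_finite_induct) (auto intro: poly_deg_le.intros)

lemma poly_deg_le_prod:
  "(\<And>i. i \<in> I \<Longrightarrow> poly_deg_le (d i) (f i)) \<Longrightarrow> poly_deg_le (\<Sum>i\<in>I. d i) (\<lambda>x. \<Prod>i\<in>I. f i x)"
  by (induction I rule: infinite_finite_induct)
    (auto intro: poly_deg_le.const poly_deg_le.mult[OF _ _ order_refl])

lemma poly_deg_le_power: "poly_deg_le d p \<Longrightarrow> poly_deg_le (k * d) (\<lambda>x. p x ^ k)"
  by (induction k) (auto intro: poly_deg_le.const poly_deg_le.mult[OF _ _ order_refl])

lemma poly_deg_le_comp:
  assumes "poly_deg_le d p" "\<And>i. poly_deg_le e (\<lambda>x. g x $ i)"
  shows "poly_deg_le (d * e) (\<lambda>x. p (g x))"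
  using assms(1)
proof induction
  case (coord d i)
  then have "e \<le> d * e" by simp
  then show ?case using poly_deg_le_mono[OF assms(2)] by blast
next
  case (mult d p d' q k)
  then have "d * e + d' * e \<le> k * e" by (metis add_mult_distrib mult_le_mono1)
  then show ?case using mult by (auto intro: poly_deg_le.mult)
qed (auto intro: poly_deg_le.intros)

text \<open>The bridge to \<open>complex poly\<close>: along a line, finiteness of roots, the
  fundamental theorem of algebra and divisibility become available.\<close>

lemma poly_deg_le_line:
  assumes "poly_deg_le d p"
  shows "\<exists>P. degree P \<le> d \<and> (\<forall>t. p (a + t *s b) = poly P t)"
  using assms
proof induction
  case (const d c)
  show ?case by (rule exI[of _ "[:c:]"]) simp
next
  case (coord d i)
  then show ?case by (intro exI[of _ "[:a $ i, b $ i:]"]) (auto simp: mult.commute)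
next
  case (add d p q)
  then obtain P Q where "degree P \<le> d" "\<forall>t. p (a + t *s b) = poly P t"
    "degree Q \<le> d" "\<forall>t. q (a + t *s b) = poly Q t" by auto
  then show ?case by (intro exI[of _ "P + Q"]) (auto intro: degree_add_le)
next
  case (mult d p e q k)
  then obtain P Q where "degree P \<le> d" "\<forall>t. p (a + t *s b) = poly P t"
    "degree Q \<le> e" "\<forall>t. q (a + t *s b) = poly Q t" by auto
  then show ?case using degree_mult_le[of P Q] mult(3)
    by (intro exI[of _ "P * Q"]) auto
qed

lemma polynomial_fun_line:
  "polynomial_fun p \<Longrightarrow> \<exists>P. \<forall>t. p (a + t *s b) = poly P t"
  using polynomial_fun_poly_deg_le poly_deg_le_line by meson

text \<open>On the line through \<open>a\<close> and \<open>b\<close> both functions are nonzero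
  univariate polynomials, one by its value at 0 and the other by its value at 1, and the product of
  two such has only finitely many roots. This is the irreducibility of affine space.\<close>

lemma polynomial_fun_mult_nonzero:
  assumes "polynomial_fun p" "polynomial_fun q" "p a \<noteq> 0" "q b \<noteq> 0"
  shows "\<exists>x. p x \<noteq> 0 \<and> q x \<noteq> 0"
proof -
  obtain P Q where P: "\<forall>t. p (a + t *s (b - a)) = poly P t" and Q: "\<forall>t. q (a + t *s (b - a)) = poly Q t"
    using polynomial_fun_line assms by meson
  have "poly P 0 \<noteq> 0" "poly Q 1 \<noteq> 0"
    using P[rule_format, of 0, symmetric] Q[rule_format, of 1, symmetric] assms by auto
  then have "P * Q \<noteq> 0" by auto
  then have "finite {t. poly (P * Q) t = 0}" by (rule poly_roots_finite)
  then obtain t where "poly (P * Q) t \<noteq> 0"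
    using infinite_UNIV_char_0[where 'a = complex] by (metis (mono_tags) UNIV_I finite_subset mem_Collect_eq subsetI)
  then show ?thesis using P Q by (intro exI[of _ "a + t *s (b - a)"]) auto
qed

section \<open>Zariski open sets and the identity principle\<close>

lemma openin_zariski_iff:
  "openin zariski U \<longleftrightarrow> (\<forall>x\<in>U. \<exists>p. polynomial_fun p \<and> p x \<noteq> 0 \<and> (\<forall>y. p y \<noteq> 0 \<longrightarrow> y \<in> U))"
proof
  assume "openin zariski U"
  then show "\<forall>x\<in>U. \<exists>p. polynomial_fun p \<and> p x \<noteq> 0 \<and> (\<forall>y. p y \<noteq> 0 \<longrightarrow> y \<in> U)"
    unfolding openin_zariski by blast
next
  assume "\<forall>x\<in>U. \<exists>p. polynomial_fun p \<and> p x \<noteq> 0 \<and> (\<forall>y. p y \<noteq> 0 \<longrightarrow> y \<in> U)"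
  then show "openin zariski U"
    unfolding openin_zariski
    by (intro exI[of _ "{p. polynomial_fun p \<and> (\<forall>y. p y \<noteq> 0 \<longrightarrow> y \<in> U)}"]) blast
qed

lemma topspace_zariski [simp]: "topspace zariski = UNIV"
proof -
  have "openin zariski (UNIV :: (complex^'n) set)"
    unfolding openin_zariski_iff by (auto intro!: exI[of _ "\<lambda>_. 1"] polynomial_fun.const)
  then show ?thesis by (metis openin_subset top.extremum_uniqueI)
qed

lemma openin_zariski_nonzero: "polynomial_fun p \<Longrightarrow> openin zariski {x. p x \<noteq> 0}"
  unfolding openin_zariski_iff by blast

lemma zariski_opens_meet:
  assumes "openin zariski U" "openin zariski V" "U \<noteq> {}" "V \<noteq> {}"
  shows "U \<inter> V \<noteq> {}"
proof -
  obtain p a where p: "polynomial_fun p" "p a \<noteq> 0" "\<And>y. p y \<noteq> 0 \<Longrightarrow> y \<in> U"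
    using assms openin_zariski_iff[of U] by (metis ex_in_conv)
  obtain q b where q: "polynomial_fun q" "q b \<noteq> 0" "\<And>y. q y \<noteq> 0 \<Longrightarrow> y \<in> V"
    using assms openin_zariski_iff[of V] by (metis ex_in_conv)
  show ?thesis using polynomial_fun_mult_nonzero[OF p(1) q(1) p(2) q(2)] p(3) q(3) by blast
qed

lemma polynomial_fun_eq_on_open:
  assumes "openin zariski U" "U \<noteq> {}" "polynomial_fun p" "polynomial_fun q" "\<And>x. x \<in> U \<Longrightarrow> p x = q x"
  shows "p x = q x"
proof (rule ccontr)
  assume "p x \<noteq> q x"
  then have "{x. p x - q x \<noteq> 0} \<noteq> {}" by auto
  then show False
    using zariski_opens_meet[OF assms(1) openin_zariski_nonzero[OF polynomial_fun_diff[OF assms(3,4)]] assms(2)]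
      assms(5) by auto
qed

lemma openin_zariski_vimage:
  assumes "openin zariski U" "polynomial_map g"
  shows "openin zariski {x. g x \<in> U}"
  unfolding openin_zariski_iff
proof
  fix x assume "x \<in> {x. g x \<in> U}"
  then obtain p where "polynomial_fun p" "p (g x) \<noteq> 0" "\<forall>y. p y \<noteq> 0 \<longrightarrow> y \<in> U"
    using assms(1) openin_zariski_iff[of U] by auto
  then show "\<exists>p. polynomial_fun p \<and> p x \<noteq> 0 \<and> (\<forall>y. p y \<noteq> 0 \<longrightarrow> y \<in> {x. g x \<in> U})"
    using polynomial_map_comp_fun[OF _ assms(2), of p] by (intro exI[of _ "\<lambda>x. p (g x)"]) auto
qed

text \<open>A univariate polynomial without roots is constant over the complex numbers.\<close>

lemma nowhere_zero_on_line_eq: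
  assumes "polynomial_fun p" "\<And>t. p (a + t *s (b - a)) \<noteq> 0"
  shows "p a = p b"
proof -
  obtain P where P: "\<forall>t. p (a + t *s (b - a)) = poly P t" using polynomial_fun_line assms by meson
  then have "constant (poly P)"
    using assms(2) fundamental_theorem_of_algebra[of P] by metis
  then have "poly P 0 = poly P 1" by (simp add: constant_def)
  then show ?thesis using P[rule_format, of 0] P[rule_format, of 1] by simp
qed

text \<open>The complement of finitely many codimension-two coordinate subspaces: any two of its points
  can be joined inside it by two lines.\<close>

lemma nowhere_zero_imp_const:
  fixes p :: "complex^'n \<Rightarrow> complex"
  assumes p: "polynomial_fun p" and P: "finite P" "\<And>i j. (i, j) \<in> P \<Longrightarrow> i \<noteq> j"
    and nz: "\<And>x. (\<And>i j. (i, j) \<in> P \<Longrightarrow> x $ i \<noteq> 0 \<or> x $ j \<noteq> 0) \<Longrightarrow> p x \<noteq> 0"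
    and a: "\<And>i j. (i, j) \<in> P \<Longrightarrow> a $ i \<noteq> 0 \<or> a $ j \<noteq> 0"
    and b: "\<And>i j. (i, j) \<in> P \<Longrightarrow> b $ i \<noteq> 0 \<or> b $ j \<noteq> 0"
  shows "p a = p b"
proof -
  \<comment> \<open>\<open>L a c i j\<close> is the minor of \<open>a\<close> and \<open>c\<close>
    in the columns \<open>i\<close>, \<open>j\<close>. If it is nonzero, the line through
    \<open>a\<close> and \<open>c\<close> avoids the subspace where both coordinates vanish. So it
    is enough to find \<open>c\<close> with finitely many nonzero minors; the conditions are added
    one pair at a time.\<close>
  define L where "L a c i j = a $ i * c $ j - a $ j * c $ i" for a c :: "complex^'n" and i j
  have ex: "\<exists>c. \<forall>(i,j)\<in>Q. L a c i j \<noteq> 0 \<and> L b c i j \<noteq> 0" if "Q \<subseteq> P" for Q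
    using finite_subset[OF that P(1)] that
  proof (induction Q rule: finite_induct)
    case (insert ij Q)
    obtain i j where ij: "ij = (i, j)" by (cases ij)
    have [simp]: "i \<noteq> j" using P(2) insert ij by auto
    let ?q = "\<lambda>c. \<Prod>(i,j)\<in>Q. L a c i j * L b c i j"
    have pl: "polynomial_fun (\<lambda>c. L d c i j)" for d i j
      unfolding L_def by (intro polynomial_fun_intros)
    have q: "polynomial_fun ?q" by (auto intro!: polynomial_fun_prod polynomial_fun.mult pl)
    obtain c where c: "?q c \<noteq> 0" using insert by (auto simp: prod_zero_iff insert(1) split: prod.splits)
    have e: "\<exists>c. L d c i j \<noteq> 0" if "d $ i \<noteq> 0 \<or> d $ j \<noteq> 0" for d
    proof (cases "d $ i = 0")
      case True
      then show ?thesis using that by (intro exI[of _ "axis i 1"]) (auto simp: L_def axis_def)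
    next
      case False
      then show ?thesis using \<open>i \<noteq> j\<close> by (intro exI[of _ "axis j 1"]) (auto simp: L_def axis_def)
    qed
    have "(i, j) \<in> P" using insert ij by auto
    then obtain c1 c2 where "L a c1 i j \<noteq> 0" "L b c2 i j \<noteq> 0" using e a b by metis
    then obtain c3 where "L a c3 i j \<noteq> 0" "L b c3 i j \<noteq> 0"
      using polynomial_fun_mult_nonzero[OF pl pl] by meson
    then have "L a c3 i j * L b c3 i j \<noteq> 0" by simp
    from polynomial_fun_mult_nonzero[OF polynomial_fun.mult[OF pl pl] q this c]
    obtain c4 where "L a c4 i j * L b c4 i j \<noteq> 0" "?q c4 \<noteq> 0" by blast
    then show ?case using ij insert(1) by (intro exI[of _ c4]) (auto simp: prod_zero_iff)
  qed auto
  obtain c where c: "\<And>i j. (i,j) \<in> P \<Longrightarrow> L a c i j \<noteq> 0 \<and> L b c i j \<noteq> 0" using ex[of P] by auto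
  have "p d = p c" if "\<And>i j. (i,j) \<in> P \<Longrightarrow> L d c i j \<noteq> 0" for d
  proof (rule nowhere_zero_on_line_eq[OF p nz])
    fix t i j assume ij: "(i, j) \<in> P"
    show "(d + t *s (c - d)) $ i \<noteq> 0 \<or> (d + t *s (c - d)) $ j \<noteq> 0"
    proof (rule ccontr)
      assume "\<not> ?thesis"
      then have *: "d $ i + t * (c $ i - d $ i) = 0" "d $ j + t * (c $ j - d $ j) = 0"
        by (simp_all only: vector_add_component vector_smult_component vector_minus_component de_Morgan_disj not_not)
      have "t * L d c i j = d $ i * (d $ j + t * (c $ j - d $ j)) - d $ j * (d $ i + t * (c $ i - d $ i))"
        by (simp add: L_def algebra_simps)
      then have "t = 0" using * that[OF ij] by auto
      then show False using * that[OF ij] by (auto simp: L_def)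
    qed
  qed
  then show ?thesis using c by metis
qed

section \<open>Monomial expansions and semi-invariants\<close>

definition monomial_fun :: "('n::finite \<Rightarrow> nat) \<Rightarrow> complex^'n \<Rightarrow> complex" where
  "monomial_fun e x = (\<Prod>i\<in>UNIV. x $ i ^ e i)"

lemma monomial_fun_mult: "monomial_fun e x * monomial_fun f x = monomial_fun (\<lambda>i. e i + f i) x"
  by (simp add: monomial_fun_def prod.distrib power_add)

lemma polynomial_fun_expansion:
  fixes p :: "complex^'n \<Rightarrow> complex"
  assumes "polynomial_fun p"
  shows "\<exists>E c. finite E \<and> (\<forall>x. p x = (\<Sum>e\<in>E. c e * monomial_fun e x))"
  using assms
proof induction
  case (const c)
  show ?case by (rule exI[of _ "{\<lambda>_. 0}"], rule exI[of _ "\<lambda>_. c"]) (simp add: monomial_fun_def)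
next
  case (coord i)
  have "monomial_fun (\<lambda>j. if j = i then 1 else 0) x = x $ i" for x
    unfolding monomial_fun_def by (subst prod.remove[of _ i]) (auto)
  then show ?case by (intro exI[of _ "{\<lambda>j. if j = i then 1 else 0}"] exI[of _ "\<lambda>_. 1"]) simp
next
  case (add p q)
  then obtain E c F d where *: "finite E" "\<forall>x. p x = (\<Sum>e\<in>E. c e * monomial_fun e x)"
    "finite F" "\<forall>x. q x = (\<Sum>e\<in>F. d e * monomial_fun e x)" by blast
  have "(\<Sum>e\<in>E. c e * monomial_fun e x) = (\<Sum>e\<in>E\<union>F. (if e \<in> E then c e else 0) * monomial_fun e x)" for x
    using * by (intro sum.mono_neutral_cong_left) auto
  moreover have "(\<Sum>e\<in>F. d e * monomial_fun e x) = (\<Sum>e\<in>E\<union>F. (if e \<in> F then d e else 0) * monomial_fun e x)" for x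
    using * by (intro sum.mono_neutral_cong_left) auto
  ultimately show ?case using *
    by (intro exI[of _ "E \<union> F"] exI[of _ "\<lambda>e. (if e \<in> E then c e else 0) + (if e \<in> F then d e else 0)"])
      (auto simp: sum.distrib algebra_simps)
next
  case (mult p q)
  then obtain E c F d where *: "finite E" "\<forall>x. p x = (\<Sum>e\<in>E. c e * monomial_fun e x)"
    "finite F" "\<forall>x. q x = (\<Sum>e\<in>F. d e * monomial_fun e x)" by blast
  let ?h = "\<lambda>(e, f) i. e i + f i :: nat"
  let ?g = "\<lambda>(e, f). c e * d f"
  \<comment> \<open>Different pairs of exponents can have the same sum, so the coefficients are
    collected over the fibres of \<open>?h\<close>.\<close>
  have "p x * q x = (\<Sum>e\<in>?h ` (E \<times> F). (\<Sum>ef\<in>{ef \<in> E \<times> F. ?h ef = e}. ?g ef) * monomial_fun e x)" for x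
  proof -
    have "p x * q x = (\<Sum>ef\<in>E \<times> F. ?g ef * monomial_fun (?h ef) x)"
      using * by (simp add: sum_product sum.cartesian_product split_def monomial_fun_mult[symmetric] algebra_simps)
    also have "\<dots> = (\<Sum>e\<in>?h ` (E \<times> F). \<Sum>ef\<in>{ef \<in> E \<times> F. ?h ef = e}. ?g ef * monomial_fun (?h ef) x)"
      using * by (intro sum.image_gen) auto
    also have "\<dots> = (\<Sum>e\<in>?h ` (E \<times> F). (\<Sum>ef\<in>{ef \<in> E \<times> F. ?h ef = e}. ?g ef) * monomial_fun e x)"
      unfolding sum_distrib_right by (intro sum.cong refl) auto
    finally show ?thesis .
  qed
  then show ?case using *
    by (intro exI[of _ "?h ` (E \<times> F)"] exI[of _ "\<lambda>e. \<Sum>ef\<in>{ef \<in> E \<times> F. ?h ef = e}. ?g ef"]) auto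
qed

lemma two_power_eq_iff: "(2::complex) ^ m = 2 ^ n \<longleftrightarrow> m = n"
proof -
  have "(2::complex) ^ m = 2 ^ n \<longleftrightarrow> (2::nat) ^ m = 2 ^ n"
    by (metis of_nat_eq_iff of_nat_numeral of_nat_power)
  then show ?thesis by simp
qed

text \<open>Distinct monomials are distinct characters of the multiplicative monoid of vectors, so Artin's
  argument applies.\<close>

lemma monomial_fun_independent:
  assumes "finite E" "\<And>x. (\<Sum>e\<in>E. c e * monomial_fun e x) = 0" "e \<in> E"
  shows "c e = 0"
  using assms
proof (induction E arbitrary: c e rule: finite_induct)
  case (insert f E)
  have ml: "monomial_fun e (\<chi> i. x $ i * y $ i) = monomial_fun e x * monomial_fun e y"
    for e :: "'a \<Rightarrow> nat" and x y
    by (simp add: monomial_fun_def power_mult_distrib prod.distrib)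
  have E0: "c e = 0" if e: "e \<in> E" for e
  proof -
    have "e \<noteq> f" using insert e by auto
    then obtain i where i: "e i \<noteq> f i" by blast
    \<comment> \<open>Doubling the \<open>i\<close>-th coordinate multiplies the monomials
      \<open>e\<close> and \<open>f\<close> by different powers of 2. Subtracting
      \<open>2 ^ f i\<close> times the original relation removes \<open>f\<close>, and the induction
      hypothesis applies.\<close>
    define y :: "complex^'a" where "y = (\<chi> j. if j = i then 2 else 1)"
    have y: "monomial_fun e y = 2 ^ e i" for e
      unfolding monomial_fun_def y_def by (subst prod.remove[of _ i]) auto
    have "(\<Sum>e\<in>E. (c e * (2 ^ e i - 2 ^ f i)) * monomial_fun e x) = 0" for x
    proof -
      have "(\<Sum>e\<in>insert f E. c e * monomial_fun e (\<chi> i. x $ i * y $ i)) - 2 ^ f i * (\<Sum>e\<in>insert f E. c e * monomial_fun e x) = 0"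
        using insert(4) by simp
      then show ?thesis using insert(1,2)
        by (simp add: ml y algebra_simps sum_subtractf sum_distrib_left)
    qed
    from insert(3)[OF this e] have "c e * (2 ^ e i - 2 ^ f i) = 0" .
    then show ?thesis using i by (simp add: two_power_eq_iff)
  qed
  then have "c f * monomial_fun f x = 0" for x using insert.prems(1)[of x] insert.hyps by simp
  from this[of "\<chi> i. 1"] have "c f = 0" by (simp add: monomial_fun_def)
  then show ?case using E0 insert by auto
qed simp

lemma polynomial_fun_expansion_supp:
  assumes "polynomial_fun p"
  shows "\<exists>E c. finite E \<and> (\<forall>e\<in>E. c e \<noteq> 0) \<and> (\<forall>x. p x = (\<Sum>e\<in>E. c e * monomial_fun e x))"
proof -
  obtain E c where *: "finite E" "\<forall>x. p x = (\<Sum>e\<in>E. c e * monomial_fun e x)"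
    using polynomial_fun_expansion assms by blast
  have "(\<Sum>e\<in>E. c e * monomial_fun e x) = (\<Sum>e\<in>{e\<in>E. c e \<noteq> 0}. c e * monomial_fun e x)" for x
    using * by (intro sum.mono_neutral_right) auto
  then show ?thesis using * by (intro exI[of _ "{e\<in>E. c e \<noteq> 0}"] exI[of _ c]) auto
qed

text \<open>The monomials are eigenvectors of the diagonal scaling by \<open>t\<close>, and they are
  linearly independent, so every monomial that occurs has the eigenvalue of \<open>p\<close>. This
  turns equivariance into conditions on exponents.\<close>

lemma semi_invariant_support:
  assumes E: "finite E" "\<forall>e\<in>E. c e \<noteq> 0" "\<forall>x. p x = (\<Sum>e\<in>E. c e * monomial_fun e x)"
    and inv: "\<And>x. p (\<chi> i. t $ i * x $ i) = k * p x" and e: "e \<in> E"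
  shows "monomial_fun e t = k"
proof -
  have "(\<Sum>e\<in>E. (c e * (monomial_fun e t - k)) * monomial_fun e x) = 0" for x
  proof -
    have "(\<Sum>e\<in>E. c e * monomial_fun e (\<chi> i. t $ i * x $ i)) = k * (\<Sum>e\<in>E. c e * monomial_fun e x)"
      using inv[of x] E(3) by simp
    moreover have "monomial_fun e (\<chi> i. t $ i * x $ i) = monomial_fun e t * monomial_fun e x" for e
      by (simp add: monomial_fun_def power_mult_distrib prod.distrib)
    ultimately show ?thesis by (simp add: algebra_simps sum_subtractf sum_distrib_left)
  qed
  from monomial_fun_independent[OF E(1) this e] have "c e * (monomial_fun e t - k) = 0" .
  then show ?thesis using E(2) e by simp
qed

lemma poly_deg_le_expansion:
  assumes "\<forall>x. p x = (\<Sum>e\<in>E. c e * monomial_fun e x)" "\<And>e. e \<in> E \<Longrightarrow> (\<Sum>i\<in>UNIV. e i) \<le> d"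
  shows "poly_deg_le d p"
proof -
  have "poly_deg_le d (\<lambda>x. \<Sum>e\<in>E. c e * monomial_fun e x)"
  proof (rule poly_deg_le_sum)
    fix e assume e: "e \<in> E"
    have "poly_deg_le (\<Sum>i\<in>UNIV. e i * 1) (monomial_fun e)" unfolding monomial_fun_def
      by (intro poly_deg_le_prod poly_deg_le_power poly_deg_le.coord) auto
    then show "poly_deg_le d (\<lambda>x. c e * monomial_fun e x)"
      using assms(2)[OF e] by (auto intro: poly_deg_le.mult[OF poly_deg_le.const[of 0]])
  qed
  moreover have "p = (\<lambda>x. \<Sum>e\<in>E. c e * monomial_fun e x)" using assms(1) by auto
  ultimately show ?thesis by simp
qed

section \<open>Primitive families\<close>

lemma polynomial_fun_cancel:
  assumes "polynomial_fun d" "d x0 \<noteq> 0" "polynomial_fun p" "polynomial_fun q"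
    "\<And>x. d x * p x = d x * q x"
  shows "p x = q x"
  by (rule polynomial_fun_eq_on_open[OF openin_zariski_nonzero[OF assms(1)] _ assms(3,4)])
    (use assms(2,5) in auto)

text \<open>Absence of a common factor, expressed through what is needed later: a polynomial vector
  proportional to \<open>a\<close> is a polynomial multiple of \<open>a\<close>. In this form a lift
  found near one point can be compared with the lifts near all others.\<close>

definition primitive_family :: "('i \<Rightarrow> complex^'n \<Rightarrow> complex) \<Rightarrow> bool" where
  "primitive_family a \<longleftrightarrow> (\<forall>i. polynomial_fun (a i)) \<and> (\<exists>i x. a i x \<noteq> 0) \<and>
     (\<forall>g. (\<forall>i. polynomial_fun (g i)) \<and> (\<forall>i j x. a i x * g j x = a j x * g i x) \<longrightarrow>
        (\<exists>e. polynomial_fun e \<and> (\<forall>i x. g i x = e x * a i x)))"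

lemma primitive_familyD:
  assumes "primitive_family a" "\<And>i. polynomial_fun (g i)" "\<And>i j x. a i x * g j x = a j x * g i x"
  shows "\<exists>e. polynomial_fun e \<and> (\<forall>i x. g i x = e x * a i x)"
  using assms unfolding primitive_family_def by blast

lemma primitive_family_polynomial_fun: "primitive_family a \<Longrightarrow> polynomial_fun (a i)"
  by (simp add: primitive_family_def)

text \<open>Repeated binary gcds. The second clause, with its factor \<open>x\<close>, says that
  taking the gcd commutes with multiplication; \<open>ring_primitive_family\<close> and
  \<open>coprime_family_degree_le\<close> apply it in this form.\<close>

lemma finite_family_gcd:
  fixes a :: "'i \<Rightarrow> 'a::{factorial_ring_gcd,semiring_gcd_mult_normalize}"
  assumes "finite I"
  shows "\<exists>d. (\<forall>i\<in>I. d dvd a i) \<and> (\<forall>c x. (\<forall>i\<in>I. c dvd a i * x) \<longrightarrow> c dvd d * x)"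
  using assms
proof (induction I rule: finite_induct)
  case empty
  show ?case by (rule exI[of _ 0]) auto
next
  case (insert i I)
  then obtain d where d: "\<forall>i\<in>I. d dvd a i" "\<forall>c x. (\<forall>i\<in>I. c dvd a i * x) \<longrightarrow> c dvd d * x" by blast
  have "c dvd gcd (a i) d * x" if "\<forall>j\<in>insert i I. c dvd a j * x" for c x
  proof -
    have "c dvd gcd (a i * x) (d * x)" using that d(2) by (intro gcd_greatest) auto
    then have "c dvd normalize x * gcd (a i) d"
      by (simp add: gcd_mult_distrib' mult.commute)
    moreover have "normalize x * gcd (a i) d dvd x * gcd (a i) d" by (intro mult_dvd_mono) auto
    ultimately show ?thesis by (metis dvd_trans mult.commute)
  qed
  then show ?case using d(1)
    by (intro exI[of _ "gcd (a i) d"]) (auto intro: dvd_trans[OF gcd_dvd2])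
qed

text \<open>\<open>d\<close> is the gcd of the family. By the cross relations
  \<open>d * a' k\<close> divides every \<open>a j * g k\<close>, hence also \<open>d * g k\<close>;
  cancelling \<open>d\<close> shows that \<open>a' k\<close> divides \<open>g k\<close>, and the
  quotient is \<open>e\<close>.\<close>

lemma ring_primitive_family:
  fixes a :: "'i::finite \<Rightarrow> 'a::{factorial_ring_gcd,semiring_gcd_mult_normalize}"
  assumes "a k \<noteq> 0"
  shows "\<exists>d a'. d \<noteq> 0 \<and> (\<forall>i. a i = d * a' i) \<and>
    (\<forall>g. (\<forall>i j. a' i * g j = a' j * g i) \<longrightarrow> (\<exists>e. \<forall>i. g i = e * a' i))"
proof -
  obtain d where d: "\<forall>i. d dvd a i" "\<forall>c x. (\<forall>i. c dvd a i * x) \<longrightarrow> c dvd d * x"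
    using finite_family_gcd[of UNIV a] by auto
  from d(1) obtain a' where a': "\<And>i. a i = d * a' i" unfolding dvd_def by metis
  have d0: "d \<noteq> 0" and k: "a' k \<noteq> 0" using a'[of k] assms by auto
  have "\<exists>e. \<forall>i. g i = e * a' i" if g: "\<forall>i j. a' i * g j = a' j * g i" for g
  proof -
    have "d * a' k dvd a j * g k" for j
      using g[rule_format, of j k] by (simp add: a' mult.assoc)
    then have "d * a' k dvd d * g k" using d(2) by blast
    then obtain e where e: "g k = a' k * e" using d0 by (auto elim: dvdE)
    have "a' k * g j = a' k * (e * a' j)" for j
      using g[rule_format, of j k] e by (auto simp: ac_simps)
    then show ?thesis using k by auto
  qed
  then show ?thesis using d0 a' by blast
qed

section \<open>The polynomial ring in four variables\<close>

lemma vector_4: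
  "(vector [a, b, c, d] :: 'a::zero^4) $ 1 = a" "(vector [a, b, c, d] :: 'a^4) $ 2 = b"
  "(vector [a, b, c, d] :: 'a^4) $ 3 = c" "(vector [a, b, c, d] :: 'a^4) $ 4 = d"
  by (simp_all add: vector_def)

text \<open>The iterated type \<open>complex poly poly poly poly\<close> inherits unique
  factorization and gcds from its coefficients, and \<open>eval1\<close> to \<open>eval4\<close>
  translate it into functions. The outermost variable stands for \<open>x $ 1\<close>, the innermost
  for \<open>x $ 4\<close>.\<close>

definition eval1 :: "complex poly \<Rightarrow> complex^4 \<Rightarrow> complex" where
  "eval1 p x = poly p (x $ 4)"
definition eval2 :: "complex poly poly \<Rightarrow> complex^4 \<Rightarrow> complex" where
  "eval2 p x = eval1 (poly p [:x $ 3:]) x"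
definition eval3 :: "complex poly poly poly \<Rightarrow> complex^4 \<Rightarrow> complex" where
  "eval3 p x = eval2 (poly p [:[:x $ 2:]:]) x"
definition eval4 :: "complex poly poly poly poly \<Rightarrow> complex^4 \<Rightarrow> complex" where
  "eval4 p x = eval3 (poly p [:[:[:x $ 1:]:]:]) x"

lemmas eval_defs = eval1_def eval2_def eval3_def eval4_def

lemma eval4_hom: "eval4 (p + q) x = eval4 p x + eval4 q x" "eval4 (p * q) x = eval4 p x * eval4 q x"
  "eval4 0 x = 0"
  by (simp_all add: eval_defs)

lemma polynomial_fun_eval1: "polynomial_fun (eval1 p)"
proof (induction p)
  case (pCons a p)
  have "eval1 (pCons a p) = (\<lambda>x. a + x $ 4 * eval1 p x)" by (auto simp: eval_defs)
  then show ?case using pCons by (auto intro!: polynomial_fun.intros)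
qed (auto simp: eval_defs intro: polynomial_fun.const)

lemma polynomial_fun_eval2: "polynomial_fun (eval2 p)"
proof (induction p)
  case (pCons a p)
  have "eval2 (pCons a p) = (\<lambda>x. eval1 a x + x $ 3 * eval2 p x)" by (auto simp: eval_defs)
  then show ?case using pCons polynomial_fun_eval1 by (auto intro!: polynomial_fun.intros)
qed (auto simp: eval_defs intro: polynomial_fun.const)

lemma polynomial_fun_eval3: "polynomial_fun (eval3 p)"
proof (induction p)
  case (pCons a p)
  have "eval3 (pCons a p) = (\<lambda>x. eval2 a x + x $ 2 * eval3 p x)" by (auto simp: eval_defs)
  then show ?case using pCons polynomial_fun_eval2 by (auto intro!: polynomial_fun.intros)
qed (auto simp: eval_defs intro: polynomial_fun.const)

lemma polynomial_fun_eval4: "polynomial_fun (eval4 p)"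
proof (induction p)
  case (pCons a p)
  have "eval4 (pCons a p) = (\<lambda>x. eval3 a x + x $ 1 * eval4 p x)" by (auto simp: eval_defs)
  then show ?case using pCons polynomial_fun_eval3 by (auto intro!: polynomial_fun.intros)
qed (auto simp: eval_defs intro: polynomial_fun.const)

lemma eval4_surj: "polynomial_fun f \<Longrightarrow> \<exists>p. f = eval4 p"
proof (induction rule: polynomial_fun.induct)
  case (const c)
  show ?case by (rule exI[of _ "[:[:[:[:c:]:]:]:]"]) (auto simp: eval_defs)
next
  case (coord i)
  consider "i = 1" | "i = 2" | "i = 3" | "i = 4" using exhaust_4 by blast
  then show ?case
  proof cases
    case 1 then show ?thesis by (intro exI[of _ "[:0, 1:]"]) (auto simp: eval_defs)
  next
    case 2 then show ?thesis by (intro exI[of _ "[:[:0, 1:]:]"]) (auto simp: eval_defs)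
  next
    case 3 then show ?thesis by (intro exI[of _ "[:[:[:0, 1:]:]:]"]) (auto simp: eval_defs)
  next
    case 4 then show ?thesis by (intro exI[of _ "[:[:[:[:0, 1:]:]:]:]"]) (auto simp: eval_defs)
  qed
next
  case (add p q)
  then obtain P Q where "p = eval4 P" "q = eval4 Q" by blast
  then have "(\<lambda>x. p x + q x) = eval4 (P + Q)" by (auto simp: eval4_hom)
  then show ?case by blast
next
  case (mult p q)
  then obtain P Q where "p = eval4 P" "q = eval4 Q" by blast
  then have "(\<lambda>x. p x * q x) = eval4 (P * Q)" by (auto simp: eval4_hom)
  then show ?case by blast
qed

lemma poly_nonzero_at:
  fixes p :: "'a::idom poly"
  assumes "p \<noteq> 0" "infinite (range c)"
  shows "\<exists>z. poly p (c z) \<noteq> 0"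
proof (rule ccontr)
  assume "\<not> ?thesis"
  then have "range c \<subseteq> {z. poly p z = 0}" by auto
  then show False using assms poly_roots_finite[of p] finite_subset by blast
qed

text \<open>Coordinates are chosen one after the other: among infinitely many constants one is not a
  root. With \<open>eval4_surj\<close> this identifies the ring with the polynomial functions on
  \<open>complex^4\<close>.\<close>

lemma eval4_eq_0:
  assumes "\<And>x. eval4 p x = 0"
  shows "p = 0"
proof (rule ccontr)
  assume "p \<noteq> 0"
  have inf: "infinite (range (\<lambda>z::complex. z))" "infinite (range (\<lambda>z::complex. [:z:]))"
    "infinite (range (\<lambda>z::complex. [:[:z:]:]))" "infinite (range (\<lambda>z::complex. [:[:[:z:]:]:]))"
    using infinite_UNIV_char_0[where 'a = complex]
    by (auto simp: finite_image_iff inj_on_def)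
  obtain z1 where 1: "poly p [:[:[:z1:]:]:] \<noteq> 0" using poly_nonzero_at[OF \<open>p \<noteq> 0\<close> inf(4)] by blast
  obtain z2 where 2: "poly (poly p [:[:[:z1:]:]:]) [:[:z2:]:] \<noteq> 0" using poly_nonzero_at[OF 1 inf(3)] by blast
  obtain z3 where 3: "poly (poly (poly p [:[:[:z1:]:]:]) [:[:z2:]:]) [:z3:] \<noteq> 0" using poly_nonzero_at[OF 2 inf(2)] by blast
  obtain z4 where "poly (poly (poly (poly p [:[:[:z1:]:]:]) [:[:z2:]:]) [:z3:]) z4 \<noteq> 0"
    using poly_nonzero_at[OF 3 inf(1)] by blast
  then show False using assms[of "vector [z1, z2, z3, z4]"] by (simp add: eval_defs vector_4)
qed

lemma primitive_part_4:
  fixes a :: "'i::finite \<Rightarrow> complex^4 \<Rightarrow> complex"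
  assumes "\<And>i. polynomial_fun (a i)" "a k x0 \<noteq> 0"
  shows "\<exists>d a'. polynomial_fun d \<and> (\<forall>i x. a i x = d x * a' i x) \<and> primitive_family a'"
proof -
  have "\<forall>i. \<exists>p. a i = eval4 p" using eval4_surj assms(1) by blast
  from choice[OF this] obtain A where A: "\<And>i. a i = eval4 (A i)" by blast
  have "A k \<noteq> 0" using assms(2) A by (auto simp: eval4_hom)
  then obtain d A' where d: "d \<noteq> 0" "\<forall>i. A i = d * A' i"
    and g: "\<And>g. (\<forall>i j. A' i * g j = A' j * g i) \<Longrightarrow> \<exists>e. \<forall>i. g i = e * A' i"
    using ring_primitive_family[of A k] by blast
  have "primitive_family (\<lambda>i. eval4 (A' i))"
    unfolding primitive_family_def
  proof (intro conjI allI impI polynomial_fun_eval4)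
    have "eval4 d x0 * eval4 (A' k) x0 \<noteq> 0" using assms(2) A[of k] d(2) eval4_hom(2)[of d "A' k" x0] by simp
    then show "\<exists>i x. eval4 (A' i) x \<noteq> 0" by auto
  next
    fix g assume *: "(\<forall>i. polynomial_fun (g i)) \<and> (\<forall>i j x. eval4 (A' i) x * g j x = eval4 (A' j) x * g i x)"
    then have "\<forall>i. \<exists>p. g i = eval4 p" using eval4_surj by blast
    from choice[OF this] obtain G where G: "\<And>i. g i = eval4 (G i)" by blast
    have "eval4 (A' i * G j - A' j * G i) x = 0" for i j x
      using eval4_hom(1)[of "A' i * G j - A' j * G i" "A' j * G i" x] * by (simp add: eval4_hom(2) G)
    then have "A' i * G j = A' j * G i" for i j using eval4_eq_0[of "A' i * G j - A' j * G i"] by auto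
    then obtain e where "\<forall>i. G i = e * A' i" using g by blast
    then show "\<exists>e. polynomial_fun e \<and> (\<forall>i x. g i x = e x * eval4 (A' i) x)"
      using polynomial_fun_eval4 G by (intro exI[of _ "eval4 e"]) (auto simp: eval4_hom)
  qed
  then show ?thesis using d A polynomial_fun_eval4
    by (intro exI[of _ "eval4 d"] exI[of _ "\<lambda>i. eval4 (A' i)"]) (auto simp: eval4_hom)
qed

text \<open>Reduction to four variables: functions are pulled back along the projection
  \<open>\<pi>\<close>, and the result is restricted to \<open>x $ 4 = 0\<close> along the section
  \<open>\<sigma>\<close>. Relations in three variables pull back as well, so the restricted family
  is still primitive.\<close>

lemma primitive_part_3:
  fixes a :: "'i::finite \<Rightarrow> complex^3 \<Rightarrow> complex"
  assumes "\<And>i. polynomial_fun (a i)" "a k x0 \<noteq> 0"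
  shows "\<exists>d a'. polynomial_fun d \<and> (\<forall>i x. a i x = d x * a' i x) \<and> primitive_family a'"
proof -
  define \<pi> :: "complex^4 \<Rightarrow> complex^3" where "\<pi> x = vector [x $ 1, x $ 2, x $ 3]" for x
  define \<sigma> :: "complex^3 \<Rightarrow> complex^4" where "\<sigma> x = vector [x $ 1, x $ 2, x $ 3, 0]" for x
  have \<pi>\<sigma>: "\<pi> (\<sigma> x) = x" for x by (simp add: \<pi>_def \<sigma>_def vec_eq_iff forall_3 vector_4)
  have \<pi>: "polynomial_map \<pi>" and \<sigma>: "polynomial_map \<sigma>"
    by (simp_all add: polynomial_map_def \<pi>_def \<sigma>_def forall_3 forall_4 vector_4
      polynomial_fun.coord polynomial_fun.const)
  note comp = polynomial_map_comp_fun[OF _ \<pi>] polynomial_map_comp_fun[OF _ \<sigma>]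
  obtain d a' where d: "polynomial_fun d" "\<forall>i x. a i (\<pi> x) = d x * a' i x" and a': "primitive_family a'"
    using primitive_part_4[of "\<lambda>i x. a i (\<pi> x)" k "\<sigma> x0"] assms comp(1) \<pi>\<sigma> by auto
  have d0: "d (\<sigma> x0) \<noteq> 0" using d(2)[rule_format, of k "\<sigma> x0"] assms(2) \<pi>\<sigma> by auto
  have "primitive_family (\<lambda>i x. a' i (\<sigma> x))"
    unfolding primitive_family_def
  proof (intro conjI allI impI)
    fix i show "polynomial_fun (\<lambda>x. a' i (\<sigma> x))" using a' comp(2) by (simp add: primitive_family_def)
  next
    show "\<exists>i x. a' i (\<sigma> x) \<noteq> 0" using d(2)[rule_format, of k "\<sigma> x0"] assms(2) \<pi>\<sigma> by auto
  next
    fix g :: "'i \<Rightarrow> complex^3 \<Rightarrow> complex"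
    assume g: "(\<forall>i. polynomial_fun (g i)) \<and> (\<forall>i j x. a' i (\<sigma> x) * g j x = a' j (\<sigma> x) * g i x)"
    have "a' i x * g j (\<pi> x) = a' j x * g i (\<pi> x)" for i j x
    proof (rule polynomial_fun_cancel[OF d(1) d0])
      fix x
      have "a i (\<pi> x) * g j (\<pi> x) = a j (\<pi> x) * g i (\<pi> x)"
        using g d(2)[rule_format, of _ "\<sigma> (\<pi> x)"] \<pi>\<sigma> by (simp add: mult.assoc)
      then show "d x * (a' i x * g j (\<pi> x)) = d x * (a' j x * g i (\<pi> x))"
        using d(2) by (simp add: mult.assoc)
    qed (use g comp(1) in \<open>auto intro!: polynomial_fun.mult primitive_family_polynomial_fun[OF a']\<close>)
    with primitive_familyD[OF a', of "\<lambda>i x. g i (\<pi> x)"] g comp(1) obtain e where e: "polynomial_fun e" "\<And>i x. g i (\<pi> x) = e x * a' i x" by blast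
    have "g i x = e (\<sigma> x) * a' i (\<sigma> x)" for i x using e(2)[of i "\<sigma> x"] \<pi>\<sigma> by simp
    then show "\<exists>e. polynomial_fun e \<and> (\<forall>i x. g i x = e x * a' i (\<sigma> x))"
      using comp(2)[OF e(1)] by blast
  qed
  moreover have "a i x = d (\<sigma> x) * a' i (\<sigma> x)" for i x
    using d(2)[rule_format, of i "\<sigma> x"] \<pi>\<sigma> by simp
  ultimately show ?thesis using comp(2)[OF d(1)]
    by (intro exI[of _ "\<lambda>x. d (\<sigma> x)"] exI[of _ "\<lambda>i x. a' i (\<sigma> x)"]) auto
qed

section \<open>Rational maps on quotients of open subsets of affine space\<close>

definition locally_rational :: "(complex^'n) set \<Rightarrow> (complex^'n \<Rightarrow> complex) \<Rightarrow> bool" where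
  "locally_rational U f \<longleftrightarrow> (\<forall>x\<in>U. \<exists>V p q. openin zariski V \<and> x \<in> V \<and> V \<subseteq> U \<and>
     polynomial_fun p \<and> polynomial_fun q \<and> (\<forall>y\<in>V. q y \<noteq> 0 \<and> f y = p y / q y))"

lemma zar_subvariety_affine [simp]: "zar (subvariety affine_variety X) = subtopology zariski X"
  by (simp add: subvariety_def affine_variety_def)

lemma regular_affine: "regular affine_variety U f \<longleftrightarrow> openin zariski U \<and> locally_rational U f"
  by (simp add: affine_variety_def locally_rational_def)

lemma locally_rational_local:
  assumes "openin zariski U"
    "\<And>x. x \<in> U \<Longrightarrow> \<exists>W g. x \<in> W \<and> openin zariski W \<and> locally_rational W g \<and> (\<forall>y\<in>U \<inter> W. f y = g y)"
  shows "locally_rational U f"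
  unfolding locally_rational_def
proof
  fix x assume x: "x \<in> U"
  then obtain W g where W: "x \<in> W" "openin zariski W" "locally_rational W g" "\<forall>y\<in>U \<inter> W. f y = g y"
    using assms(2) by blast
  then obtain V p q where V: "openin zariski V" "x \<in> V" "V \<subseteq> W" "polynomial_fun p" "polynomial_fun q"
    "\<forall>y\<in>V. q y \<noteq> 0 \<and> g y = p y / q y"
    unfolding locally_rational_def by meson
  show "\<exists>V p q. openin zariski V \<and> x \<in> V \<and> V \<subseteq> U \<and>
     polynomial_fun p \<and> polynomial_fun q \<and> (\<forall>y\<in>V. q y \<noteq> 0 \<and> f y = p y / q y)"
    using V W x assms(1) by (intro exI[of _ "V \<inter> U"] exI[of _ p] exI[of _ q]) auto
qed

lemma regular_subvariety_affine:
  assumes "openin zariski X"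
  shows "regular (subvariety affine_variety X) U f \<longleftrightarrow> openin zariski U \<and> U \<subseteq> X \<and> locally_rational U f"
proof -
  have "regular (subvariety affine_variety X) U f \<longleftrightarrow> openin zariski U \<and> U \<subseteq> X \<and>
    (\<forall>x\<in>U. \<exists>W g. x \<in> W \<and> regular affine_variety W g \<and> (\<forall>y\<in>U \<inter> W. f y = g y))"
    using assms by (auto simp: subvariety_def affine_variety_def openin_open_subtopology)
  moreover have "(\<forall>x\<in>U. \<exists>W g. x \<in> W \<and> regular affine_variety W g \<and> (\<forall>y\<in>U \<inter> W. f y = g y)) \<longleftrightarrow> locally_rational U f"
    if "openin zariski U"
  proof
    assume "locally_rational U f"
    then show "\<forall>x\<in>U. \<exists>W g. x \<in> W \<and> regular affine_variety W g \<and> (\<forall>y\<in>U \<inter> W. f y = g y)"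
      using that by (intro ballI exI[of _ U] exI[of _ f]) (auto simp: regular_affine)
  next
    assume *: "\<forall>x\<in>U. \<exists>W g. x \<in> W \<and> regular affine_variety W g \<and> (\<forall>y\<in>U \<inter> W. f y = g y)"
    show "locally_rational U f"
      by (rule locally_rational_local[OF that]) (use * in \<open>simp add: regular_affine\<close>)
  qed
  ultimately show ?thesis by blast
qed

lemma openin_quotient_variety:
  assumes "openin zariski X"
  shows "openin (zar (quotient_variety (subvariety affine_variety X) \<pi>)) W \<longleftrightarrow>
    W \<subseteq> \<pi> ` X \<and> openin zariski {x \<in> X. \<pi> x \<in> W}"
  using assms by (auto simp: quotient_variety_def openin_coinduced_topology openin_open_subtopology)

lemma points_quotient_variety [simp]:
  assumes "openin zariski X"
  shows "points (quotient_variety (subvariety affine_variety X) \<pi>) = \<pi> ` X" (is "?L = ?R")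
proof
  show "?L \<subseteq> ?R" using openin_quotient_variety[OF assms, of \<pi> ?L] openin_topspace by simp
  have "{x \<in> X. \<pi> x \<in> \<pi> ` X} = X" by auto
  then have "openin zariski {x \<in> X. \<pi> x \<in> \<pi> ` X}" using assms by simp
  then show "?R \<subseteq> ?L" using openin_quotient_variety[OF assms, of \<pi> ?R] by (simp add: openin_subset)
qed

lemma regular_quotient_variety:
  assumes "openin zariski X"
  shows "regular (quotient_variety (subvariety affine_variety X) \<pi>) W f \<longleftrightarrow>
    W \<subseteq> \<pi> ` X \<and> openin zariski {x \<in> X. \<pi> x \<in> W} \<and> locally_rational {x \<in> X. \<pi> x \<in> W} (f \<circ> \<pi>)"
  using assms openin_quotient_variety[OF assms, of \<pi>]
  by (auto simp: quotient_variety_def regular_subvariety_affine)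

text \<open>The only properties of a space with functions needed for composing rational maps: regularity
  is local, and any two nonempty open sets meet.\<close>

definition irreducible_space :: "'a variety \<Rightarrow> bool" where
  "irreducible_space Y \<longleftrightarrow> points Y \<noteq> {} \<and>
     (\<forall>U V. openin (zar Y) U \<and> openin (zar Y) V \<and> U \<noteq> {} \<and> V \<noteq> {} \<longrightarrow> U \<inter> V \<noteq> {}) \<and>
     (\<forall>U f. regular Y U f \<longrightarrow> openin (zar Y) U) \<and>
     (\<forall>U V f. regular Y U f \<and> openin (zar Y) V \<and> V \<subseteq> U \<longrightarrow> regular Y V f) \<and>
     (\<forall>U f. openin (zar Y) U \<and> (\<forall>x\<in>U. \<exists>W g. x \<in> W \<and> regular Y W g \<and> (\<forall>y\<in>U \<inter> W. f y = g y)) \<longrightarrow> regular Y U f)"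

lemma irreducible_spaceD:
  assumes "irreducible_space Y"
  shows "points Y \<noteq> {}"
    "openin (zar Y) U \<Longrightarrow> openin (zar Y) V \<Longrightarrow> U \<noteq> {} \<Longrightarrow> V \<noteq> {} \<Longrightarrow> U \<inter> V \<noteq> {}"
    "regular Y U f \<Longrightarrow> openin (zar Y) U"
    "regular Y U f \<Longrightarrow> openin (zar Y) V \<Longrightarrow> V \<subseteq> U \<Longrightarrow> regular Y V f"
    "openin (zar Y) U \<Longrightarrow> (\<And>x. x \<in> U \<Longrightarrow> \<exists>W g. x \<in> W \<and> regular Y W g \<and> (\<forall>y\<in>U \<inter> W. f y = g y)) \<Longrightarrow> regular Y U f"
proof -
  note * = assms[unfolded irreducible_space_def]
  show "points Y \<noteq> {}" using * by (rule conjunct1)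
  show "openin (zar Y) U \<Longrightarrow> openin (zar Y) V \<Longrightarrow> U \<noteq> {} \<Longrightarrow> V \<noteq> {} \<Longrightarrow> U \<inter> V \<noteq> {}"
    using *[THEN conjunct2, THEN conjunct1] by blast
  show "regular Y U f \<Longrightarrow> openin (zar Y) U"
    using *[THEN conjunct2, THEN conjunct2, THEN conjunct1] by blast
  show "regular Y U f \<Longrightarrow> openin (zar Y) V \<Longrightarrow> V \<subseteq> U \<Longrightarrow> regular Y V f"
    using *[THEN conjunct2, THEN conjunct2, THEN conjunct2, THEN conjunct1] by blast
  show "openin (zar Y) U \<Longrightarrow> (\<And>x. x \<in> U \<Longrightarrow> \<exists>W g. x \<in> W \<and> regular Y W g \<and> (\<forall>y\<in>U \<inter> W. f y = g y)) \<Longrightarrow> regular Y U f"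
    using *[THEN conjunct2, THEN conjunct2, THEN conjunct2, THEN conjunct2] by (meson ballI)
qed

lemma irreducible_space_quotient:
  assumes X: "openin zariski X" "X \<noteq> {}"
  shows "irreducible_space (quotient_variety (subvariety affine_variety X) \<pi>)" (is "irreducible_space ?Y")
  unfolding irreducible_space_def
proof (intro conjI allI impI)
  note o = openin_quotient_variety[OF X(1), of \<pi>]
  note r = regular_quotient_variety[OF X(1), of \<pi>]
  show "points ?Y \<noteq> {}" using X by simp
  show "U \<inter> V \<noteq> {}" if "openin (zar ?Y) U \<and> openin (zar ?Y) V \<and> U \<noteq> {} \<and> V \<noteq> {}" for U V
  proof -
    have "{x \<in> X. \<pi> x \<in> U} \<noteq> {}" "{x \<in> X. \<pi> x \<in> V} \<noteq> {}" using that o by auto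
    then show ?thesis using zariski_opens_meet[of "{x \<in> X. \<pi> x \<in> U}" "{x \<in> X. \<pi> x \<in> V}"] that o by auto
  qed
  show "openin (zar ?Y) U" if "regular ?Y U f" for U f using that o r by auto
  show "regular ?Y V f" if *: "regular ?Y U f \<and> openin (zar ?Y) V \<and> V \<subseteq> U" for U V f
  proof -
    have "locally_rational {x \<in> X. \<pi> x \<in> V} (f \<circ> \<pi>)"
      using * o r by (intro locally_rational_local) (auto intro!: exI[of _ "{x \<in> X. \<pi> x \<in> U}"] exI[of _ "f \<circ> \<pi>"])
    then show ?thesis using * o r by auto
  qed
  show "regular ?Y U f"
    if *: "openin (zar ?Y) U \<and> (\<forall>x\<in>U. \<exists>W g. x \<in> W \<and> regular ?Y W g \<and> (\<forall>y\<in>U \<inter> W. f y = g y))" for U f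
  proof -
    have "locally_rational {x \<in> X. \<pi> x \<in> U} (f \<circ> \<pi>)"
    proof (rule locally_rational_local)
      show "openin zariski {x \<in> X. \<pi> x \<in> U}" using * o by auto
      fix x assume x: "x \<in> {x \<in> X. \<pi> x \<in> U}"
      then obtain W g where W: "\<pi> x \<in> W" "regular ?Y W g" "\<forall>y\<in>U \<inter> W. f y = g y" using * by blast
      then show "\<exists>W g. x \<in> W \<and> openin zariski W \<and> locally_rational W g \<and>
          (\<forall>y\<in>{x \<in> X. \<pi> x \<in> U} \<inter> W. (f \<circ> \<pi>) y = g y)"
        using x r by (intro exI[of _ "{x \<in> X. \<pi> x \<in> W}"] exI[of _ "g \<circ> \<pi>"]) auto
    qed
    then show ?thesis using * o r by auto
  qed
qed

lemma openin_subvariety: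
  assumes "openin (zar X) U"
  shows "openin (zar (subvariety X U)) V \<longleftrightarrow> openin (zar X) V \<and> V \<subseteq> U"
  using assms by (simp add: subvariety_def openin_open_subtopology)

lemma regular_subvariety:
  assumes X: "irreducible_space X" and U: "openin (zar X) U"
  shows "regular (subvariety X U) V f \<longleftrightarrow> V \<subseteq> U \<and> regular X V f"
proof -
  have "regular (subvariety X U) V f \<longleftrightarrow> openin (zar X) V \<and> V \<subseteq> U \<and>
      (\<forall>x\<in>V. \<exists>W g. x \<in> W \<and> regular X W g \<and> (\<forall>y\<in>V \<inter> W. f y = g y))"
    using U by (auto simp: subvariety_def openin_open_subtopology)
  also have "\<dots> \<longleftrightarrow> V \<subseteq> U \<and> regular X V f"
  proof
    assume *: "openin (zar X) V \<and> V \<subseteq> U \<and> (\<forall>x\<in>V. \<exists>W g. x \<in> W \<and> regular X W g \<and> (\<forall>y\<in>V \<inter> W. f y = g y))"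
    then have "regular X V f" by (intro irreducible_spaceD(5)[OF X]) simp_all
    then show "V \<subseteq> U \<and> regular X V f" using * by simp
  next
    assume "V \<subseteq> U \<and> regular X V f"
    then show "openin (zar X) V \<and> V \<subseteq> U \<and> (\<forall>x\<in>V. \<exists>W g. x \<in> W \<and> regular X W g \<and> (\<forall>y\<in>V \<inter> W. f y = g y))"
      using irreducible_spaceD(3)[OF X] by (intro conjI ballI exI[of _ V] exI[of _ f]) auto
  qed
  finally show ?thesis .
qed

lemma partial_morphisms_iff:
  assumes X: "irreducible_space X"
  shows "(U, f) \<in> partial_morphisms X Y \<longleftrightarrow> openin (zar X) U \<and> U \<noteq> {} \<and> f ` U \<subseteq> points Y \<and>
    (\<forall>V. openin (zar Y) V \<longrightarrow> openin (zar X) {x \<in> U. f x \<in> V}) \<and>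
    (\<forall>V g. regular Y V g \<longrightarrow> regular X {x \<in> U. f x \<in> V} (g \<circ> f))"
proof -
  have p: "points (subvariety X U) = U" if "openin (zar X) U"
    using openin_subset[OF that] by (auto simp: subvariety_def)
  show ?thesis
    by (auto simp: partial_morphisms_def morphism_def continuous_map p openin_subvariety regular_subvariety[OF X])
qed

lemma partial_morphismsD:
  assumes X: "irreducible_space X" and "(U, f) \<in> partial_morphisms X Y"
  shows "openin (zar X) U" "U \<noteq> {}" "f ` U \<subseteq> points Y" "U \<subseteq> points X"
    "openin (zar Y) V \<Longrightarrow> openin (zar X) {x \<in> U. f x \<in> V}"
    "regular Y V g \<Longrightarrow> regular X {x \<in> U. f x \<in> V} (g \<circ> f)"
  using assms(2) unfolding partial_morphisms_iff[OF X] by (auto dest: openin_subset)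

lemma partial_morphisms_comp:
  assumes X: "irreducible_space X" and Y: "irreducible_space Y"
    and f: "(U, f) \<in> partial_morphisms X Y" and g: "(V, g) \<in> partial_morphisms Y Z"
    and ne: "{x \<in> U. f x \<in> V} \<noteq> {}"
  shows "({x \<in> U. f x \<in> V}, g \<circ> f) \<in> partial_morphisms X Z"
  unfolding partial_morphisms_iff[OF X]
proof (intro conjI allI impI ne)
  note F = partial_morphismsD[OF X f] and G = partial_morphismsD[OF Y g]
  show "openin (zar X) {x \<in> U. f x \<in> V}" using F(5) G(1) by blast
  show "(g \<circ> f) ` {x \<in> U. f x \<in> V} \<subseteq> points Z" using G(3) by auto
  fix W
  have eq: "{x \<in> {x \<in> U. f x \<in> V}. (g \<circ> f) x \<in> W} = {x \<in> U. f x \<in> {y \<in> V. g y \<in> W}}" by auto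
  show "openin (zar X) {x \<in> {x \<in> U. f x \<in> V}. (g \<circ> f) x \<in> W}" if "openin (zar Z) W"
    unfolding eq using F(5) G(5)[OF that] by blast
  show "regular X {x \<in> {x \<in> U. f x \<in> V}. (g \<circ> f) x \<in> W} (h \<circ> (g \<circ> f))" if "regular Z W h" for h
    unfolding eq using F(6)[OF G(6)[OF that]] by (simp only: comp_assoc)
qed

lemma partial_morphisms_id:
  assumes X: "irreducible_space X"
  shows "(points X, \<lambda>x. x) \<in> partial_morphisms X X"
proof -
  have "{x \<in> points X. x \<in> V} = V" if "openin (zar X) V" for V using openin_subset[OF that] by auto
  then show ?thesis
    unfolding partial_morphisms_iff[OF X]
  proof (intro conjI allI impI)
    fix V g assume "regular X V g"
    moreover from irreducible_spaceD(3)[OF X this] have "{x \<in> points X. x \<in> V} = V"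
      by (auto dest: openin_subset)
    ultimately show "regular X {x \<in> points X. x \<in> V} (g \<circ> (\<lambda>x. x))" by (simp add: comp_def)
  qed (use irreducible_spaceD(1)[OF X] in simp_all)
qed

section \<open>Classes of rational maps and the group of birational maps\<close>

text \<open>Both representatives agree with the pair that defines the class, hence with each other
  on its domain. Agreement on all of \<open>U \<inter> V\<close> would need separatedness; this
  weaker form serves for the target surfaces as well.\<close>

lemma rational_maps_agree:
  assumes X: "irreducible_space X" and \<phi>: "\<phi> \<in> rational_maps X Y" "(U, f) \<in> \<phi>" "(V, g) \<in> \<phi>"
  shows "\<exists>W. openin (zar X) W \<and> W \<noteq> {} \<and> (\<forall>x\<in>U \<inter> V \<inter> W. f x = g x)"
proof -
  obtain W h where W: "(W, h) \<in> partial_morphisms X Y" "\<phi> = rat_class X Y W h"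
    using \<phi> unfolding rational_maps_def by blast
  then have *: "\<forall>x\<in>W \<inter> U. h x = f x" "\<forall>x\<in>W \<inter> V. h x = g x"
    using \<phi>(2,3) by (auto simp: rat_class_def)
  have "f x = g x" if "x \<in> U \<inter> V \<inter> W" for x using *[THEN bspec, of x] that by simp
  then show ?thesis using partial_morphismsD(1,2)[OF X W(1)] by blast
qed

lemma rational_maps_partial_morphisms:
  "\<phi> \<in> rational_maps X Y \<Longrightarrow> (U, f) \<in> \<phi> \<Longrightarrow> (U, f) \<in> partial_morphisms X Y"
  unfolding rational_maps_def rat_class_def by auto

lemma rat_id_mem: "irreducible_space X \<Longrightarrow> (points X, \<lambda>x. x) \<in> rat_id X"
  using partial_morphisms_id by (auto simp: rat_id_def rat_class_def)

definition dominant_map :: "'b variety \<Rightarrow> 'a set \<Rightarrow> ('a \<Rightarrow> 'b) \<Rightarrow> bool" where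
  "dominant_map Y U f \<longleftrightarrow> (\<forall>V. openin (zar Y) V \<and> V \<noteq> {} \<longrightarrow> (\<exists>x\<in>U. f x \<in> V))"

lemma rat_comp_eq_idD:
  assumes Y: "irreducible_space Y" and id: "rat_comp Y Y \<phi> \<psi> = rat_id Y"
  shows "\<exists>V g U f. (V, g) \<in> \<psi> \<and> (U, f) \<in> \<phi> \<and> (\<exists>y\<in>V. g y \<in> U) \<and> (\<forall>y\<in>V \<inter> points Y. g y \<in> U \<longrightarrow> f (g y) = y)"
proof -
  have "(points Y, \<lambda>x. x) \<in> rat_comp Y Y \<phi> \<psi>" using id rat_id_mem[OF Y] by simp
  then show ?thesis unfolding rat_comp_def by fastforce
qed

text \<open>On an open set \<open>\<psi>\<close> is a section of \<open>\<phi>\<close>, so some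
  representative of \<open>\<phi>\<close> hits every nonempty open set; any other representative
  coincides with it on a nonempty open set.\<close>

lemma birational_inverses_dominant:
  assumes X: "irreducible_space X" and Y: "irreducible_space Y"
    and b: "birational_inverses X Y \<phi> \<psi>" and f: "(U, f) \<in> \<phi>"
  shows "dominant_map Y U f"
  unfolding dominant_map_def
proof (intro allI impI)
  fix W assume W: "openin (zar Y) W \<and> W \<noteq> {}"
  have \<phi>: "\<phi> \<in> rational_maps X Y" and \<psi>: "\<psi> \<in> rational_maps Y X" and id: "rat_comp Y Y \<phi> \<psi> = rat_id Y"
    using b unfolding birational_inverses_def by auto
  obtain V1 g1 U1 f1 where 1: "(V1, g1) \<in> \<psi>" "(U1, f1) \<in> \<phi>" "\<exists>y\<in>V1. g1 y \<in> U1"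
    "\<forall>y\<in>V1 \<inter> points Y. g1 y \<in> U1 \<longrightarrow> f1 (g1 y) = y"
    using rat_comp_eq_idD[OF Y id] by blast
  note F = partial_morphismsD[OF X rational_maps_partial_morphisms[OF \<phi> f]]
  note F1 = partial_morphismsD[OF X rational_maps_partial_morphisms[OF \<phi> 1(2)]]
  note G1 = partial_morphismsD[OF Y rational_maps_partial_morphisms[OF \<psi> 1(1)]]
  have "{y \<in> V1. g1 y \<in> U1} \<inter> W \<noteq> {}"
    using W 1(3) G1(5)[OF F1(1)] by (intro irreducible_spaceD(2)[OF Y]) auto
  then obtain y where y: "y \<in> V1" "g1 y \<in> U1" "y \<in> W" by blast
  have "f1 (g1 y) = y" using 1(4) y G1(4) by blast
  then have ne: "{x \<in> U1. f1 x \<in> W} \<noteq> {}" using y by auto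
  have op: "openin (zar X) {x \<in> U1. f1 x \<in> W}" using F1(5) W by blast
  obtain O' where O': "openin (zar X) O'" "O' \<noteq> {}" "\<forall>x\<in>U \<inter> U1 \<inter> O'. f x = f1 x"
    using rational_maps_agree[OF X \<phi> f 1(2)] by blast
  have "U \<inter> O' \<inter> {x \<in> U1. f1 x \<in> W} \<noteq> {}"
    using F O' op ne by (intro irreducible_spaceD(2)[OF X] openin_Int)
  then show "\<exists>x\<in>U. f x \<in> W" using O'(3) by fastforce
qed

lemma birational_inverses_sym: "birational_inverses X Y \<phi> \<psi> \<Longrightarrow> birational_inverses Y X \<psi> \<phi>"
  by (auto simp: birational_inverses_def)

text \<open>The identity principle that usually follows from a closed diagonal. It makes a class
  determined by any one of its members (\<open>rat_class_eq\<close>).\<close>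

definition separated_space :: "'a variety \<Rightarrow> bool" where
  "separated_space X \<longleftrightarrow> irreducible_space X \<and> (\<forall>U f V g W. (U, f) \<in> partial_morphisms X X \<and>
     (V, g) \<in> partial_morphisms X X \<and> openin (zar X) W \<and> W \<noteq> {} \<and> (\<forall>x\<in>U \<inter> V \<inter> W. f x = g x) \<longrightarrow>
     (\<forall>x\<in>U \<inter> V. f x = g x))"

lemma rat_class_eq:
  assumes X: "separated_space X" and \<phi>: "\<phi> \<in> rational_maps X X" "(U, f) \<in> \<phi>"
  shows "\<phi> = rat_class X X U f"
proof (intro Set.set_eqI iffI; clarify)
  have i: "irreducible_space X" using X by (simp add: separated_space_def)
  note f = rational_maps_partial_morphisms[OF \<phi>]
  fix V g
  {
    assume g: "(V, g) \<in> \<phi>"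
    from rational_maps_agree[OF i \<phi>(1) \<phi>(2) g]
    have "\<forall>x\<in>U \<inter> V. f x = g x"
      using X f rational_maps_partial_morphisms[OF \<phi>(1) g] unfolding separated_space_def by blast
    then show "(V, g) \<in> rat_class X X U f"
      using rational_maps_partial_morphisms[OF \<phi>(1) g] by (simp add: rat_class_def)
  next
    assume g: "(V, g) \<in> rat_class X X U f"
    obtain W h where W: "(W, h) \<in> partial_morphisms X X" "\<phi> = rat_class X X W h"
      using \<phi> unfolding rational_maps_def by blast
    have *: "(V, g) \<in> partial_morphisms X X" "\<forall>x\<in>U \<inter> V. f x = g x" "\<forall>x\<in>W \<inter> U. h x = f x"
      using g W(2) \<phi>(2) by (auto simp: rat_class_def)
    have "\<forall>x\<in>W \<inter> V \<inter> U. h x = g x" using * by auto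
    then have "\<forall>x\<in>W \<inter> V. h x = g x"
      using X W(1) *(1) partial_morphismsD[OF i f] unfolding separated_space_def by blast
    then show "(V, g) \<in> \<phi>" using W(2) *(1) by (simp add: rat_class_def)
  }
qed

lemma rat_class_mem: "(U, f) \<in> partial_morphisms X Y \<Longrightarrow> (U, f) \<in> rat_class X Y U f"
  by (simp add: rat_class_def)

lemma rat_class_rational_maps: "(U, f) \<in> partial_morphisms X Y \<Longrightarrow> rat_class X Y U f \<in> rational_maps X Y"
  by (auto simp: rational_maps_def)

lemma rat_comp_rat_class:
  assumes X: "separated_space X" and f: "(U, f) \<in> partial_morphisms X X" "dominant_map X U f"
    and g: "(V, g) \<in> partial_morphisms X X"
  shows "rat_comp X X (rat_class X X V g) (rat_class X X U f) = rat_class X X {x \<in> U. f x \<in> V} (g \<circ> f)"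
proof (intro Set.set_eqI iffI; clarify)
  have i: "irreducible_space X" using X by (simp add: separated_space_def)
  note F = partial_morphismsD[OF i f(1)]
  note G = partial_morphismsD[OF i g]
  have ne: "{x \<in> U. f x \<in> V'} \<noteq> {}" if "openin (zar X) V'" "V' \<noteq> {}" for V'
    using f(2) that by (auto simp: dominant_map_def)
  fix W h
  {
    assume "(W, h) \<in> rat_comp X X (rat_class X X V g) (rat_class X X U f)"
    then obtain U' f' V' g' where *: "(W, h) \<in> partial_morphisms X X" "(U', f') \<in> rat_class X X U f"
      "(V', g') \<in> rat_class X X V g" "\<forall>x\<in>U' \<inter> W. f' x \<in> V' \<longrightarrow> h x = g' (f' x)"
      unfolding rat_comp_def by blast
    then have **: "(U', f') \<in> partial_morphisms X X" "(V', g') \<in> partial_morphisms X X"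
      "\<forall>x\<in>U \<inter> U'. f x = f' x" "\<forall>x\<in>V \<inter> V'. g x = g' x" by (auto simp: rat_class_def)
    note F' = partial_morphismsD[OF i **(1)] and G' = partial_morphismsD[OF i **(2)]
    \<comment> \<open>On this open set all four representatives are defined and comparable; the
      identity principle extends the agreement from here.\<close>
    let ?W = "{x \<in> U. f x \<in> V \<inter> V'} \<inter> U'"
    have "openin (zar X) ?W"
      using F(5)[of "V \<inter> V'"] F' G G' by (intro openin_Int) auto
    moreover have "?W \<noteq> {}"
    proof (rule irreducible_spaceD(2)[OF i _ F'(1) _ F'(2)])
      have "V \<inter> V' \<noteq> {}" by (rule irreducible_spaceD(2)[OF i G(1) G'(1) G(2) G'(2)])
      then show "{x \<in> U. f x \<in> V \<inter> V'} \<noteq> {}" using G(1) G'(1) by (intro ne openin_Int)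
      show "openin (zar X) {x \<in> U. f x \<in> V \<inter> V'}" using G(1) G'(1) by (intro F(5) openin_Int)
    qed
    moreover have "\<forall>x\<in>{x \<in> U. f x \<in> V} \<inter> W \<inter> ?W. (g \<circ> f) x = h x" using * ** by auto
    ultimately have "\<forall>x\<in>{x \<in> U. f x \<in> V} \<inter> W. (g \<circ> f) x = h x"
      using X *(1) partial_morphisms_comp[OF i i f(1) g ne[OF G(1,2)]]
      unfolding separated_space_def by blast
    then show "(W, h) \<in> rat_class X X {x \<in> U. f x \<in> V} (g \<circ> f)" using *(1) by (simp add: rat_class_def)
  next
    assume "(W, h) \<in> rat_class X X {x \<in> U. f x \<in> V} (g \<circ> f)"
    then have "(W, h) \<in> partial_morphisms X X" "\<forall>x\<in>{x \<in> U. f x \<in> V} \<inter> W. g (f x) = h x"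
      by (auto simp: rat_class_def)
    moreover have "\<exists>x\<in>U. f x \<in> V" using ne[OF G(1,2)] by auto
    ultimately show "(W, h) \<in> rat_comp X X (rat_class X X V g) (rat_class X X U f)"
      unfolding rat_comp_def using rat_class_mem[OF f(1)] rat_class_mem[OF g]
      by (intro CollectI case_prodI conjI bexI[of _ "(U, f)"] bexI[of _ "(V, g)"]) auto
  }
qed

text \<open>Composites of arbitrary rational maps may be nowhere defined, while dominant ones always
  compose. The group \<open>Bir X\<close> is obtained as the group of units of this monoid.\<close>

definition dominant_monoid :: "'a variety \<Rightarrow> ('a, 'a) ratmap monoid" where
  "dominant_monoid X = \<lparr>carrier = {rat_class X X U f |U f. (U, f) \<in> partial_morphisms X X \<and> dominant_map X U f},
     mult = rat_comp X X, one = rat_id X\<rparr>"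

lemma dominant_comp:
  assumes X: "irreducible_space X" and f: "(U, f) \<in> partial_morphisms X X" "dominant_map X U f"
    and g: "(V, g) \<in> partial_morphisms X X" "dominant_map X V g"
  shows "dominant_map X {x \<in> U. f x \<in> V} (g \<circ> f)"
  unfolding dominant_map_def
proof (intro allI impI)
  fix W assume "openin (zar X) W \<and> W \<noteq> {}"
  then have "openin (zar X) {y \<in> V. g y \<in> W}" "{y \<in> V. g y \<in> W} \<noteq> {}"
    using partial_morphismsD(5)[OF X g(1)] g(2) by (auto simp: dominant_map_def)
  then show "\<exists>x\<in>{x \<in> U. f x \<in> V}. (g \<circ> f) x \<in> W" using f(2) by (fastforce simp: dominant_map_def)
qed

lemma monoid_dominant:
  assumes X: "separated_space X"
  shows "monoid (dominant_monoid X)"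
proof -
  have i: "irreducible_space X" using X by (simp add: separated_space_def)
  note id = partial_morphisms_id[OF i]
  have did: "dominant_map X (points X) (\<lambda>x. x)"
    by (auto simp: dominant_map_def dest: openin_subset)
  have ne: "{x \<in> U. f x \<in> V} \<noteq> {}" if "dominant_map X U f" "(V, g) \<in> partial_morphisms X X" for U f V g
    using that partial_morphismsD(1,2)[OF i that(2)] by (auto simp: dominant_map_def)
  have idr: "rat_class X X {x \<in> points X. x \<in> U} (f \<circ> (\<lambda>x. x)) = rat_class X X U f"
    "rat_class X X {x \<in> U. f x \<in> points X} ((\<lambda>x. x) \<circ> f) = rat_class X X U f"
    if "(U, f) \<in> partial_morphisms X X" for U f
  proof -
    have "{x \<in> points X. x \<in> U} = U" "{x \<in> U. f x \<in> points X} = U"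
      using partial_morphismsD(3,4)[OF i that] by auto
    then show "rat_class X X {x \<in> points X. x \<in> U} (f \<circ> (\<lambda>x. x)) = rat_class X X U f"
      "rat_class X X {x \<in> U. f x \<in> points X} ((\<lambda>x. x) \<circ> f) = rat_class X X U f"
      by (simp_all add: comp_def)
  qed
  let ?D = "{rat_class X X U f |U f. (U, f) \<in> partial_morphisms X X \<and> dominant_map X U f}"
  show ?thesis
  proof (rule monoidI, unfold dominant_monoid_def monoid.simps partial_object.simps)
    fix \<phi> \<psi> assume "\<psi> \<in> ?D" "\<phi> \<in> ?D"
    then obtain U f V g where *: "\<phi> = rat_class X X U f" "(U, f) \<in> partial_morphisms X X" "dominant_map X U f"
      "\<psi> = rat_class X X V g" "(V, g) \<in> partial_morphisms X X" "dominant_map X V g" by blast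
    show "rat_comp X X \<psi> \<phi> \<in> ?D"
      unfolding *(1,4) rat_comp_rat_class[OF X *(2,3,5)]
      using partial_morphisms_comp[OF i i *(2,5) ne[OF *(3,5)]] dominant_comp[OF i *(2,3,5,6)] by blast
  next
    show "rat_id X \<in> ?D" using id did unfolding rat_id_def by blast
  next
    fix \<phi> assume "\<phi> \<in> ?D"
    then obtain U f where *: "\<phi> = rat_class X X U f" "(U, f) \<in> partial_morphisms X X" "dominant_map X U f" by blast
    show "rat_comp X X (rat_id X) \<phi> = \<phi>"
      unfolding *(1) rat_id_def rat_comp_rat_class[OF X *(2,3) id] by (rule idr(2)[OF *(2)])
    show "rat_comp X X \<phi> (rat_id X) = \<phi>"
      unfolding *(1) rat_id_def rat_comp_rat_class[OF X id did *(2)] by (rule idr(1)[OF *(2)])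
  next
    fix \<theta> \<psi> \<phi> assume "\<theta> \<in> ?D" "\<psi> \<in> ?D" "\<phi> \<in> ?D"
    then obtain U f V g W h where *: "\<phi> = rat_class X X U f" "(U, f) \<in> partial_morphisms X X" "dominant_map X U f"
      "\<psi> = rat_class X X V g" "(V, g) \<in> partial_morphisms X X" "dominant_map X V g"
      "\<theta> = rat_class X X W h" "(W, h) \<in> partial_morphisms X X" "dominant_map X W h" by blast
    note c = partial_morphisms_comp[OF i i *(2,5) ne[OF *(3,5)]] partial_morphisms_comp[OF i i *(5,8) ne[OF *(6,8)]]
      dominant_comp[OF i *(2,3,5,6)] dominant_comp[OF i *(5,6,8,9)]
    have "{x \<in> {x \<in> U. f x \<in> V}. (g \<circ> f) x \<in> W} = {x \<in> U. f x \<in> {y \<in> V. g y \<in> W}}" by auto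
    then show "rat_comp X X (rat_comp X X \<theta> \<psi>) \<phi> = rat_comp X X \<theta> (rat_comp X X \<psi> \<phi>)"
      unfolding *(1,4,7) rat_comp_rat_class[OF X *(2,3,5)] rat_comp_rat_class[OF X *(5,6,8)]
        rat_comp_rat_class[OF X *(2,3) c(2)] rat_comp_rat_class[OF X c(1,3) *(8)]
      by (simp only: comp_assoc)
  qed
qed

lemma group_Bir:
  assumes X: "separated_space X"
  shows "group (Bir X)"
proof -
  have i: "irreducible_space X" using X by (simp add: separated_space_def)
  interpret M: monoid "dominant_monoid X" by (rule monoid_dominant[OF X])
  have mem: "\<phi> \<in> carrier (dominant_monoid X)" if "birational_inverses X X \<phi> \<psi>" for \<phi> \<psi>
  proof -
    have "\<phi> \<in> rational_maps X X" using that by (simp add: birational_inverses_def)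
    then obtain U f where U: "(U, f) \<in> partial_morphisms X X" "\<phi> = rat_class X X U f"
      unfolding rational_maps_def by blast
    have "dominant_map X U f"
      using birational_inverses_dominant[OF i i that, of U f] rat_class_mem[OF U(1)] U(2) by simp
    then show ?thesis using U unfolding dominant_monoid_def partial_object.simps by blast
  qed
  have rm: "\<phi> \<in> rational_maps X X" if "\<phi> \<in> carrier (dominant_monoid X)" for \<phi>
    using that by (auto simp: dominant_monoid_def rational_maps_def)
  have "{\<phi>. \<exists>\<psi>. birational_inverses X X \<phi> \<psi>} = Units (dominant_monoid X)"
  proof (intro Set.set_eqI iffI)
    fix \<phi> assume "\<phi> \<in> {\<phi>. \<exists>\<psi>. birational_inverses X X \<phi> \<psi>}"
    then obtain \<psi> where b: "birational_inverses X X \<phi> \<psi>" by blast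
    then show "\<phi> \<in> Units (dominant_monoid X)"
      using mem[OF b] mem[OF birational_inverses_sym[OF b]]
      by (auto simp: Units_def dominant_monoid_def birational_inverses_def)
  next
    fix \<phi> assume "\<phi> \<in> Units (dominant_monoid X)"
    then show "\<phi> \<in> {\<phi>. \<exists>\<psi>. birational_inverses X X \<phi> \<psi>}" using rm
      by (auto simp: Units_def birational_inverses_def) (auto simp: dominant_monoid_def)
  qed
  then have "Bir X = units_of (dominant_monoid X)"
    by (simp add: Bir_def units_of_def dominant_monoid_def)
  then show ?thesis using M.units_group by simp
qed

section \<open>Polynomial lifts of rational maps\<close>

text \<open>Packs numerators \<open>P\<close> and denominators \<open>Q\<close> into one vector, so
  that clearing denominators is a polynomial map on an ordinary affine space.\<close>

definition join_vec :: "complex^'n \<Rightarrow> complex^'m \<Rightarrow> complex^('n + 'm)" where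
  "join_vec P Q = (\<chi> k. case k of Inl i \<Rightarrow> P $ i | Inr j \<Rightarrow> Q $ j)"

lemma join_vec_simps [simp]: "join_vec P Q $ Inl i = P $ i" "join_vec P Q $ Inr j = Q $ j"
  by (simp_all add: join_vec_def)

lemma polynomial_map_join_vec:
  assumes "polynomial_map P" "polynomial_map Q"
  shows "polynomial_map (\<lambda>x. join_vec (P x) (Q x))"
  unfolding polynomial_map_def
proof
  fix k show "polynomial_fun (\<lambda>x. join_vec (P x) (Q x) $ k)"
    using assms by (cases k) (auto simp: polynomial_map_def)
qed

text \<open>Locally on \<open>X\<close> the quotient map \<open>\<pi>\<close> has sections with regular components, and a point of \<open>X\<close>
  given by fractions can be moved along its fibre to clear the denominators.\<close>

definition liftable :: "(complex^'n) set \<Rightarrow> (complex^'n \<Rightarrow> 'b) \<Rightarrow> bool" where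
  "liftable X \<pi> \<longleftrightarrow> openin zariski X \<and> X \<noteq> {} \<and>
     (\<forall>x0\<in>X. \<exists>V p q. openin zariski V \<and> x0 \<in> V \<and> V \<subseteq> X \<and>
        (\<forall>x\<in>V. \<forall>x'\<in>X. \<pi> x = \<pi> x' \<longrightarrow> x' \<in> V \<and> (\<forall>i. p i x / q i x = p i x' / q i x')) \<and>
        (\<forall>i. polynomial_fun (p i) \<and> polynomial_fun (q i)) \<and>
        (\<forall>x\<in>V. (\<forall>i. q i x \<noteq> 0) \<and> (\<chi> i. p i x / q i x) \<in> X \<and> \<pi> (\<chi> i. p i x / q i x) = \<pi> x)) \<and>
     (\<exists>c :: complex^('n + 'n) \<Rightarrow> complex^'n. polynomial_map c \<and>
        (\<forall>P Q. (\<forall>i. Q $ i \<noteq> 0) \<and> (\<chi> i. P $ i / Q $ i) \<in> X \<longrightarrow>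
           c (join_vec P Q) \<in> X \<and> \<pi> (c (join_vec P Q)) = \<pi> (\<chi> i. P $ i / Q $ i)))"

abbreviation quot :: "(complex^'n) set \<Rightarrow> (complex^'n \<Rightarrow> 'b) \<Rightarrow> 'b variety" where
  "quot X \<pi> \<equiv> quotient_variety (subvariety affine_variety X) \<pi>"

lemma liftable_open: "liftable X \<pi> \<Longrightarrow> openin zariski X" "liftable X \<pi> \<Longrightarrow> X \<noteq> {}"
  by (simp_all add: liftable_def)

lemma liftable_section:
  assumes "liftable X \<pi>" "x0 \<in> X"
  obtains V p q where "openin zariski V" "x0 \<in> V" "V \<subseteq> X"
    "\<And>x x'. x \<in> V \<Longrightarrow> x' \<in> X \<Longrightarrow> \<pi> x = \<pi> x' \<Longrightarrow> x' \<in> V \<and> (\<forall>i. p i x / q i x = p i x' / q i x')"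
    "\<And>i. polynomial_fun (p i)" "\<And>i. polynomial_fun (q i)"
    "\<And>x. x \<in> V \<Longrightarrow> (\<forall>i. q i x \<noteq> 0) \<and> (\<chi> i. p i x / q i x) \<in> X \<and> \<pi> (\<chi> i. p i x / q i x) = \<pi> x"
proof -
  from assms(1)[unfolded liftable_def, THEN conjunct2, THEN conjunct2, THEN conjunct1, rule_format, OF assms(2)]
  obtain V p q where *: "openin zariski V" "x0 \<in> V" "V \<subseteq> X"
    "\<forall>x\<in>V. \<forall>x'\<in>X. \<pi> x = \<pi> x' \<longrightarrow> x' \<in> V \<and> (\<forall>i. p i x / q i x = p i x' / q i x')"
    "\<forall>i. polynomial_fun (p i) \<and> polynomial_fun (q i)"
    "\<forall>x\<in>V. (\<forall>i. q i x \<noteq> 0) \<and> (\<chi> i. p i x / q i x) \<in> X \<and> \<pi> (\<chi> i. p i x / q i x) = \<pi> x"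
    by (elim exE conjE)
  show ?thesis
  proof (rule that[OF *(1-3)])
    show "x' \<in> V \<and> (\<forall>i. p i x / q i x = p i x' / q i x')" if "x \<in> V" "x' \<in> X" "\<pi> x = \<pi> x'" for x x'
      using *(4)[rule_format, OF that] .
    show "polynomial_fun (p i)" "polynomial_fun (q i)" for i using *(5) by simp_all
    show "(\<forall>i. q i x \<noteq> 0) \<and> (\<chi> i. p i x / q i x) \<in> X \<and> \<pi> (\<chi> i. p i x / q i x) = \<pi> x" if "x \<in> V" for x
      using *(6) that by (rule bspec)
  qed
qed

lemma liftable_clear:
  fixes X :: "(complex^'n) set"
  assumes "liftable X \<pi>"
  obtains c :: "complex^('n + 'n) \<Rightarrow> complex^'n" where "polynomial_map c"
    "\<And>P Q. (\<forall>i. Q $ i \<noteq> 0) \<Longrightarrow> (\<chi> i. P $ i / Q $ i) \<in> X \<Longrightarrow>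
       c (join_vec P Q) \<in> X \<and> \<pi> (c (join_vec P Q)) = \<pi> (\<chi> i. P $ i / Q $ i)"
proof -
  from assms[unfolded liftable_def, THEN conjunct2, THEN conjunct2, THEN conjunct2]
  obtain c :: "complex^('n + 'n) \<Rightarrow> complex^'n" where c: "polynomial_map c"
    "\<forall>P Q. (\<forall>i. Q $ i \<noteq> 0) \<and> (\<chi> i. P $ i / Q $ i) \<in> X \<longrightarrow>
       c (join_vec P Q) \<in> X \<and> \<pi> (c (join_vec P Q)) = \<pi> (\<chi> i. P $ i / Q $ i)"
    by (elim exE conjE)
  show ?thesis by (rule that[OF c(1) c(2)[rule_format, OF conjI]])
qed

lemma openin_zariski_INT:
  fixes V :: "'i::finite \<Rightarrow> (complex^'n) set"
  shows "(\<And>i. openin zariski (V i)) \<Longrightarrow> openin zariski (\<Inter>i. V i)"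
  by (rule openin_INT2) auto

text \<open>The components of a local section of \<open>\<pi>\<close> descend to regular functions
  on the quotient. Pulled back along \<open>f\<close> they are fractions near \<open>x0\<close>, and
  \<open>c\<close> clears the denominators within the fibre.\<close>

lemma local_lift:
  fixes X :: "(complex^'n) set" and X' :: "(complex^'m) set"
  assumes L: "liftable X \<pi>" and X': "openin zariski X'" "X' \<noteq> {}"
    and f: "(U, f) \<in> partial_morphisms (quot X' \<pi>') (quot X \<pi>)"
    and x0: "x0 \<in> X'" "\<pi>' x0 \<in> U"
  shows "\<exists>V g. openin zariski V \<and> x0 \<in> V \<and> V \<subseteq> X' \<and> polynomial_map g \<and>
    (\<forall>x\<in>V. \<pi>' x \<in> U \<and> g x \<in> X \<and> f (\<pi>' x) = \<pi> (g x))"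
proof -
  note X = liftable_open[OF L]
  note F = partial_morphismsD[OF irreducible_space_quotient[OF X'] f]
  have "f (\<pi>' x0) \<in> \<pi> ` X" using F(3) x0 X by auto
  then obtain z0 where z0: "z0 \<in> X" "f (\<pi>' x0) = \<pi> z0" by blast
  obtain V p q where V: "openin zariski V" "z0 \<in> V" "V \<subseteq> X"
    and sat: "\<And>x x'. x \<in> V \<Longrightarrow> x' \<in> X \<Longrightarrow> \<pi> x = \<pi> x' \<Longrightarrow> x' \<in> V \<and> (\<forall>i. p i x / q i x = p i x' / q i x')"
    and pq: "\<And>i. polynomial_fun (p i)" "\<And>i. polynomial_fun (q i)"
    and h: "\<And>x. x \<in> V \<Longrightarrow> (\<forall>i. q i x \<noteq> 0) \<and> (\<chi> i. p i x / q i x) \<in> X \<and> \<pi> (\<chi> i. p i x / q i x) = \<pi> x"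
    by (rule liftable_section[OF L z0(1)]) (rule that)
  obtain c :: "complex^('n + 'n) \<Rightarrow> complex^'n" where c: "polynomial_map c"
    "\<And>P Q. (\<forall>i. Q $ i \<noteq> 0) \<Longrightarrow> (\<chi> i. P $ i / Q $ i) \<in> X \<Longrightarrow>
       c (join_vec P Q) \<in> X \<and> \<pi> (c (join_vec P Q)) = \<pi> (\<chi> i. P $ i / Q $ i)"
    by (rule liftable_clear[OF L]) (rule that)
  define W where "W = \<pi> ` V"
  have W: "{x \<in> X. \<pi> x \<in> W} = V"
  proof (intro Set.set_eqI iffI)
    fix x assume "x \<in> {x \<in> X. \<pi> x \<in> W}"
    then obtain y where "x \<in> X" "y \<in> V" "\<pi> y = \<pi> x" by (auto simp: W_def)
    then show "x \<in> V" using sat[of y x] by simp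
  next
    fix x assume "x \<in> V"
    then show "x \<in> {x \<in> X. \<pi> x \<in> W}" using V(3) by (auto simp: W_def)
  qed
  \<comment> \<open>The function on the quotient with pullback \<open>p i / q i\<close>; by
    \<open>sat\<close> it does not depend on the chosen point of the fibre.\<close>
  define u where "u i s = (let z = (SOME z. z \<in> V \<and> \<pi> z = s) in p i z / q i z)" for i s
  have u: "u i (\<pi> z) = p i z / q i z" if "z \<in> V" for i z
  proof -
    let ?z = "SOME y. y \<in> V \<and> \<pi> y = \<pi> z"
    have "?z \<in> V \<and> \<pi> ?z = \<pi> z" using that by (intro someI[of "\<lambda>y. y \<in> V \<and> \<pi> y = \<pi> z" z]) simp
    then have "p i ?z / q i ?z = p i z / q i z" using sat[of ?z z] that V(3) by blast
    then show ?thesis by (simp only: u_def Let_def)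
  qed
  have "regular (quot X \<pi>) W (u i)" for i
    unfolding regular_quotient_variety[OF X(1)] W locally_rational_def
  proof (intro conjI ballI)
    show "W \<subseteq> \<pi> ` X" using V(3) by (auto simp: W_def)
    show "openin zariski V" by (rule V)
    fix x assume "x \<in> V"
    then show "\<exists>V' p' q'. openin zariski V' \<and> x \<in> V' \<and> V' \<subseteq> V \<and> polynomial_fun p' \<and> polynomial_fun q' \<and>
        (\<forall>y\<in>V'. q' y \<noteq> 0 \<and> (u i \<circ> \<pi>) y = p' y / q' y)"
      using V(1) pq h u by (intro exI[of _ V] exI[of _ "p i"] exI[of _ "q i"]) (simp add: comp_def)
  qed
  from F(6)[OF this] have "locally_rational {x \<in> X'. \<pi>' x \<in> {x \<in> U. f x \<in> W}} (u i \<circ> f \<circ> \<pi>')" for i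
    unfolding regular_quotient_variety[OF X'(1)] by blast
  moreover have "x0 \<in> {x \<in> X'. \<pi>' x \<in> {x \<in> U. f x \<in> W}}" using x0 z0 V by (auto simp: W_def)
  ultimately have "\<forall>i. \<exists>V' P Q. openin zariski V' \<and> x0 \<in> V' \<and> V' \<subseteq> {x \<in> X'. \<pi>' x \<in> {x \<in> U. f x \<in> W}} \<and>
     polynomial_fun P \<and> polynomial_fun Q \<and> (\<forall>y\<in>V'. Q y \<noteq> 0 \<and> (u i \<circ> f \<circ> \<pi>') y = P y / Q y)"
    unfolding locally_rational_def by blast
  from choice[OF this] obtain V' where "\<forall>i. \<exists>P Q. openin zariski (V' i) \<and> x0 \<in> V' i \<and>
     V' i \<subseteq> {x \<in> X'. \<pi>' x \<in> {x \<in> U. f x \<in> W}} \<and>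
     polynomial_fun P \<and> polynomial_fun Q \<and> (\<forall>y\<in>V' i. Q y \<noteq> 0 \<and> (u i \<circ> f \<circ> \<pi>') y = P y / Q y)" ..
  from choice[OF this] obtain P where "\<forall>i. \<exists>Q. openin zariski (V' i) \<and> x0 \<in> V' i \<and>
     V' i \<subseteq> {x \<in> X'. \<pi>' x \<in> {x \<in> U. f x \<in> W}} \<and>
     polynomial_fun (P i) \<and> polynomial_fun Q \<and> (\<forall>y\<in>V' i. Q y \<noteq> 0 \<and> (u i \<circ> f \<circ> \<pi>') y = P i y / Q y)" ..
  from choice[OF this] obtain Q where V': "\<And>i. openin zariski (V' i)" "\<And>i. x0 \<in> V' i"
     "\<And>i. V' i \<subseteq> {x \<in> X'. \<pi>' x \<in> {x \<in> U. f x \<in> W}}"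
     "\<And>i. polynomial_fun (P i)" "\<And>i. polynomial_fun (Q i)"
     "\<And>i y. y \<in> V' i \<Longrightarrow> Q i y \<noteq> 0 \<and> u i (f (\<pi>' y)) = P i y / Q i y"
    by (simp only: comp_apply) blast
  define g where "g x = c (join_vec (\<chi> i. P i x) (\<chi> i. Q i x))" for x
  have "polynomial_map g" unfolding g_def
    by (intro polynomial_map_comp[OF c(1)] polynomial_map_join_vec) (simp_all add: polynomial_map_def V')
  moreover have "\<pi>' x \<in> U \<and> g x \<in> X \<and> f (\<pi>' x) = \<pi> (g x)" if x: "x \<in> (\<Inter>i. V' i)" for x
  proof -
    have "\<pi>' x \<in> U" "f (\<pi>' x) \<in> W" using V'(3) x by auto
    then obtain z where z: "z \<in> V" "f (\<pi>' x) = \<pi> z" unfolding W_def by blast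
    have Q: "Q i x \<noteq> 0" "P i x / Q i x = p i z / q i z" for i
      using V'(6)[of x i] x u[OF z(1), of i] z(2) by auto
    then have "(\<chi> i. (\<chi> i. P i x) $ i / (\<chi> i. Q i x) $ i) = (\<chi> i. p i z / q i z)"
      by (simp add: vec_eq_iff)
    then show ?thesis
      using c(2)[of "\<chi> i. Q i x" "\<chi> i. P i x"] h[OF z(1)] Q(1) \<open>\<pi>' x \<in> U\<close> z(2) by (simp add: g_def)
  qed
  moreover have "(\<Inter>i. V' i) \<subseteq> X'" using V'(3) by auto
  ultimately show ?thesis
    using openin_zariski_INT[OF V'(1)] V'(2) by (intro exI[of _ "\<Inter>i. V' i"] exI[of _ g]) auto
qed

section \<open>The projective plane as a quotient\<close>

lemma proj_point_eq_iff: "proj_point x = proj_point y \<longleftrightarrow> (\<exists>c. c \<noteq> 0 \<and> y = c *s x)"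
proof
  assume "proj_point x = proj_point y"
  moreover have "y \<in> proj_point y" by (auto simp: proj_point_def intro!: exI[of _ 1])
  ultimately show "\<exists>c. c \<noteq> 0 \<and> y = c *s x" by (auto simp: proj_point_def)
next
  assume "\<exists>c. c \<noteq> 0 \<and> y = c *s x"
  then obtain c where c: "c \<noteq> 0" "y = c *s x" by blast
  have "z \<in> proj_point x \<longleftrightarrow> z \<in> proj_point y" for z
  proof
    assume "z \<in> proj_point x"
    then obtain d where "z = d *s x" "d \<noteq> 0" by (auto simp: proj_point_def)
    then show "z \<in> proj_point y" using c by (auto simp: proj_point_def intro!: exI[of _ "d / c"])
  next
    assume "z \<in> proj_point y"
    then obtain d where "z = d *s y" "d \<noteq> 0" by (auto simp: proj_point_def)
    then show "z \<in> proj_point x" using c by (auto simp: proj_point_def intro!: exI[of _ "d * c"])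
  qed
  then show "proj_point x = proj_point y" by blast
qed

lemma proj_point_eq_iff_minors:
  fixes x y :: "complex^'n"
  assumes "x \<noteq> 0" "y \<noteq> 0"
  shows "proj_point x = proj_point y \<longleftrightarrow> (\<forall>i j. x $ i * y $ j = x $ j * y $ i)"
proof
  assume "proj_point x = proj_point y"
  then show "\<forall>i j. x $ i * y $ j = x $ j * y $ i" by (auto simp: proj_point_eq_iff)
next
  assume *: "\<forall>i j. x $ i * y $ j = x $ j * y $ i"
  obtain i where i: "x $ i \<noteq> 0" using assms(1) by (auto simp: vec_eq_iff)
  have y: "y = (y $ i / x $ i) *s x"
    using * i by (simp add: vec_eq_iff field_simps)
  then have "y $ i / x $ i \<noteq> 0" using assms(2) by (metis vector_smult_lzero)
  with y show "proj_point x = proj_point y" unfolding proj_point_eq_iff by blast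
qed

lemma openin_zariski_nonzero_vec: "openin zariski (- {0 :: complex^'n})"
  unfolding openin_zariski_iff
proof
  fix x :: "complex^'n" assume "x \<in> - {0}"
  then obtain i where "x $ i \<noteq> 0" by (auto simp: vec_eq_iff)
  then show "\<exists>p. polynomial_fun p \<and> p x \<noteq> 0 \<and> (\<forall>y. p y \<noteq> 0 \<longrightarrow> y \<in> - {0})"
    by (intro exI[of _ "\<lambda>x. x $ i"]) (auto intro: polynomial_fun.coord)
qed

lemma liftable_proj_point: "liftable (- {0 :: complex^3}) proj_point"
  unfolding liftable_def
proof (intro conjI ballI)
  show "openin zariski (- {0 :: complex^3})" by (rule openin_zariski_nonzero_vec)
  have "(1 :: complex^3) \<in> - {0}" by (simp add: vec_eq_iff)
  then show "- {0 :: complex^3} \<noteq> {}" by blast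
next
  fix x0 :: "complex^3" assume "x0 \<in> - {0}"
  then obtain k where k: "x0 $ k \<noteq> 0" by (auto simp: vec_eq_iff)
  let ?h = "\<lambda>x :: complex^3. \<chi> i. x $ i / x $ k"
  have h: "?h x = (1 / x $ k) *s x" for x by (simp add: vec_eq_iff)
  show "\<exists>V p q. openin zariski V \<and> x0 \<in> V \<and> V \<subseteq> - {0} \<and>
        (\<forall>x\<in>V. \<forall>x'\<in>- {0}. proj_point x = proj_point x' \<longrightarrow> x' \<in> V \<and> (\<forall>i. p i x / q i x = p i x' / q i x')) \<and>
        (\<forall>i. polynomial_fun (p i) \<and> polynomial_fun (q i)) \<and>
        (\<forall>x\<in>V. (\<forall>i. q i x \<noteq> 0) \<and> (\<chi> i. p i x / q i x) \<in> - {0} \<and> proj_point (\<chi> i. p i x / q i x) = proj_point x)"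
  proof (rule exI[of _ "{x. x $ k \<noteq> 0}"], rule exI[of _ "\<lambda>i x. x $ i"], rule exI[of _ "\<lambda>i x. x $ k"],
      intro conjI ballI impI allI)
    show "openin zariski {x :: complex^3. x $ k \<noteq> 0}" by (intro openin_zariski_nonzero polynomial_fun.coord)
    show "?h x \<in> - {0}" "proj_point (?h x) = proj_point x" if "x \<in> {x. x $ k \<noteq> 0}" for x
    proof -
      show "proj_point (?h x) = proj_point x"
        using that unfolding h by (subst eq_commute) (auto simp: proj_point_eq_iff intro!: exI[of _ "1 / x $ k"])
      have "?h x $ k \<noteq> (0 :: complex^3) $ k" using that by simp
      then have "?h x \<noteq> 0" by (rule contrapos_nn) (simp only:)
      then show "?h x \<in> - {0}" by simp
    qed
  qed (use k in \<open>auto simp: proj_point_eq_iff intro: polynomial_fun.coord\<close>)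
next
  let ?c = "\<lambda>z :: complex^(3 + 3). vector [z $ Inl 1 * z $ Inr 2 * z $ Inr 3,
    z $ Inl 2 * z $ Inr 1 * z $ Inr 3, z $ Inl 3 * z $ Inr 1 * z $ Inr 2] :: complex^3"
  show "\<exists>c :: complex^(3 + 3) \<Rightarrow> complex^3. polynomial_map c \<and>
        (\<forall>P Q. (\<forall>i. Q $ i \<noteq> 0) \<and> (\<chi> i. P $ i / Q $ i) \<in> - {0} \<longrightarrow>
           c (join_vec P Q) \<in> - {0} \<and> proj_point (c (join_vec P Q)) = proj_point (\<chi> i. P $ i / Q $ i))"
  proof (intro exI[of _ ?c] conjI allI impI)
    show "polynomial_map ?c" by (simp add: polynomial_map_def forall_3 polynomial_fun.intros)
    fix P Q :: "complex^3" assume *: "(\<forall>i. Q $ i \<noteq> 0) \<and> (\<chi> i. P $ i / Q $ i) \<in> - {0}"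
    let ?q = "Q $ 1 * Q $ 2 * Q $ 3"
    have eq: "?c (join_vec P Q) = ?q *s (\<chi> i. P $ i / Q $ i)"
      using * by (simp add: vec_eq_iff forall_3)
    have q: "?q \<noteq> 0" using * by simp
    show "?c (join_vec P Q) \<in> - {0}" using * q unfolding eq by simp
    show "proj_point (?c (join_vec P Q)) = proj_point (\<chi> i. P $ i / Q $ i)"
      unfolding eq by (subst eq_commute) (use q in \<open>auto simp: proj_point_eq_iff intro!: exI[of _ ?q]\<close>)
  qed
qed

lemma P2_quotient: "P2 = quot (- {0}) proj_point"
  by (simp add: projective_space_def)

lemma irreducible_space_P2: "irreducible_space P2"
  unfolding P2_quotient by (rule irreducible_space_quotient[OF liftable_open[OF liftable_proj_point]])

lemma points_P2: "points P2 = proj_point ` (- {0})"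
  unfolding P2_quotient by (rule points_quotient_variety[OF openin_zariski_nonzero_vec])

lemma openin_P2: "openin (zar P2) W \<longleftrightarrow> W \<subseteq> proj_point ` (- {0}) \<and> openin zariski {x \<in> - {0}. proj_point x \<in> W}"
  unfolding P2_quotient by (rule openin_quotient_variety[OF openin_zariski_nonzero_vec])

lemma local_lift_P2:
  assumes "liftable X \<pi>" "(U, f) \<in> partial_morphisms P2 (quot X \<pi>)" "x0 \<noteq> 0" "proj_point x0 \<in> U"
  shows "\<exists>V g. openin zariski V \<and> x0 \<in> V \<and> V \<subseteq> - {0} \<and> polynomial_map g \<and>
    (\<forall>x\<in>V. proj_point x \<in> U \<and> g x \<in> X \<and> f (proj_point x) = \<pi> (g x))"
  using local_lift[OF assms(1) liftable_open[OF liftable_proj_point], of U f proj_point x0] assms(2-4)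
  unfolding P2_quotient by simp

text \<open>Two maps into the plane with local lifts \<open>a\<close> and \<open>b\<close> agree
  exactly where the minors of \<open>a\<close> and \<open>b\<close> vanish. These are polynomials,
  so their vanishing spreads from an open set to every point.\<close>

lemma separated_space_P2: "separated_space P2"
  unfolding separated_space_def
proof (intro conjI allI impI ballI irreducible_space_P2)
  fix U f V g W s
  assume *: "(U, f) \<in> partial_morphisms P2 P2 \<and> (V, g) \<in> partial_morphisms P2 P2 \<and>
    openin (zar P2) W \<and> W \<noteq> {} \<and> (\<forall>x\<in>U \<inter> V \<inter> W. f x = g x)" and s: "s \<in> U \<inter> V"
  then have "s \<in> points P2" using partial_morphismsD(4)[OF irreducible_space_P2] by blast
  then obtain x0 where x0: "s = proj_point x0" "x0 \<in> - {0}" unfolding points_P2 by blast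
  note ll = local_lift_P2[OF liftable_proj_point]
  have 1: "(U, f) \<in> partial_morphisms P2 (quot (- {0}) proj_point)"
    "(V, g) \<in> partial_morphisms P2 (quot (- {0}) proj_point)"
    using * by (auto simp: P2_quotient)
  have x0n: "x0 \<noteq> 0" using x0 by simp
  have 2: "proj_point x0 \<in> U" "proj_point x0 \<in> V" using s x0 by auto
  obtain A a where A: "openin zariski A" "x0 \<in> A" "A \<subseteq> - {0}" "polynomial_map a"
    "\<And>x. x \<in> A \<Longrightarrow> proj_point x \<in> U \<and> a x \<in> - {0} \<and> f (proj_point x) = proj_point (a x)"
    using ll[OF 1(1) x0n 2(1)] by blast
  obtain B b where B: "openin zariski B" "x0 \<in> B" "B \<subseteq> - {0}" "polynomial_map b"
    "\<And>x. x \<in> B \<Longrightarrow> proj_point x \<in> V \<and> b x \<in> - {0} \<and> g (proj_point x) = proj_point (b x)"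
    using ll[OF 1(2) x0n 2(2)] by blast
  let ?C = "A \<inter> B \<inter> {x \<in> - {0}. proj_point x \<in> W}"
  have W: "openin zariski {x \<in> - {0}. proj_point x \<in> W}" "{x \<in> - {0}. proj_point x \<in> W} \<noteq> {}"
    using * openin_P2[of W] by auto
  have C: "openin zariski ?C" "?C \<noteq> {}"
  proof -
    have "A \<inter> B \<noteq> {}" using A B by blast
    then show "?C \<noteq> {}" by (rule zariski_opens_meet[OF openin_Int[OF A(1) B(1)] W(1) _ W(2)])
    show "openin zariski ?C" using A B W by (intro openin_Int)
  qed
  have "a x0 $ i * b x0 $ j = a x0 $ j * b x0 $ i" for i j
  proof (rule polynomial_fun_eq_on_open[OF C, where p = "\<lambda>x. a x $ i * b x $ j" and q = "\<lambda>x. a x $ j * b x $ i"])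
    fix x assume x: "x \<in> ?C"
    then have "proj_point (a x) = proj_point (b x)" using A(5)[of x] B(5)[of x] * by auto
    then show "a x $ i * b x $ j = a x $ j * b x $ i"
      using proj_point_eq_iff_minors[of "a x" "b x"] A(5)[of x] B(5)[of x] x by auto
  qed (use A(4) B(4) in \<open>auto simp: polynomial_map_def intro!: polynomial_fun.mult\<close>)
  then show "f s = g s"
    using proj_point_eq_iff_minors[of "a x0" "b x0"] A(5)[OF A(2)] B(5)[OF B(2)] x0 by auto
qed

lemma group_Bir_P2: "group (Bir P2)"
  by (rule group_Bir[OF separated_space_P2])

section \<open>Hirzebruch surfaces as torus quotients\<close>

definition hirzebruch_point :: "nat \<Rightarrow> complex^4 \<Rightarrow> (complex^4) set" where
  "hirzebruch_point n v = {w. \<exists>\<mu> \<rho>. \<mu> \<noteq> 0 \<and> \<rho> \<noteq> 0 \<and>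
        w $ 1 = \<mu> * v $ 1 / \<rho> ^ n \<and> w $ 2 = \<mu> * v $ 2 \<and> w $ 3 = \<rho> * v $ 3 \<and> w $ 4 = \<rho> * v $ 4}"

lemma hirzebruch_quotient: "hirzebruch n = quot plane_pairs (hirzebruch_point n)"
  by (simp add: hirzebruch_def hirzebruch_point_def[abs_def])

lemma P1xP1_hirzebruch: "P1xP1 = hirzebruch 0"
  by (simp add: P1xP1_def hirzebruch_def)

lemma hirzebruch_point_eq_iff:
  "hirzebruch_point n v = hirzebruch_point n w \<longleftrightarrow> (\<exists>\<mu> \<rho>. \<mu> \<noteq> 0 \<and> \<rho> \<noteq> 0 \<and>
     w $ 1 = \<mu> * v $ 1 / \<rho> ^ n \<and> w $ 2 = \<mu> * v $ 2 \<and> w $ 3 = \<rho> * v $ 3 \<and> w $ 4 = \<rho> * v $ 4)"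
  (is "?L \<longleftrightarrow> ?R")
proof
  assume ?L
  moreover have "w \<in> hirzebruch_point n w"
    unfolding hirzebruch_point_def by (intro CollectI exI[of _ 1]) simp
  ultimately have "w \<in> hirzebruch_point n v" by (simp only:)
  then show ?R unfolding hirzebruch_point_def by (rule CollectD)
next
  assume ?R
  then obtain \<mu> \<rho> where *: "\<mu> \<noteq> 0" "\<rho> \<noteq> 0" "w $ 1 = \<mu> * v $ 1 / \<rho> ^ n" "w $ 2 = \<mu> * v $ 2"
    "w $ 3 = \<rho> * v $ 3" "w $ 4 = \<rho> * v $ 4" by blast
  show ?L
  proof (intro Set.set_eqI iffI)
    fix z assume "z \<in> hirzebruch_point n v"
    then obtain \<mu>' \<rho>' where "\<mu>' \<noteq> 0" "\<rho>' \<noteq> 0" "z $ 1 = \<mu>' * v $ 1 / \<rho>' ^ n" "z $ 2 = \<mu>' * v $ 2"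
      "z $ 3 = \<rho>' * v $ 3" "z $ 4 = \<rho>' * v $ 4" unfolding hirzebruch_point_def by blast
    then show "z \<in> hirzebruch_point n w" unfolding hirzebruch_point_def using *
      by - (rule CollectI, rule exI[of _ "\<mu>' / \<mu>"], rule exI[of _ "\<rho>' / \<rho>"], simp add: power_divide)
  next
    fix z assume "z \<in> hirzebruch_point n w"
    then obtain \<mu>' \<rho>' where "\<mu>' \<noteq> 0" "\<rho>' \<noteq> 0" "z $ 1 = \<mu>' * w $ 1 / \<rho>' ^ n" "z $ 2 = \<mu>' * w $ 2"
      "z $ 3 = \<rho>' * w $ 3" "z $ 4 = \<rho>' * w $ 4" unfolding hirzebruch_point_def by blast
    then show "z \<in> hirzebruch_point n v" unfolding hirzebruch_point_def using *
      by - (rule CollectI, rule exI[of _ "\<mu>' * \<mu>"], rule exI[of _ "\<rho>' * \<rho>"], simp add: power_mult_distrib ac_simps)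
  qed
qed

lemma openin_plane_pairs: "openin zariski plane_pairs"
  unfolding openin_zariski_iff
proof
  fix x assume "x \<in> plane_pairs"
  then obtain i j where ij: "i \<in> {1, 2}" "j \<in> {3, 4}" "x $ i \<noteq> 0" "x $ j \<noteq> 0"
    unfolding plane_pairs_def by auto
  then show "\<exists>p. polynomial_fun p \<and> p x \<noteq> 0 \<and> (\<forall>y. p y \<noteq> 0 \<longrightarrow> y \<in> plane_pairs)"
    by (intro exI[of _ "\<lambda>x. x $ i * x $ j"]) (auto simp: plane_pairs_def intro!: polynomial_fun.intros)
qed

lemma liftable_hirzebruch: "liftable plane_pairs (hirzebruch_point n)"
  unfolding liftable_def
proof (intro conjI ballI)
  show "openin zariski plane_pairs" by (rule openin_plane_pairs)
  have "(1 :: complex^4) \<in> plane_pairs" by (simp add: plane_pairs_def)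
  then show "plane_pairs \<noteq> {}" by blast
next
  fix x0 assume "x0 \<in> plane_pairs"
  then obtain i j where ij: "i \<in> {1, 2 :: 4}" "j \<in> {3, 4 :: 4}" "x0 $ i \<noteq> 0" "x0 $ j \<noteq> 0"
    unfolding plane_pairs_def by auto
  let ?V = "{x :: complex^4. x $ i * x $ j \<noteq> 0}"
  \<comment> \<open>The section normalizes a point: \<open>\<rho> = 1 / x $ j\<close> makes the base
    coordinate \<open>j\<close> equal to 1, then \<open>\<mu>\<close> makes the fibre coordinate
    \<open>i\<close> equal to 1. The powers of \<open>x $ j\<close> account for the division by
    \<open>\<rho> ^ n\<close> in the first coordinate.\<close>
  let ?p = "\<lambda>k (x :: complex^4). if k = 1 \<and> i = 2 then x $ 1 * x $ j ^ n else x $ k"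
  let ?q = "\<lambda>k (x :: complex^4). if k = 1 then x $ i else if k = 2 then (if i = 2 then x $ 2 else x $ 1 * x $ j ^ n) else x $ j"
  show "\<exists>V p q. openin zariski V \<and> x0 \<in> V \<and> V \<subseteq> plane_pairs \<and>
        (\<forall>x\<in>V. \<forall>x'\<in>plane_pairs. hirzebruch_point n x = hirzebruch_point n x' \<longrightarrow>
            x' \<in> V \<and> (\<forall>i. p i x / q i x = p i x' / q i x')) \<and>
        (\<forall>i. polynomial_fun (p i) \<and> polynomial_fun (q i)) \<and>
        (\<forall>x\<in>V. (\<forall>i. q i x \<noteq> 0) \<and> (\<chi> i. p i x / q i x) \<in> plane_pairs \<and>
            hirzebruch_point n (\<chi> i. p i x / q i x) = hirzebruch_point n x)"
  proof (rule exI[of _ ?V], rule exI[of _ ?p], rule exI[of _ ?q], intro conjI ballI impI allI)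
    show "openin zariski ?V" by (intro openin_zariski_nonzero polynomial_fun.intros)
    show "x0 \<in> ?V" using ij by simp
    show "?V \<subseteq> plane_pairs" using ij by (auto simp: plane_pairs_def)
    fix k
    show "polynomial_fun (?p k)"
      by (cases "k = 1"; cases "i = 2") (simp_all add: polynomial_fun.intros polynomial_fun_power)
    show "polynomial_fun (?q k)"
      by (cases "k = 1"; cases "k = 2"; cases "i = 2") (simp_all add: polynomial_fun.intros polynomial_fun_power)
  next
    fix x x' assume x: "x \<in> ?V" and "hirzebruch_point n x = hirzebruch_point n x'"
    then obtain \<mu> \<rho> where *: "\<mu> \<noteq> 0" "\<rho> \<noteq> 0" "x' $ 1 = \<mu> * x $ 1 / \<rho> ^ n" "x' $ 2 = \<mu> * x $ 2"
      "x' $ 3 = \<rho> * x $ 3" "x' $ 4 = \<rho> * x $ 4" unfolding hirzebruch_point_eq_iff by blast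
    have j: "x' $ j = \<rho> * x $ j" using * ij by auto
    have i: "x' $ i = (if i = 2 then \<mu> else \<mu> / \<rho> ^ n) * x $ i" using * ij by auto
    show "x' \<in> ?V" using x j i * by auto
    fix k show "?p k x / ?q k x = ?p k x' / ?q k x'"
      using ij(1) x * j exhaust_4[of k] by (auto simp: power_mult_distrib)
  next
    fix x k assume x: "x \<in> ?V"
    show "?q k x \<noteq> 0" using x ij(1) by auto
  next
    fix x assume x: "x \<in> ?V"
    let ?h = "\<chi> k. ?p k x / ?q k x"
    have "hirzebruch_point n x = hirzebruch_point n ?h"
      unfolding hirzebruch_point_eq_iff
    proof (rule exI[of _ "if i = 2 then 1 / x $ 2 else 1 / (x $ 1 * x $ j ^ n)"], rule exI[of _ "1 / x $ j"])
    qed (use x ij(1) in \<open>auto simp: power_divide\<close>)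
    then show "hirzebruch_point n ?h = hirzebruch_point n x" by simp
    have "?h $ i \<noteq> 0" "?h $ j \<noteq> 0" using x ij by auto
    then show "?h \<in> plane_pairs" using ij by (auto simp only: plane_pairs_def mem_Collect_eq insert_iff empty_iff)
  qed
next
  \<comment> \<open>Denominators are cleared by the torus element
    \<open>\<rho> = Q $ 3 * Q $ 4\<close>, \<open>\<mu> = Q $ 1 * Q $ 2 * \<rho> ^ n\<close>; the
    power in \<open>\<mu>\<close> cancels the division by \<open>\<rho> ^ n\<close>.\<close>
  let ?c = "\<lambda>z :: complex^(4 + 4). vector [z $ Inl 1 * z $ Inr 2,
    z $ Inl 2 * z $ Inr 1 * (z $ Inr 3 * z $ Inr 4) ^ n, z $ Inl 3 * z $ Inr 4, z $ Inl 4 * z $ Inr 3] :: complex^4"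
  show "\<exists>c :: complex^(4 + 4) \<Rightarrow> complex^4. polynomial_map c \<and>
        (\<forall>P Q. (\<forall>i. Q $ i \<noteq> 0) \<and> (\<chi> i. P $ i / Q $ i) \<in> plane_pairs \<longrightarrow>
           c (join_vec P Q) \<in> plane_pairs \<and>
           hirzebruch_point n (c (join_vec P Q)) = hirzebruch_point n (\<chi> i. P $ i / Q $ i))"
  proof (intro exI[of _ ?c] conjI allI impI)
    show "polynomial_map ?c"
      by (simp add: polynomial_map_def forall_4 vector_4 polynomial_fun.intros polynomial_fun_power)
    fix P Q :: "complex^4" assume *: "(\<forall>i. Q $ i \<noteq> 0) \<and> (\<chi> i. P $ i / Q $ i) \<in> plane_pairs"
    show "?c (join_vec P Q) \<in> plane_pairs" using * by (simp add: plane_pairs_def vector_4)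
    have "hirzebruch_point n (\<chi> i. P $ i / Q $ i) = hirzebruch_point n (?c (join_vec P Q))"
      unfolding hirzebruch_point_eq_iff
      by (rule exI[of _ "Q $ 1 * Q $ 2 * (Q $ 3 * Q $ 4) ^ n"], rule exI[of _ "Q $ 3 * Q $ 4"])
        (use * in \<open>simp add: vector_4\<close>)
    then show "hirzebruch_point n (?c (join_vec P Q)) = hirzebruch_point n (\<chi> i. P $ i / Q $ i)" by simp
  qed
qed

section \<open>Automorphisms of the minimal surfaces have bounded degree\<close>

text \<open>Let \<open>d\<close> be the common factor of \<open>a\<close>, and \<open>e\<close> the
  factor relating \<open>g\<close> to the primitive part of \<open>a\<close>. Both have no zeros off
  a set of codimension two, so they are constant there by
  \<open>nowhere_zero_imp_const\<close>.\<close>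

lemma no_common_zero_proportional:
  fixes a g :: "'i \<Rightarrow> complex^'n \<Rightarrow> complex"
  assumes prim: "\<exists>d a'. polynomial_fun d \<and> (\<forall>i x. a i x = d x * a' i x) \<and> primitive_family a'"
    and P: "finite P" "\<And>i j. (i, j) \<in> P \<Longrightarrow> i \<noteq> j"
    and a: "\<And>x. (\<And>i j. (i, j) \<in> P \<Longrightarrow> x $ i \<noteq> 0 \<or> x $ j \<noteq> 0) \<Longrightarrow> \<exists>i. a i x \<noteq> 0"
    and g: "\<And>x. (\<And>i j. (i, j) \<in> P \<Longrightarrow> x $ i \<noteq> 0 \<or> x $ j \<noteq> 0) \<Longrightarrow> \<exists>i. g i x \<noteq> 0"
    and pg: "\<And>i. polynomial_fun (g i)"
    and eq: "\<And>i j x. a i x * g j x = a j x * g i x"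
  shows "\<exists>c. c \<noteq> 0 \<and> (\<forall>i x. g i x = c * a i x)"
proof -
  obtain d a' where d: "polynomial_fun d" "\<And>i x. a i x = d x * a' i x" and a': "primitive_family a'"
    using prim by blast
  have pa: "polynomial_fun (a i)" for i
  proof -
    have "a i = (\<lambda>x. d x * a' i x)" using d(2) by auto
    then show ?thesis using polynomial_fun.mult[OF d(1) primitive_family_polynomial_fun[OF a']] by simp
  qed
  have one: "\<And>i j. (i, j) \<in> P \<Longrightarrow> (1 :: complex^'n) $ i \<noteq> 0 \<or> (1 :: complex^'n) $ j \<noteq> 0" by simp
  have dn: "d x \<noteq> 0" if "\<And>i j. (i, j) \<in> P \<Longrightarrow> x $ i \<noteq> 0 \<or> x $ j \<noteq> 0" for x
    using a[OF that] d(2) by auto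
  have "a' i x * g j x = a' j x * g i x" for i j x
    by (rule polynomial_fun_cancel[OF d(1) dn[OF one]])
      (use eq[of i _ j] d(2) primitive_family_polynomial_fun[OF a'] pg in
        \<open>auto simp: mult.assoc[symmetric] intro!: polynomial_fun.mult\<close>)
  from primitive_familyD[OF a' pg this] obtain e where e: "polynomial_fun e" "\<And>i x. g i x = e x * a' i x" by blast
  have en: "e x \<noteq> 0" if "\<And>i j. (i, j) \<in> P \<Longrightarrow> x $ i \<noteq> 0 \<or> x $ j \<noteq> 0" for x
    using g[OF that] e(2) by auto
  let ?U = "{x :: complex^'n. (\<Prod>i\<in>UNIV. x $ i) \<noteq> 0}"
  have U: "openin zariski ?U" "?U \<noteq> {}"
  proof -
    show "openin zariski ?U" by (intro openin_zariski_nonzero polynomial_fun_intros)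
    have "(1 :: complex^'n) \<in> ?U" by simp
    then show "?U \<noteq> {}" by blast
  qed
  have "g i x = e 1 / d 1 * a i x" for i x
  proof (rule polynomial_fun_eq_on_open[OF U pg])
    show "polynomial_fun (\<lambda>x. e 1 / d 1 * a i x)"
      by (rule polynomial_fun.mult[OF polynomial_fun.const pa])
    fix x assume "x \<in> ?U"
    then have x: "\<And>i j. (i, j) \<in> P \<Longrightarrow> x $ i \<noteq> 0 \<or> x $ j \<noteq> 0" by auto
    have "d x = d 1" by (rule nowhere_zero_imp_const[OF d(1) P dn x one]) auto
    moreover have "e x = e 1" by (rule nowhere_zero_imp_const[OF e(1) P en x one]) auto
    ultimately show "g i x = e 1 / d 1 * a i x" using e(2) d(2) dn[OF one] by simp
  qed
  moreover have "e 1 / d 1 \<noteq> 0" using en[OF one] dn[OF one] by simp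
  ultimately show ?thesis by blast
qed

definition inverse_morphisms :: "'a variety \<Rightarrow> ('a \<Rightarrow> 'a) \<Rightarrow> ('a \<Rightarrow> 'a) \<Rightarrow> bool" where
  "inverse_morphisms X f g \<longleftrightarrow> (points X, f) \<in> partial_morphisms X X \<and>
     (points X, g) \<in> partial_morphisms X X \<and> (\<forall>x\<in>points X. g (f x) = x \<and> f (g x) = x)"

lemma local_lift_P2_P2:
  assumes "(U, f) \<in> partial_morphisms P2 P2" "x0 \<noteq> 0" "proj_point x0 \<in> U"
  shows "\<exists>V g. openin zariski V \<and> x0 \<in> V \<and> V \<subseteq> - {0} \<and> polynomial_map g \<and>
    (\<forall>x\<in>V. proj_point x \<in> U \<and> g x \<noteq> (0 :: complex^3) \<and> f (proj_point x) = proj_point (g x))"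
proof -
  have "(U, f) \<in> partial_morphisms P2 (quot (- {0}) proj_point)"
    using assms(1) by (simp only: P2_quotient[symmetric])
  from local_lift_P2[OF liftable_proj_point this assms(2,3)] show ?thesis by simp
qed

text \<open>The primitive part \<open>G\<close> of one local lift is global: every other local lift
  is a polynomial multiple of it, and a lift that is nonzero at a point forces \<open>G\<close> to
  be nonzero there.\<close>

lemma global_lift_P2:
  assumes f: "(points P2, f) \<in> partial_morphisms P2 P2"
  shows "\<exists>G. polynomial_map G \<and> (\<forall>x. x \<noteq> 0 \<longrightarrow> G x \<noteq> 0 \<and> f (proj_point x) = proj_point (G x))"
proof -
  have ll: "\<exists>V g. openin zariski V \<and> x0 \<in> V \<and> V \<subseteq> - {0} \<and> polynomial_map g \<and>
    (\<forall>x\<in>V. g x \<noteq> 0 \<and> f (proj_point x) = proj_point (g x))" if "x0 \<noteq> 0" for x0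
  proof -
    have "proj_point x0 \<in> points P2" using that by (simp add: points_P2)
    from local_lift_P2_P2[OF f that this] show ?thesis by blast
  qed
  have 1: "(1 :: complex^3) \<noteq> 0" by (simp add: vec_eq_iff)
  obtain V g where V: "openin zariski V" "1 \<in> V" "V \<subseteq> - {0}" "polynomial_map g"
    "\<And>x. x \<in> V \<Longrightarrow> g x \<noteq> 0 \<and> f (proj_point x) = proj_point (g x)" using ll[OF 1] by blast
  obtain k where "g 1 $ k \<noteq> 0" using V(5)[OF V(2)] by (auto simp: vec_eq_iff)
  then obtain d G where d: "polynomial_fun d" "\<And>i x. g x $ i = d x * G i x" and G: "primitive_family G"
    using primitive_part_3[of "\<lambda>i x. g x $ i" k 1] V(4) unfolding polynomial_map_def by blast
  let ?G = "\<lambda>x. \<chi> i. G i x"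
  have "?G x \<noteq> 0 \<and> f (proj_point x) = proj_point (?G x)" if x: "x \<noteq> 0" for x
  proof -
    obtain W h where W: "openin zariski W" "x \<in> W" "W \<subseteq> - {0}" "polynomial_map h"
      "\<And>x. x \<in> W \<Longrightarrow> h x \<noteq> 0 \<and> f (proj_point x) = proj_point (h x)" using ll[OF x] by blast
    have VW: "openin zariski (V \<inter> W)" "V \<inter> W \<noteq> {}"
      using V W zariski_opens_meet[of V W] by (auto intro: openin_Int)
    have "G i y * h y $ j = G j y * h y $ i" for i j y
    proof (rule polynomial_fun_eq_on_open[OF VW, where p = "\<lambda>y. G i y * h y $ j" and q = "\<lambda>y. G j y * h y $ i"])
      fix y assume y: "y \<in> V \<inter> W"
      then have "g y \<noteq> 0" "h y \<noteq> 0" "proj_point (g y) = proj_point (h y)" using V(5)[of y] W(5)[of y] by auto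
      then have "g y $ i * h y $ j = g y $ j * h y $ i" using proj_point_eq_iff_minors by blast
      moreover have "d y \<noteq> 0" using \<open>g y \<noteq> 0\<close> d(2)[of y] by (auto simp: vec_eq_iff)
      ultimately show "G i y * h y $ j = G j y * h y $ i" by (simp add: d(2))
    qed (use W(4) primitive_family_polynomial_fun[OF G] in
        \<open>auto simp: polynomial_map_def intro!: polynomial_fun.mult\<close>)
    then obtain e where "\<And>i x. h x $ i = e x * G i x"
      using primitive_familyD[OF G, of "\<lambda>i x. h x $ i"] W(4) unfolding polynomial_map_def by blast
    then have h: "h x = e x *s ?G x" by (simp add: vec_eq_iff)
    have hx: "h x \<noteq> 0" "f (proj_point x) = proj_point (h x)" using W(5)[OF W(2)] by auto
    from hx(1) h have n: "e x \<noteq> 0" "?G x \<noteq> 0" by (metis vector_smult_lzero, metis vector_smult_rzero)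
    then have "proj_point (?G x) = proj_point (h x)" using h proj_point_eq_iff by blast
    then show ?thesis using hx n by simp
  qed
  moreover have "polynomial_map ?G" using primitive_family_polynomial_fun[OF G] by (simp add: polynomial_map_def)
  ultimately show ?thesis by blast
qed

lemma P2_lift_scalar:
  fixes G H :: "complex^3 \<Rightarrow> complex^3"
  assumes "polynomial_map G" "polynomial_map H"
    and "\<And>x. x \<noteq> 0 \<Longrightarrow> G x \<noteq> 0 \<and> H x \<noteq> 0 \<and> proj_point (G x) = proj_point (H x)"
  shows "\<exists>c. c \<noteq> 0 \<and> (\<forall>x. H x = c *s G x)"
proof -
  \<comment> \<open>One pair of coordinates is enough for the codimension-two set: off
    \<open>x $ 1 = x $ 2 = 0\<close> both lifts are nonzero.\<close>
  have nz: "x \<noteq> 0" if "\<And>i j. (i, j) \<in> {(1 :: 3, 2 :: 3)} \<Longrightarrow> x $ i \<noteq> 0 \<or> x $ j \<noteq> 0" for x :: "complex^3"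
    using that by auto
  have "G 1 \<noteq> 0" using assms(3)[of 1] by (simp add: vec_eq_iff)
  then obtain k where k: "G 1 $ k \<noteq> 0" by (auto simp: vec_eq_iff)
  have ex: "\<exists>i. v $ i \<noteq> 0" if "v \<noteq> 0" for v :: "complex^3"
    using that by (auto simp: vec_eq_iff)
  have eq: "G x $ i * H x $ j = G x $ j * H x $ i" for i j x
  proof (rule polynomial_fun_eq_on_open[OF openin_zariski_nonzero_vec, where p = "\<lambda>x. G x $ i * H x $ j" and q = "\<lambda>x. G x $ j * H x $ i"])
    have "(1 :: complex^3) \<in> - {0}" by (simp add: vec_eq_iff)
    then show "- {0 :: complex^3} \<noteq> {}" by blast
    fix y :: "complex^3" assume "y \<in> - {0}"
    then show "G y $ i * H y $ j = G y $ j * H y $ i"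
      using assms(3)[of y] proj_point_eq_iff_minors[of "G y" "H y"] by simp
  qed (use assms(1,2) in \<open>auto simp: polynomial_map_def intro!: polynomial_fun.mult\<close>)
  have "\<exists>c. c \<noteq> 0 \<and> (\<forall>i x. H x $ i = c * G x $ i)"
  proof (rule no_common_zero_proportional[where P = "{(1, 2)}"])
    show "\<exists>d a'. polynomial_fun d \<and> (\<forall>i x. G x $ i = d x * a' i x) \<and> primitive_family a'"
      using primitive_part_3[of "\<lambda>i x. G x $ i" k 1] assms(1) k by (simp add: polynomial_map_def)
  qed (use assms(2,3) nz ex eq in \<open>auto simp: polynomial_map_def\<close>)
  then show ?thesis by (auto simp: vec_eq_iff)
qed

text \<open>Scaling by 2 alone detects the degree, because its powers are distinct: all monomials
  that occur in any component have the same total degree.\<close>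

lemma homogeneous_of_scaling:
  fixes G :: "complex^'n \<Rightarrow> complex^'m"
  assumes "polynomial_map G" "\<And>x. G (2 *s x) = k *s G x" "G x0 \<noteq> 0"
  shows "\<exists>d. (\<forall>i. poly_deg_le d (\<lambda>x. G x $ i)) \<and> (\<forall>t x. G (t *s x) = t ^ d *s G x)"
proof -
  have scale: "(\<chi> i. (2 *s (1 :: complex^'n)) $ i * x $ i) = 2 *s x" for x :: "complex^'n"
    by (simp add: vec_eq_iff)
  have mon: "monomial_fun e (2 *s (1 :: complex^'n)) = 2 ^ (\<Sum>i\<in>UNIV. e i)" for e
    by (simp add: monomial_fun_def power_sum)
  have exp: "\<exists>E c. finite E \<and> (\<forall>e\<in>E. c e \<noteq> 0) \<and> (\<forall>x. G x $ i = (\<Sum>e\<in>E. c e * monomial_fun e x)) \<and>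
     (\<forall>e\<in>E. 2 ^ (\<Sum>i\<in>UNIV. e i) = k)" for i
  proof -
    obtain E c where E: "finite E" "\<forall>e\<in>E. c e \<noteq> 0" "\<forall>x. G x $ i = (\<Sum>e\<in>E. c e * monomial_fun e x)"
      using polynomial_fun_expansion_supp[of "\<lambda>x. G x $ i"] assms(1) unfolding polynomial_map_def by blast
    have "monomial_fun e (2 *s (1 :: complex^'n)) = k" if "e \<in> E" for e
      by (rule semi_invariant_support[OF E _ that]) (subst scale, simp add: assms(2))
    then show ?thesis using E mon by auto
  qed
  obtain i0 where i0: "G x0 $ i0 \<noteq> 0" using assms(3) by (auto simp: vec_eq_iff)
  obtain E0 c0 where E0: "\<forall>x. G x $ i0 = (\<Sum>e\<in>E0. c0 e * monomial_fun e x)"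
     "\<forall>e\<in>E0. 2 ^ (\<Sum>i\<in>UNIV. e i) = k" using exp[of i0] by blast
  have "E0 \<noteq> {}" using E0(1) i0 by auto
  then obtain e0 where "e0 \<in> E0" by blast
  define d where "d = (\<Sum>i\<in>UNIV. e0 i)"
  have k: "k = 2 ^ d" using E0(2) \<open>e0 \<in> E0\<close> d_def by simp
  have "poly_deg_le d (\<lambda>x. G x $ i) \<and> (\<forall>t x. G (t *s x) $ i = t ^ d * G x $ i)" for i
  proof -
    obtain E c where E: "\<forall>x. G x $ i = (\<Sum>e\<in>E. c e * monomial_fun e x)"
      "\<forall>e\<in>E. 2 ^ (\<Sum>i\<in>UNIV. e i) = k" using exp[of i] by blast
    then have de: "(\<Sum>i\<in>UNIV. e i) = d" if "e \<in> E" for e using that k two_power_eq_iff by metis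
    have "monomial_fun e (t *s x) = t ^ d * monomial_fun e x" if "e \<in> E" for e t and x :: "complex^'n"
      using de[OF that] by (simp add: monomial_fun_def power_mult_distrib prod.distrib power_sum[symmetric])
    then have "G (t *s x) $ i = t ^ d * G x $ i" for t x
      unfolding E(1)[rule_format] sum_distrib_left by (intro sum.cong) simp_all
    then show ?thesis using poly_deg_le_expansion[OF E(1)] de by simp
  qed
  then show ?thesis by (auto simp: vec_eq_iff)
qed

text \<open>The lift composed with a lift of the inverse is a scalar multiple of the identity, so
  the degrees of the two lifts multiply to 1.\<close>

lemma Aut_lift_P2:
  assumes "inverse_morphisms P2 f g"
  shows "\<exists>G. (\<forall>i. poly_deg_le 1 (\<lambda>x. G x $ i)) \<and> (\<forall>x. x \<noteq> 0 \<longrightarrow> G x \<noteq> 0 \<and> f (proj_point x) = proj_point (G x))"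
proof -
  have f: "(points P2, f) \<in> partial_morphisms P2 P2" and g: "(points P2, g) \<in> partial_morphisms P2 P2"
    and fg: "\<And>x. x \<noteq> 0 \<Longrightarrow> g (f (proj_point x)) = proj_point x"
    using assms by (auto simp: inverse_morphisms_def points_P2)
  obtain G where G: "polynomial_map G" "\<And>x. x \<noteq> 0 \<Longrightarrow> G x \<noteq> 0 \<and> f (proj_point x) = proj_point (G x)"
    using global_lift_P2[OF f] by blast
  obtain H where H: "polynomial_map H" "\<And>x. x \<noteq> 0 \<Longrightarrow> H x \<noteq> 0 \<and> g (proj_point x) = proj_point (H x)"
    using global_lift_P2[OF g] by blast
  have 1: "(1 :: complex^3) \<noteq> 0" by (simp add: vec_eq_iff)
  have p2: "proj_point (2 *s x) = proj_point x" for x :: "complex^3"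
    by (subst eq_commute) (auto simp: proj_point_eq_iff intro!: exI[of _ 2])
  have hom: "\<exists>d. (\<forall>i. poly_deg_le d (\<lambda>x. K x $ i)) \<and> (\<forall>t x. K (t *s x) = t ^ d *s K x)"
    if K: "polynomial_map K" "\<And>x. x \<noteq> 0 \<Longrightarrow> K x \<noteq> 0 \<and> h (proj_point x) = proj_point (K x)"
    for K :: "complex^3 \<Rightarrow> complex^3" and h
  proof -
    have "polynomial_map (\<lambda>x. K (2 *s x))"
      by (rule polynomial_map_comp[OF K(1)]) (auto simp: polynomial_map_def intro!: polynomial_fun.intros)
    moreover have "K x \<noteq> 0 \<and> K (2 *s x) \<noteq> 0 \<and> proj_point (K x) = proj_point (K (2 *s x))" if "x \<noteq> 0" for x
    proof -
      have "2 *s x \<noteq> 0" using that by simp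
      then show ?thesis using K(2)[OF that] K(2)[of "2 *s x"] p2 by metis
    qed
    ultimately obtain c where "\<forall>x. K (2 *s x) = c *s K x" using P2_lift_scalar[OF K(1)] by blast
    then show ?thesis using homogeneous_of_scaling[OF K(1)] K(2)[OF 1] by blast
  qed
  obtain d where d: "\<forall>i. poly_deg_le d (\<lambda>x. G x $ i)" "\<And>t x. G (t *s x) = t ^ d *s G x" using hom[OF G] by blast
  obtain d' where d': "\<And>t x. H (t *s x) = t ^ d' *s H x" using hom[OF H] by blast
  have "polynomial_map (\<lambda>x :: complex^3. x)" by (simp add: polynomial_map_def polynomial_fun.coord)
  moreover have "x \<noteq> 0 \<and> H (G x) \<noteq> 0 \<and> proj_point x = proj_point (H (G x))" if "x \<noteq> 0" for x
    using G(2)[OF that] H(2)[of "G x"] fg[OF that] that by simp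
  ultimately obtain \<rho> where \<rho>: "\<rho> \<noteq> 0" "\<And>x. H (G x) = \<rho> *s x"
    using P2_lift_scalar[OF _ polynomial_map_comp[OF H(1) G(1)]] by blast
  have "H (G (2 *s 1)) $ 1 = (2 ^ d) ^ d' * H (G 1) $ 1" by (simp add: d(2) d')
  then have "\<rho> * 2 = (2 ^ d) ^ d' * \<rho>" by (simp add: \<rho>(2))
  then have "(2 :: complex) ^ (d * d') = 2 ^ 1" using \<rho>(1) by (simp add: power_mult)
  then have "d = 1" by (simp only: two_power_eq_iff) simp
  then show ?thesis using d(1) G(2) by blast
qed

section \<open>Lifts and weights on Hirzebruch surfaces\<close>

definition hirzebruch_act :: "nat \<Rightarrow> complex \<Rightarrow> complex \<Rightarrow> complex^4 \<Rightarrow> complex^4" where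
  "hirzebruch_act n \<mu> \<rho> v = vector [\<mu> * v $ 1 / \<rho> ^ n, \<mu> * v $ 2, \<rho> * v $ 3, \<rho> * v $ 4]"

lemma hirzebruch_act_component [simp]:
  "hirzebruch_act n \<mu> \<rho> v $ 1 = \<mu> * v $ 1 / \<rho> ^ n" "hirzebruch_act n \<mu> \<rho> v $ 2 = \<mu> * v $ 2"
  "hirzebruch_act n \<mu> \<rho> v $ 3 = \<rho> * v $ 3" "hirzebruch_act n \<mu> \<rho> v $ 4 = \<rho> * v $ 4"
  by (simp_all add: hirzebruch_act_def vector_4)

lemma hirzebruch_point_eq_iff_act:
  "hirzebruch_point n v = hirzebruch_point n w \<longleftrightarrow> (\<exists>\<mu> \<rho>. \<mu> \<noteq> 0 \<and> \<rho> \<noteq> 0 \<and> w = hirzebruch_act n \<mu> \<rho> v)"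
  unfolding hirzebruch_point_eq_iff by (simp add: vec_eq_iff forall_4)

lemma plane_pairs_act: "\<mu> \<noteq> 0 \<Longrightarrow> \<rho> \<noteq> 0 \<Longrightarrow> hirzebruch_act n \<mu> \<rho> v \<in> plane_pairs \<longleftrightarrow> v \<in> plane_pairs"
  by (simp add: plane_pairs_def)

lemma polynomial_map_act: "polynomial_map (hirzebruch_act n \<mu> \<rho>)"
proof -
  have "polynomial_fun (\<lambda>x :: complex^4. \<mu> / \<rho> ^ n * x $ 1)" by (intro polynomial_fun.intros)
  then show ?thesis by (simp add: polynomial_map_def forall_4 polynomial_fun.intros)
qed

lemma points_hirzebruch: "points (hirzebruch n) = hirzebruch_point n ` plane_pairs"
  unfolding hirzebruch_quotient by (rule points_quotient_variety[OF openin_plane_pairs])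

lemma local_lift_hirzebruch:
  assumes "liftable X \<pi>" "(U, f) \<in> partial_morphisms (hirzebruch n) (quot X \<pi>)"
    "x0 \<in> plane_pairs" "hirzebruch_point n x0 \<in> U"
  shows "\<exists>V g. openin zariski V \<and> x0 \<in> V \<and> V \<subseteq> plane_pairs \<and> polynomial_map g \<and>
    (\<forall>x\<in>V. hirzebruch_point n x \<in> U \<and> g x \<in> X \<and> f (hirzebruch_point n x) = \<pi> (g x))"
  using local_lift[OF assms(1) liftable_open[OF liftable_hirzebruch[of n]], of U f "hirzebruch_point n" x0] assms(2-4)
  unfolding hirzebruch_quotient by simp

lemma one_plane_pairs: "(1 :: complex^4) \<in> plane_pairs"
  by (simp add: plane_pairs_def)

text \<open>As for the plane, but the order matters: the base pair is made primitive first, because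
  removing its common factor changes the first fibre coordinate, and the fibre pair
  afterwards.\<close>

lemma global_lift_hirzebruch:
  assumes f: "(points (hirzebruch n), f) \<in> partial_morphisms (hirzebruch n) (hirzebruch n)"
  shows "\<exists>G. polynomial_map G \<and>
    (\<forall>x\<in>plane_pairs. G x \<in> plane_pairs \<and> f (hirzebruch_point n x) = hirzebruch_point n (G x))"
proof -
  have f': "(points (hirzebruch n), f) \<in> partial_morphisms (hirzebruch n) (quot plane_pairs (hirzebruch_point n))"
    using f by (simp only: hirzebruch_quotient[symmetric])
  have ll: "\<exists>V g. openin zariski V \<and> x0 \<in> V \<and> V \<subseteq> plane_pairs \<and> polynomial_map g \<and>
    (\<forall>x\<in>V. g x \<in> plane_pairs \<and> f (hirzebruch_point n x) = hirzebruch_point n (g x))" if "x0 \<in> plane_pairs" for x0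
  proof -
    have "hirzebruch_point n x0 \<in> points (hirzebruch n)" using that by (simp add: points_hirzebruch)
    from local_lift_hirzebruch[OF liftable_hirzebruch f' that this] show ?thesis by blast
  qed
  obtain V g where V: "openin zariski V" "1 \<in> V" "V \<subseteq> plane_pairs" "polynomial_map g"
    "\<And>x. x \<in> V \<Longrightarrow> g x \<in> plane_pairs \<and> f (hirzebruch_point n x) = hirzebruch_point n (g x)"
    using ll[OF one_plane_pairs] by blast
  have pg: "polynomial_fun (\<lambda>x. g x $ i)" for i using V(4) by (simp add: polynomial_map_def)
  have g1: "g 1 \<in> plane_pairs" using V(2,5) by blast
  \<comment> \<open>The type \<open>bool\<close> indexes the two members of a pair,
    \<open>True\<close> being the first.\<close>
  define b where "b x t = (if t then g x $ 3 else g x $ 4)" for x t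
  have pb: "polynomial_fun (\<lambda>x. b x t)" for t using pg by (cases t) (simp_all add: b_def)
  have "\<exists>t. b 1 t \<noteq> 0" using g1 by (auto simp: plane_pairs_def b_def)
  then obtain t0 where "b 1 t0 \<noteq> 0" ..
  from primitive_part_4[of "\<lambda>t x. b x t", OF pb this]
  obtain e B where e: "polynomial_fun e" "\<And>t x. b x t = e x * B t x" and B: "primitive_family B" by blast
  have en: "e x \<noteq> 0" if "x \<in> V" for x
    using V(5)[OF that] e(2)[of x True] e(2)[of x False] by (auto simp: plane_pairs_def b_def)
  \<comment> \<open>Dividing the base pair by \<open>e\<close> is the action of
    \<open>\<rho> = 1 / e\<close>, which multiplies the first fibre coordinate by
    \<open>e ^ n\<close>.\<close>
  define a where "a x t = (if t then g x $ 1 * e x ^ n else g x $ 2)" for x t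
  have pa: "polynomial_fun (\<lambda>x. a x t)" for t
    using pg e(1) by (cases t) (simp_all add: a_def polynomial_fun.mult polynomial_fun_power)
  have "\<exists>t. a 1 t \<noteq> 0" using g1 en[OF V(2)] by (auto simp: plane_pairs_def a_def)
  then obtain t1 where "a 1 t1 \<noteq> 0" ..
  from primitive_part_4[of "\<lambda>t x. a x t", OF pa this]
  obtain d A where d: "polynomial_fun d" "\<And>t x. a x t = d x * A t x" and A: "primitive_family A" by blast
  have dn: "d x \<noteq> 0" if "x \<in> V" for x
    using V(5)[OF that] d(2)[of x True] d(2)[of x False] en[OF that] by (auto simp: plane_pairs_def a_def)
  let ?G = "\<lambda>x. vector [A True x, A False x, B True x, B False x] :: complex^4"
  note pA = primitive_family_polynomial_fun[OF A] and pB = primitive_family_polynomial_fun[OF B]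
  have "?G x \<in> plane_pairs \<and> f (hirzebruch_point n x) = hirzebruch_point n (?G x)" if x: "x \<in> plane_pairs" for x
  proof -
    obtain W h where W: "openin zariski W" "x \<in> W" "W \<subseteq> plane_pairs" "polynomial_map h"
      "\<And>x. x \<in> W \<Longrightarrow> h x \<in> plane_pairs \<and> f (hirzebruch_point n x) = hirzebruch_point n (h x)" using ll[OF x] by blast
    have ph: "polynomial_fun (\<lambda>x. h x $ i)" for i using W(4) by (simp add: polynomial_map_def)
    have VW: "openin zariski (V \<inter> W)" "V \<inter> W \<noteq> {}"
      using V W zariski_opens_meet[of V W] by (auto intro: openin_Int)
    have rel: "\<exists>\<mu> \<rho>. \<mu> \<noteq> 0 \<and> \<rho> \<noteq> 0 \<and> h y = hirzebruch_act n \<mu> \<rho> (g y)" if "y \<in> V \<inter> W" for y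
      using V(5)[of y] W(5)[of y] that hirzebruch_point_eq_iff_act[of n "g y" "h y"] by auto
    define hb where "hb t y = (if t then h y $ 3 else h y $ 4)" for t y
    have phb: "polynomial_fun (hb t)" for t unfolding hb_def using ph by (cases t) simp_all
    have "B s y * hb t y = B t y * hb s y" for s t y
    proof (rule polynomial_fun_eq_on_open[OF VW, where p = "\<lambda>y. B s y * hb t y" and q = "\<lambda>y. B t y * hb s y"])
      fix y assume y: "y \<in> V \<inter> W"
      then obtain \<mu> \<rho> where "\<mu> \<noteq> 0" "\<rho> \<noteq> 0" "h y = hirzebruch_act n \<mu> \<rho> (g y)" using rel by blast
      then have "hb t y = \<rho> * e y * B t y" for t using e(2)[of y t] by (cases t) (simp_all add: hb_def b_def)
      then show "B s y * hb t y = B t y * hb s y" by simp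
    qed (intro polynomial_fun.mult pB phb)+
    from primitive_familyD[OF B phb this] obtain e' where e': "polynomial_fun e'" "\<And>t y. hb t y = e' y * B t y" by blast
    define ha where "ha t y = (if t then h y $ 1 * e' y ^ n else h y $ 2)" for t y
    have pha: "polynomial_fun (ha t)" for t
      unfolding ha_def using ph e'(1) by (cases t) (simp_all add: polynomial_fun.mult polynomial_fun_power)
    have "A s y * ha t y = A t y * ha s y" for s t y
    proof (rule polynomial_fun_eq_on_open[OF VW, where p = "\<lambda>y. A s y * ha t y" and q = "\<lambda>y. A t y * ha s y"])
      fix y assume y: "y \<in> V \<inter> W"
      then obtain \<mu> \<rho> where r: "\<mu> \<noteq> 0" "\<rho> \<noteq> 0" "h y = hirzebruch_act n \<mu> \<rho> (g y)" using rel by blast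
      have "hb t y = \<rho> * b y t" for t using r(3) by (cases t) (simp_all add: hb_def b_def)
      then have "e' y * B t y = \<rho> * e y * B t y" for t using e'(2)[of t y] e(2)[of y t] by auto
      moreover have "B True y \<noteq> 0 \<or> B False y \<noteq> 0"
        using V(5)[of y] y e(2)[of y True] e(2)[of y False] by (auto simp: plane_pairs_def b_def)
      \<comment> \<open>The parameter \<open>\<rho>\<close> of the pointwise relation is the
        quotient of the two common factors; this makes the corrected fibre pairs
        proportional.\<close>
      ultimately have "e' y = \<rho> * e y" by (metis mult_right_cancel)
      then have "ha t y = \<mu> * a y t" for t
        using r by (cases t) (simp_all add: ha_def a_def power_mult_distrib)
      then show "A s y * ha t y = A t y * ha s y" by (simp add: d(2))
    qed (intro polynomial_fun.mult pA pha)+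
    from primitive_familyD[OF A pha this] obtain d' where d': "\<And>t y. ha t y = d' y * A t y" by blast
    have hx: "h x \<in> plane_pairs" "f (hirzebruch_point n x) = hirzebruch_point n (h x)" using W(5)[OF W(2)] by auto
    have e'x: "e' x \<noteq> 0" using hx(1) e'(2)[of True x] e'(2)[of False x] by (auto simp: plane_pairs_def hb_def)
    have d'x: "d' x \<noteq> 0" using hx(1) d'[of True x] d'[of False x] e'x by (auto simp: plane_pairs_def ha_def)
    have "h x = hirzebruch_act n (d' x) (e' x) (?G x)"
      using d'[of True x] d'[of False x] e'(2)[of True x] e'(2)[of False x] e'x
      by (simp add: vec_eq_iff forall_4 vector_4 ha_def hb_def field_simps)
    then show ?thesis
      using hx e'x d'x hirzebruch_point_eq_iff_act[of n "?G x" "h x"] plane_pairs_act[OF d'x e'x, of n "?G x"] by auto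
  qed
  moreover have "polynomial_map ?G" using pA pB by (simp add: polynomial_map_def forall_4 vector_4)
  ultimately show ?thesis by blast
qed

lemma plane_pairs_codim_two:
  "x \<in> plane_pairs \<longleftrightarrow> (\<forall>i j. (i, j) \<in> {(1, 2), (3 :: 4, 4 :: 4)} \<longrightarrow> x $ i \<noteq> 0 \<or> x $ j \<noteq> 0)"
  by (auto simp: plane_pairs_def)

lemma plane_pairs_proportional:
  fixes a b :: "bool \<Rightarrow> complex^4 \<Rightarrow> complex"
  assumes "\<And>t. polynomial_fun (a t)" "\<And>t. polynomial_fun (b t)"
    and nz: "\<And>x. x \<in> plane_pairs \<Longrightarrow> (\<exists>t. a t x \<noteq> 0) \<and> (\<exists>t. b t x \<noteq> 0) \<and> a True x * b False x = a False x * b True x"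
  shows "\<exists>c. c \<noteq> 0 \<and> (\<forall>t x. b t x = c * a t x)"
proof -
  obtain t0 where t0: "a t0 1 \<noteq> 0" using nz[OF one_plane_pairs] by blast
  have *: "a True x * b False x = a False x * b True x" for x
  proof (rule polynomial_fun_eq_on_open[OF openin_plane_pairs,
        where p = "\<lambda>x. a True x * b False x" and q = "\<lambda>x. a False x * b True x"])
    show "plane_pairs \<noteq> {}" using one_plane_pairs by blast
  qed (use assms in \<open>auto intro: polynomial_fun.mult\<close>)
  have "a s x * b t x = a t x * b s x" for s t x using *[of x] by (cases s; cases t) auto
  then show ?thesis
    by (intro no_common_zero_proportional[where P = "{(1, 2), (3, 4)}"])
      (use assms(2) nz plane_pairs_codim_two primitive_part_4[of a, OF assms(1) t0] in auto)
qed

text \<open>Pointwise the two lifts differ by a torus element that may depend on the point. The base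
  pairs have no common zero on \<open>plane_pairs\<close>, which makes \<open>\<rho>\<close>
  constant; with \<open>\<rho>\<close> known, the fibre pairs do the same for
  \<open>\<mu>\<close>.\<close>

lemma hirzebruch_lift_scalar:
  assumes G: "polynomial_map G" and H: "polynomial_map H"
    and eq: "\<And>x. x \<in> plane_pairs \<Longrightarrow> G x \<in> plane_pairs \<and> H x \<in> plane_pairs \<and>
      hirzebruch_point n (G x) = hirzebruch_point n (H x)"
  shows "\<exists>\<mu> \<rho>. \<mu> \<noteq> 0 \<and> \<rho> \<noteq> 0 \<and> (\<forall>x. H x = hirzebruch_act n \<mu> \<rho> (G x))"
proof -
  have pG: "polynomial_fun (\<lambda>x. G x $ i)" and pH: "polynomial_fun (\<lambda>x. H x $ i)" for i
    using G H by (simp_all add: polynomial_map_def)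
  have act: "\<exists>\<mu> \<rho>. \<mu> \<noteq> 0 \<and> \<rho> \<noteq> 0 \<and> H x = hirzebruch_act n \<mu> \<rho> (G x)" if "x \<in> plane_pairs" for x
    using eq[OF that] hirzebruch_point_eq_iff_act[of n "G x" "H x"] by auto
  have "\<exists>\<rho>. \<rho> \<noteq> 0 \<and> (\<forall>t x. (if t then H x $ 3 else H x $ 4) = \<rho> * (if t then G x $ 3 else G x $ 4))"
  proof (rule plane_pairs_proportional)
    fix t
    show "polynomial_fun (\<lambda>x. if t then G x $ 3 else G x $ 4)" using pG by (cases t) simp_all
    show "polynomial_fun (\<lambda>x. if t then H x $ 3 else H x $ 4)" using pH by (cases t) simp_all
  next
    fix x assume x: "x \<in> plane_pairs"
    then obtain \<mu> \<rho> where "\<mu> \<noteq> 0" "\<rho> \<noteq> 0" "H x = hirzebruch_act n \<mu> \<rho> (G x)" using act by blast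
    moreover have "\<exists>t. (if t then v $ 3 else v $ 4) \<noteq> 0" if "v \<in> plane_pairs" for v :: "complex^4"
      using that by (auto simp: plane_pairs_def)
    ultimately show "(\<exists>t. (if t then G x $ 3 else G x $ 4) \<noteq> 0) \<and> (\<exists>t. (if t then H x $ 3 else H x $ 4) \<noteq> 0) \<and>
       (if True then G x $ 3 else G x $ 4) * (if False then H x $ 3 else H x $ 4) =
       (if False then G x $ 3 else G x $ 4) * (if True then H x $ 3 else H x $ 4)"
      using eq[OF x] by simp
  qed
  then obtain \<rho> where r: "\<rho> \<noteq> 0"
    "\<And>t x. (if t then H x $ 3 else H x $ 4) = \<rho> * (if t then G x $ 3 else G x $ 4)" by blast
  have \<rho>: "\<rho> \<noteq> 0" "H x $ 3 = \<rho> * G x $ 3" "H x $ 4 = \<rho> * G x $ 4" for x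
    using r(1) r(2)[of True x] r(2)[of False x] by simp_all
  have "\<exists>\<mu>. \<mu> \<noteq> 0 \<and> (\<forall>t x. (if t then \<rho> ^ n * H x $ 1 else H x $ 2) = \<mu> * (if t then G x $ 1 else G x $ 2))"
  proof (rule plane_pairs_proportional)
    fix t
    show "polynomial_fun (\<lambda>x. if t then G x $ 1 else G x $ 2)" using pG by (cases t) simp_all
    show "polynomial_fun (\<lambda>x. if t then \<rho> ^ n * H x $ 1 else H x $ 2)"
      using pH by (cases t) (simp_all add: polynomial_fun.intros)
  next
    fix x assume x: "x \<in> plane_pairs"
    then obtain \<mu> \<rho>' where *: "\<mu> \<noteq> 0" "\<rho>' \<noteq> 0" "H x = hirzebruch_act n \<mu> \<rho>' (G x)" using act by blast
    have "G x \<in> plane_pairs" "H x \<in> plane_pairs" using eq[OF x] by auto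
    moreover have "\<rho>' = \<rho>" using \<open>G x \<in> plane_pairs\<close> *(3) \<rho>(2,3)[of x] by (auto simp: plane_pairs_def)
    ultimately show "(\<exists>t. (if t then G x $ 1 else G x $ 2) \<noteq> 0) \<and> (\<exists>t. (if t then \<rho> ^ n * H x $ 1 else H x $ 2) \<noteq> 0) \<and>
       (if True then G x $ 1 else G x $ 2) * (if False then \<rho> ^ n * H x $ 1 else H x $ 2) =
       (if False then G x $ 1 else G x $ 2) * (if True then \<rho> ^ n * H x $ 1 else H x $ 2)"
      using * \<rho>(1) by (auto simp: plane_pairs_def)
  qed
  then obtain \<mu> where m: "\<mu> \<noteq> 0"
    "\<And>t x. (if t then \<rho> ^ n * H x $ 1 else H x $ 2) = \<mu> * (if t then G x $ 1 else G x $ 2)" by blast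
  have \<mu>: "\<mu> \<noteq> 0" "\<rho> ^ n * H x $ 1 = \<mu> * G x $ 1" "H x $ 2 = \<mu> * G x $ 2" for x
    using m(1) m(2)[of True x] m(2)[of False x] by simp_all
  have "H x = hirzebruch_act n \<mu> \<rho> (G x)" for x
    using \<rho> \<mu>(2)[of x] \<mu>(3)[of x] by (simp add: vec_eq_iff forall_4 field_simps)
  then show ?thesis using \<rho>(1) \<mu>(1) by blast
qed

text \<open>The weights are those of the torus action defining \<open>hirzebruch n\<close>.\<close>

definition bihomogeneous :: "nat \<Rightarrow> (complex^4 \<Rightarrow> complex) \<Rightarrow> int \<Rightarrow> int \<Rightarrow> bool" where
  "bihomogeneous n P u v \<longleftrightarrow> (\<exists>E c. E \<noteq> {} \<and> (\<forall>x. P x = (\<Sum>e\<in>E. c e * monomial_fun e x)) \<and>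
     (\<forall>e\<in>E. int (e 1) + int (e 2) = u \<and> int (e 3) + int (e 4) - int n * int (e 1) = v))"

lemma monomial_fun_4: "monomial_fun e x = x $ 1 ^ e 1 * x $ 2 ^ e 2 * x $ 3 ^ e 3 * x $ (4 :: 4) ^ e 4"
  unfolding monomial_fun_def UNIV_4 by (simp add: mult.assoc)

lemma monomial_fun_act:
  assumes "\<mu> \<noteq> 0" "\<rho> \<noteq> 0"
  shows "monomial_fun e (hirzebruch_act n \<mu> \<rho> x) =
    \<mu> powi (int (e 1) + int (e 2)) * \<rho> powi (int (e 3) + int (e 4) - int n * int (e 1)) * monomial_fun e x"
proof -
  have 1: "\<mu> powi (int (e 1) + int (e 2)) = \<mu> ^ e 1 * \<mu> ^ e 2"
    using assms by (simp add: power_int_add)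
  have "\<rho> powi (int n * int (e 1)) = (\<rho> ^ n) ^ e 1"
    by (metis power_int_mult power_int_of_nat)
  then have 2: "\<rho> powi (int (e 3) + int (e 4) - int n * int (e 1)) = \<rho> ^ e 3 * \<rho> ^ e 4 / (\<rho> ^ n) ^ e 1"
    using assms by (simp add: power_int_diff power_int_add)
  show ?thesis unfolding monomial_fun_4 1 2
    by (simp add: power_mult_distrib power_divide)
qed

lemma bihomogeneous_act:
  assumes "bihomogeneous n P u v" "\<mu> \<noteq> 0" "\<rho> \<noteq> 0"
  shows "P (hirzebruch_act n \<mu> \<rho> x) = \<mu> powi u * \<rho> powi v * P x"
proof -
  obtain E c where E: "\<forall>x. P x = (\<Sum>e\<in>E. c e * monomial_fun e x)"
    "\<forall>e\<in>E. int (e 1) + int (e 2) = u \<and> int (e 3) + int (e 4) - int n * int (e 1) = v"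
    using assms(1) unfolding bihomogeneous_def by blast
  show ?thesis unfolding E(1)[rule_format] sum_distrib_left
    using E(2) by (intro sum.cong refl) (simp add: monomial_fun_act[OF assms(2,3)])
qed

lemma two_powi_inject: "(2 :: complex) powi a = 2 powi b \<longleftrightarrow> a = b"
proof
  assume "(2 :: complex) powi a = 2 powi b"
  then have "norm ((2 :: complex) powi a) = norm ((2 :: complex) powi b)" by simp
  then have "(2 :: real) powi a = 2 powi b" by (simp add: norm_power_int)
  then have "2 powr of_int a = (2 :: real) powr of_int b" by (simp add: powr_real_of_int')
  then show "a = b" by (simp add: powr_inj)
qed simp

text \<open>The torus elements \<open>(2, 1)\<close> and \<open>(1, 2)\<close> separate the weights,
  because integer powers of 2 are distinct. Weights are integers and not naturals: the second weight
  of \<open>x $ 1\<close> is \<open>- n\<close>.\<close>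

lemma bihomogeneous_of_semi_invariant:
  assumes P: "polynomial_fun P" "P x0 \<noteq> 0"
    and inv: "\<And>x. P (hirzebruch_act n 2 1 x) = k * P x" "\<And>x. P (hirzebruch_act n 1 2 x) = l * P x"
  shows "\<exists>u v. bihomogeneous n P u v \<and> k = 2 powi u \<and> l = 2 powi v"
proof -
  obtain E c where E: "finite E" "\<forall>e\<in>E. c e \<noteq> 0" "\<forall>x. P x = (\<Sum>e\<in>E. c e * monomial_fun e x)"
    using polynomial_fun_expansion_supp[OF P(1)] by blast
  have act: "(\<chi> i. hirzebruch_act n \<mu> \<rho> 1 $ i * x $ i) = hirzebruch_act n \<mu> \<rho> x" for \<mu> \<rho> x
    by (simp add: vec_eq_iff forall_4)
  have one: "monomial_fun e (1 :: complex^4) = 1" for e by (simp add: monomial_fun_def)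
  have k: "2 powi (int (e 1) + int (e 2)) = k" and l: "2 powi (int (e 3) + int (e 4) - int n * int (e 1)) = l"
    if "e \<in> E" for e
  proof -
    have "monomial_fun e (hirzebruch_act n 2 1 1) = k"
      by (rule semi_invariant_support[OF E _ that]) (simp only: act inv)
    then show "2 powi (int (e 1) + int (e 2)) = k" by (simp add: monomial_fun_act one)
    have "monomial_fun e (hirzebruch_act n 1 2 1) = l"
      by (rule semi_invariant_support[OF E _ that]) (simp only: act inv)
    then show "2 powi (int (e 3) + int (e 4) - int n * int (e 1)) = l" by (simp add: monomial_fun_act one)
  qed
  have "E \<noteq> {}" using E(3) P(2) by auto
  then obtain e0 where e0: "e0 \<in> E" by blast
  let ?u = "int (e0 1) + int (e0 2)" and ?v = "int (e0 3) + int (e0 4) - int n * int (e0 1)"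
  have "\<forall>e\<in>E. int (e 1) + int (e 2) = ?u \<and> int (e 3) + int (e 4) - int n * int (e 1) = ?v"
    using trans[OF k k[OF e0, symmetric]] trans[OF l l[OF e0, symmetric]] by (simp add: two_powi_inject)
  then have "bihomogeneous n P ?u ?v" unfolding bihomogeneous_def using E(3) \<open>E \<noteq> {}\<close> by blast
  then show ?thesis using k[OF e0] l[OF e0] by blast
qed

text \<open>The coordinates have weights \<open>(1, - n)\<close>, \<open>(1, 0)\<close>,
  \<open>(0, 1)\<close>, \<open>(0, 1)\<close>, and these generate the cone of effective
  weights.\<close>

lemma bihomogeneous_bounds:
  assumes "bihomogeneous n P u v"
  shows "u \<ge> 0" "v \<ge> - (int n * u)"
proof -
  obtain E c where E: "E \<noteq> {}" "\<forall>e\<in>E. int (e 1) + int (e 2) = u \<and> int (e 3) + int (e 4) - int n * int (e (1 :: 4)) = v"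
    using assms unfolding bihomogeneous_def by blast
  then obtain e where e: "int (e 1) + int (e 2) = u" "int (e 3) + int (e 4) - int n * int (e (1 :: 4)) = v" by blast
  then show "u \<ge> 0" by linarith
  have "int n * int (e 1) \<le> int n * u" using e(1) by (intro mult_left_mono) auto
  then show "v \<ge> - (int n * u)" using e(2) by linarith
qed

text \<open>The total degree of a monomial is \<open>u + v + n * e 1\<close>, and \<open>e 1\<close>
  is at most \<open>u\<close>.\<close>

lemma bihomogeneous_poly_deg_le:
  assumes "bihomogeneous n P u v" "u + v + int n * u \<le> int d"
  shows "poly_deg_le d P"
proof -
  obtain E c where E: "\<forall>x. P x = (\<Sum>e\<in>E. c e * monomial_fun e x)"
    "\<forall>e\<in>E. int (e 1) + int (e 2) = u \<and> int (e 3) + int (e 4) - int n * int (e 1) = v"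
    using assms(1) unfolding bihomogeneous_def by blast
  show ?thesis
  proof (rule poly_deg_le_expansion[OF E(1)])
    fix e assume "e \<in> E"
    then have e: "int (e 1) + int (e 2) = u" "int (e 3) + int (e 4) - int n * int (e 1) = v" using E(2) by auto
    have "int n * int (e 1) \<le> int n * u" using e(1) by (intro mult_left_mono) auto
    then show "(\<Sum>i\<in>UNIV. e i) \<le> d" using e assms(2) unfolding sum_4 by linarith
  qed
qed

text \<open>A monomial of this weight without \<open>x $ 1\<close> would have degree
  \<open>- n\<close> in the base coordinates. For positive \<open>n\<close>,
  \<open>x $ 1 = 0\<close> is the section with negative self-intersection.\<close>

lemma bihomogeneous_vanish:
  assumes "bihomogeneous n P 1 (- int n)" "n > 0" "x $ 1 = 0"
  shows "P x = 0"
proof -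
  obtain E c where E: "\<forall>x. P x = (\<Sum>e\<in>E. c e * monomial_fun e x)"
    "\<forall>e\<in>E. int (e 1) + int (e 2) = 1 \<and> int (e 3) + int (e 4) - int n * int (e 1) = - int n"
    using assms(1) unfolding bihomogeneous_def by blast
  have "monomial_fun e x = 0" if "e \<in> E" for e
  proof -
    have e: "int (e 1) + int (e 2) = 1" "int (e 3) + int (e 4) - int n * int (e 1) = - int n" using E(2) that by auto
    have "e 1 \<noteq> 0"
    proof
      assume "e 1 = 0"
      then have "int (e 3) + int (e 4) = - int n" using e(2) by simp
      then show False using assms(2) by linarith
    qed
    then show ?thesis using assms(3) unfolding monomial_fun_4 by simp
  qed
  then show ?thesis using E(1) by simp
qed

text \<open>The weights of an automorphism and of its inverse form inverse integer matrices that both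
  preserve the cone of effective weights, so they fix or swap its two extremal rays.\<close>

lemma weight_matrix_cases:
  fixes p q r s p' q' r' s' n :: int
  assumes inv: "r * r' + p * s' = 1" "s * r' + q * s' = 0" "r * p' + p * q' = 0" "s * p' + q * q' = 1"
    and eff: "p \<ge> 0" "q \<ge> - (n * p)" "r - n * p \<ge> 0" "s - n * q \<ge> - (n * (r - n * p))"
    and eff': "p' \<ge> 0" "q' \<ge> - (n * p')" "r' - n * p' \<ge> 0" "s' - n * q' \<ge> - (n * (r' - n * p'))"
    and n: "n \<ge> 0"
  shows "p = 0 \<and> q = 1 \<and> r = 1 \<and> s = 0 \<or> p = 1 \<and> q = - n \<and> r = n \<and> s = 1 - n * n"
proof -
  define D where "D = r * q - p * s"
  define D' where "D' = r' * q' - p' * s'"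
  have "D * D' = (r * r' + p * s') * (s * p' + q * q') - (s * r' + q * s') * (r * p' + p * q')"
    unfolding D_def D'_def by (simp add: algebra_simps)
  then have "D * D' = 1" using inv by simp
  then consider "D = 1" | "D = -1" using zmult_eq_1_iff by blast
  \<comment> \<open>Cramer's rule: up to the sign \<open>D\<close>, the primed matrix is the
    adjugate of the unprimed one.\<close>
  moreover have e: "D * r' = q" "D * s' = - s" "D * p' = - p" "D * q' = r"
  proof -
    have "D * r' = q * (r * r' + p * s') - p * (s * r' + q * s')" unfolding D_def by (simp add: algebra_simps)
    then show "D * r' = q" using inv by simp
    have "D * s' = r * (s * r' + q * s') - s * (r * r' + p * s')" unfolding D_def by (simp add: algebra_simps)
    then show "D * s' = - s" using inv by simp
    have "D * p' = q * (r * p' + p * q') - p * (s * p' + q * q')" unfolding D_def by (simp add: algebra_simps)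
    then show "D * p' = - p" using inv by simp
    have "D * q' = r * (s * p' + q * q') - s * (r * p' + p * q')" unfolding D_def by (simp add: algebra_simps)
    then show "D * q' = r" using inv by simp
  qed
  ultimately show ?thesis
  proof cases
    case 1
    then have e: "r' = q" "s' = - s" "p' = - p" "q' = r" using e by auto
    then have p: "p = 0" "p' = 0" using eff eff' by auto
    then have "r * q = 1" using 1 by (simp add: D_def)
    moreover have "r \<ge> 0" using eff p by simp
    ultimately have rq: "r = 1" "q = 1" using zmult_eq_1_iff[of r q] by auto
    have "s \<ge> 0" "s \<le> 0" using eff(4) eff'(4) e p rq by auto
    then show ?thesis using p rq by simp
  next
    \<comment> \<open>Determinant -1: the bounds for the two matrices squeeze \<open>q\<close> and
      \<open>r\<close>, and the extremal rays are exchanged.\<close>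
    case 2
    then have e: "r' = - q" "s' = s" "p' = p" "q' = - r" using e by auto
    have q: "q = - (n * p)" and r: "r = n * p" using eff eff' e by auto
    have "p * (n * n * p + s) = 1" using 2 unfolding D_def q r by (simp add: algebra_simps)
    then have "p = 1" "n * n * p + s = 1" using zmult_eq_1_iff[of p] eff(1) by auto
    then show ?thesis using q r by auto
  qed
qed

text \<open>A lift is equivariant up to an automorphism of the torus, by
  \<open>hirzebruch_lift_scalar\<close> applied to \<open>G\<close> and its translates. The weights
  \<open>(r, s)\<close> and \<open>(p, q)\<close> record how that automorphism pulls back
  \<open>\<mu>\<close> and \<open>\<rho>\<close>; the nonzero values at \<open>x0\<close> make them
  well defined.\<close>

lemma hirzebruch_lift_weights:
  assumes G: "polynomial_map G"
    and lift: "\<And>x. x \<in> plane_pairs \<Longrightarrow> G x \<in> plane_pairs \<and> f (hirzebruch_point n x) = hirzebruch_point n (G x)"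
    and nz: "G x0 $ 1 \<noteq> 0" "G x0 $ 2 \<noteq> 0" "G x0 $ 3 \<noteq> 0" "G x0 $ 4 \<noteq> 0"
  shows "\<exists>r s p q. bihomogeneous n (\<lambda>x. G x $ 1) (r - int n * p) (s - int n * q) \<and>
    bihomogeneous n (\<lambda>x. G x $ 2) r s \<and> bihomogeneous n (\<lambda>x. G x $ 3) p q \<and> bihomogeneous n (\<lambda>x. G x $ 4) p q \<and>
    (\<forall>x. G (hirzebruch_act n 2 1 x) = hirzebruch_act n (2 powi r) (2 powi p) (G x)) \<and>
    (\<forall>x. G (hirzebruch_act n 1 2 x) = hirzebruch_act n (2 powi s) (2 powi q) (G x))"
proof -
  have pG: "polynomial_fun (\<lambda>x. G x $ i)" for i using G by (simp add: polynomial_map_def)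
  have sc: "\<exists>\<mu>' \<rho>'. \<mu>' \<noteq> 0 \<and> \<rho>' \<noteq> 0 \<and> (\<forall>x. G (hirzebruch_act n \<mu> \<rho> x) = hirzebruch_act n \<mu>' \<rho>' (G x))"
    if "\<mu> \<noteq> 0" "\<rho> \<noteq> 0" for \<mu> \<rho>
  proof (rule hirzebruch_lift_scalar[OF G])
    show "polynomial_map (\<lambda>x. G (hirzebruch_act n \<mu> \<rho> x))" by (rule polynomial_map_comp[OF G polynomial_map_act])
    fix x assume x: "x \<in> plane_pairs"
    have "hirzebruch_act n \<mu> \<rho> x \<in> plane_pairs" using plane_pairs_act[OF that] x by blast
    moreover have "hirzebruch_point n x = hirzebruch_point n (hirzebruch_act n \<mu> \<rho> x)"
      unfolding hirzebruch_point_eq_iff_act using that by blast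
    ultimately show "G x \<in> plane_pairs \<and> G (hirzebruch_act n \<mu> \<rho> x) \<in> plane_pairs \<and>
        hirzebruch_point n (G x) = hirzebruch_point n (G (hirzebruch_act n \<mu> \<rho> x))"
      using lift[OF x] lift[of "hirzebruch_act n \<mu> \<rho> x"] by simp
  qed
  obtain m1 r1 where 1: "m1 \<noteq> 0" "r1 \<noteq> 0" "\<And>x. G (hirzebruch_act n 2 1 x) = hirzebruch_act n m1 r1 (G x)"
    using sc[of 2 1] by auto
  obtain m2 r2 where 2: "m2 \<noteq> 0" "r2 \<noteq> 0" "\<And>x. G (hirzebruch_act n 1 2 x) = hirzebruch_act n m2 r2 (G x)"
    using sc[of 1 2] by auto
  obtain r s where rs: "bihomogeneous n (\<lambda>x. G x $ 2) r s" "m1 = 2 powi r" "m2 = 2 powi s"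
    using bihomogeneous_of_semi_invariant[OF pG nz(2), of n m1 m2] 1(3) 2(3) by auto
  obtain p q where pq: "bihomogeneous n (\<lambda>x. G x $ 3) p q" "r1 = 2 powi p" "r2 = 2 powi q"
    using bihomogeneous_of_semi_invariant[OF pG nz(3), of n r1 r2] 1(3) 2(3) by auto
  obtain p4 q4 where 4: "bihomogeneous n (\<lambda>x. G x $ 4) p4 q4" "r1 = 2 powi p4" "r2 = 2 powi q4"
    using bihomogeneous_of_semi_invariant[OF pG nz(4), of n r1 r2] 1(3) 2(3) by auto
  obtain u v where uv: "bihomogeneous n (\<lambda>x. G x $ 1) u v" "m1 / r1 ^ n = 2 powi u" "m2 / r2 ^ n = 2 powi v"
    using bihomogeneous_of_semi_invariant[OF pG nz(1), of n "m1 / r1 ^ n" "m2 / r2 ^ n"] 1(3) 2(3) by auto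
  have pw: "2 powi a / (2 powi b) ^ n = (2 :: complex) powi (a - int n * b)" for a b
    using power_int_mult[of "2 :: complex" b "int n"] by (simp add: power_int_diff mult.commute)
  have "u = r - int n * p" "v = s - int n * q"
    using uv(2,3) unfolding rs(2,3) pq(2,3) pw two_powi_inject by auto
  moreover have "p4 = p" "q4 = q" using 4 pq two_powi_inject by auto
  ultimately show ?thesis using rs pq 4 uv 1(3) 2(3) by blast
qed

text \<open>By \<open>weight_matrix_cases\<close> an automorphism preserves the weights of the
  coordinates or exchanges the extremal rays. The exchange is possible only for
  \<open>n = 0\<close>, where it swaps the two rulings; for positive \<open>n\<close> both base
  components would vanish on the negative section. If the weights are preserved, the second
  component has the largest degree bound, \<open>n + 1\<close>.\<close>

lemma Aut_lift_hirzebruch: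
  assumes "inverse_morphisms (hirzebruch n) f g"
  shows "\<exists>G. (\<forall>i. poly_deg_le (n + 1) (\<lambda>x. G x $ i)) \<and>
    (\<forall>x\<in>plane_pairs. G x \<in> plane_pairs \<and> f (hirzebruch_point n x) = hirzebruch_point n (G x))"
proof -
  have f: "(points (hirzebruch n), f) \<in> partial_morphisms (hirzebruch n) (hirzebruch n)"
    and g: "(points (hirzebruch n), g) \<in> partial_morphisms (hirzebruch n) (hirzebruch n)"
    and gf: "\<And>x. x \<in> plane_pairs \<Longrightarrow> g (f (hirzebruch_point n x)) = hirzebruch_point n x"
    and fg: "\<And>x. x \<in> plane_pairs \<Longrightarrow> f (g (hirzebruch_point n x)) = hirzebruch_point n x"
    using assms by (auto simp: inverse_morphisms_def points_hirzebruch)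
  obtain G where G: "polynomial_map G" "\<And>x. x \<in> plane_pairs \<Longrightarrow> G x \<in> plane_pairs \<and> f (hirzebruch_point n x) = hirzebruch_point n (G x)"
    using global_lift_hirzebruch[OF f] by blast
  obtain H where H: "polynomial_map H" "\<And>x. x \<in> plane_pairs \<Longrightarrow> H x \<in> plane_pairs \<and> g (hirzebruch_point n x) = hirzebruch_point n (H x)"
    using global_lift_hirzebruch[OF g] by blast
  have id: "polynomial_map (\<lambda>x :: complex^4. x)" by (simp add: polynomial_map_def polynomial_fun.coord)
  have HG: "\<exists>\<mu> \<rho>. \<mu> \<noteq> 0 \<and> \<rho> \<noteq> 0 \<and> (\<forall>x. H (G x) = hirzebruch_act n \<mu> \<rho> x)"
    by (rule hirzebruch_lift_scalar[OF id polynomial_map_comp[OF H(1) G(1)]]) (use G(2) H(2) gf in metis)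
  then obtain \<mu> \<rho> where \<mu>: "\<mu> \<noteq> 0" "\<rho> \<noteq> 0" "\<And>x. H (G x) = hirzebruch_act n \<mu> \<rho> x" by blast
  have GH: "\<exists>\<mu> \<rho>. \<mu> \<noteq> 0 \<and> \<rho> \<noteq> 0 \<and> (\<forall>x. G (H x) = hirzebruch_act n \<mu> \<rho> x)"
    by (rule hirzebruch_lift_scalar[OF id polynomial_map_comp[OF G(1) H(1)]]) (use G(2) H(2) fg in metis)
  then obtain \<mu>' \<rho>' where \<mu>': "\<mu>' \<noteq> 0" "\<rho>' \<noteq> 0" "\<And>x. G (H x) = hirzebruch_act n \<mu>' \<rho>' x" by blast
  \<comment> \<open>\<open>G (H 1)\<close> is a torus translate of \<open>1\<close>, so all its
    coordinates are nonzero.\<close>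
  obtain r s p q where w: "bihomogeneous n (\<lambda>x. G x $ 1) (r - int n * p) (s - int n * q)"
    "bihomogeneous n (\<lambda>x. G x $ 2) r s" "bihomogeneous n (\<lambda>x. G x $ 3) p q" "bihomogeneous n (\<lambda>x. G x $ 4) p q"
    "\<And>x. G (hirzebruch_act n 2 1 x) = hirzebruch_act n (2 powi r) (2 powi p) (G x)"
    "\<And>x. G (hirzebruch_act n 1 2 x) = hirzebruch_act n (2 powi s) (2 powi q) (G x)"
    using hirzebruch_lift_weights[OF G, of "H 1"] \<mu>' by auto
  obtain r' s' p' q' where w': "bihomogeneous n (\<lambda>x. H x $ 1) (r' - int n * p') (s' - int n * q')"
    "bihomogeneous n (\<lambda>x. H x $ 2) r' s'" "bihomogeneous n (\<lambda>x. H x $ 3) p' q'" "bihomogeneous n (\<lambda>x. H x $ 4) p' q'"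
    using hirzebruch_lift_weights[OF H, of "G 1"] \<mu> by auto
  \<comment> \<open>\<open>H (G x)\<close> is computed twice: here by the weights of
    \<open>G\<close> and \<open>H\<close>, below as the torus translate \<open>\<mu>(3)\<close>. The
    comparison shows that the two weight matrices are inverse.\<close>
  have e1: "H (G (hirzebruch_act n 2 1 1)) $ i = 2 powi (r * u + p * v) * H (G 1) $ i"
    if "bihomogeneous n (\<lambda>x. H x $ i) u v" for i u v
    using bihomogeneous_act[OF that, of "2 powi r" "2 powi p" "G 1"]
    by (simp add: w(5) power_int_add power_int_mult)
  have e2: "H (G (hirzebruch_act n 1 2 1)) $ i = 2 powi (s * u + q * v) * H (G 1) $ i"
    if "bihomogeneous n (\<lambda>x. H x $ i) u v" for i u v
    using bihomogeneous_act[OF that, of "2 powi s" "2 powi q" "G 1"]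
    by (simp add: w(6) power_int_add power_int_mult)
  have "(2 :: complex) powi (r * r' + p * s') = 2 powi 1" "(2 :: complex) powi (s * r' + q * s') = 2 powi 0"
    "(2 :: complex) powi (r * p' + p * q') = 2 powi 0" "(2 :: complex) powi (s * p' + q * q') = 2 powi 1"
    using e1[OF w'(2)] e2[OF w'(2)] e1[OF w'(3)] e2[OF w'(3)] \<mu>(1,2) by (simp_all add: \<mu>(3))
  then have inv: "r * r' + p * s' = 1" "s * r' + q * s' = 0" "r * p' + p * q' = 0" "s * p' + q * q' = 1"
    unfolding two_powi_inject by auto
  have cases: "p = 0 \<and> q = 1 \<and> r = 1 \<and> s = 0 \<or> p = 1 \<and> q = - int n \<and> r = int n \<and> s = 1 - int n * int n"
    by (rule weight_matrix_cases[OF inv])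
      (use bihomogeneous_bounds[OF w(1)] bihomogeneous_bounds[OF w(3)]
        bihomogeneous_bounds[OF w'(1)] bihomogeneous_bounds[OF w'(3)] in auto)
  have "\<forall>i. poly_deg_le (n + 1) (\<lambda>x. G x $ i)"
    using cases
  proof
    assume *: "p = 0 \<and> q = 1 \<and> r = 1 \<and> s = 0"
    then show ?thesis unfolding forall_4
      using w(1-4)[THEN bihomogeneous_poly_deg_le, of "n + 1"] by simp
  next
    assume *: "p = 1 \<and> q = - int n \<and> r = int n \<and> s = 1 - int n * int n"
    have "n = 0"
    proof (rule ccontr)
      assume "n \<noteq> 0"
      let ?x = "vector [0, 1, 0, 1] :: complex^4"
      have "?x \<in> plane_pairs" by (simp add: plane_pairs_def vector_4)
      moreover have "G ?x $ 3 = 0" "G ?x $ 4 = 0"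
        using bihomogeneous_vanish[of n "\<lambda>x. G x $ 3" ?x] bihomogeneous_vanish[of n "\<lambda>x. G x $ 4" ?x] w(3,4) * \<open>n \<noteq> 0\<close>
        by (auto simp: vector_4)
      ultimately show False using G(2)[of ?x] by (simp add: plane_pairs_def)
    qed
    then show ?thesis unfolding forall_4
      using w(1-4)[THEN bihomogeneous_poly_deg_le, of "n + 1"] * by simp
  qed
  then show ?thesis using G(2) by blast
qed

section \<open>Fixed points of the iterates on a line\<close>

text \<open>A zero vector is parallel to every vector, so base points count as fixed points and the
  condition is closed.\<close>

definition parallel :: "complex^'n \<Rightarrow> complex^'n \<Rightarrow> bool" where
  "parallel x y \<longleftrightarrow> (\<forall>i j. x $ i * y $ j = x $ j * y $ i)"

lemma proj_point_parallel: "x \<noteq> 0 \<Longrightarrow> y \<noteq> 0 \<Longrightarrow> proj_point x = proj_point y \<longleftrightarrow> parallel x y"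
  for x y :: "complex^'n"
  using proj_point_eq_iff_minors by (simp add: parallel_def)

lemma parallel_scale: "t \<noteq> 0 \<Longrightarrow> parallel (t *s x) y \<longleftrightarrow> parallel x y" "t \<noteq> 0 \<Longrightarrow> parallel x (t *s y) \<longleftrightarrow> parallel x y"
  by (simp_all add: parallel_def mult.left_commute[of _ t])

definition quadratic_iterate :: "complex^(3 \<times> 3 \<times> 3) \<Rightarrow> nat \<Rightarrow> complex^3 \<Rightarrow> complex^3" where
  "quadratic_iterate c n = quadratic_forms c ^^ n"

lemma quadratic_forms_scale: "quadratic_forms c (t *s x) = t ^ 2 *s quadratic_forms c x"
  by (simp add: quadratic_forms_def vec_eq_iff sum_distrib_left power2_eq_square ac_simps)

lemma quadratic_forms_scale_coeffs: "quadratic_forms (t *s c) x = t *s quadratic_forms c x"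
  by (simp add: quadratic_forms_def vec_eq_iff sum_distrib_left ac_simps)

lemma polynomial_map_quadratic_forms: "polynomial_map (quadratic_forms c)"
  unfolding polynomial_map_def quadratic_forms_def by (auto intro!: polynomial_fun_intros)

lemma quadratic_iterate_0 [simp]: "quadratic_iterate c 0 x = x"
  by (simp add: quadratic_iterate_def)

lemma quadratic_iterate_Suc: "quadratic_iterate c (Suc n) x = quadratic_forms c (quadratic_iterate c n x)"
  by (simp add: quadratic_iterate_def)

lemma quadratic_iterate_Suc': "quadratic_iterate c (Suc n) x = quadratic_iterate c n (quadratic_forms c x)"
  by (simp add: quadratic_iterate_def funpow_swap1)

lemma quadratic_iterate_scale: "quadratic_iterate c n (t *s x) = t ^ (2 ^ n) *s quadratic_iterate c n x"
  by (induction n) (simp_all add: quadratic_iterate_Suc quadratic_forms_scale power_mult[symmetric] mult.commute)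

lemma polynomial_map_quadratic_iterate: "polynomial_map (quadratic_iterate c n)"
proof (induction n)
  case 0
  then show ?case by (simp add: polynomial_map_def polynomial_fun.coord)
next
  case (Suc n)
  then show ?case unfolding quadratic_iterate_Suc[abs_def]
    by (rule polynomial_map_comp[OF polynomial_map_quadratic_forms])
qed

text \<open>The iterates restricted to the line \<open>x + y = \<kappa> z\<close>, parametrized by \<open>(1, \<kappa> s - 1, s)\<close>;
  the point missed by the parametrization is \<open>(0, \<kappa>, 1)\<close>.\<close>

fun line_iterate :: "complex^(3 \<times> 3 \<times> 3) \<Rightarrow> complex \<Rightarrow> nat \<Rightarrow> 3 \<Rightarrow> complex poly" where
  "line_iterate c \<kappa> 0 i = (if i = 1 then 1 else if i = 2 then [:-1, \<kappa>:] else [:0, 1:])"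
| "line_iterate c \<kappa> (Suc n) i =
     (\<Sum>j\<in>UNIV. \<Sum>k\<in>UNIV. smult (c $ (i, j, k)) (line_iterate c \<kappa> n j * line_iterate c \<kappa> n k))"

lemma poly_line_iterate:
  "poly (line_iterate c \<kappa> n i) s = quadratic_iterate c n (vector [1, \<kappa> * s - 1, s]) $ i"
proof (induction n arbitrary: i)
  case 0
  have "i = 1 \<or> i = 2 \<or> i = 3" by (rule exhaust_3)
  then show ?case by (auto simp: mult.commute)
next
  case (Suc n)
  then show ?case by (simp add: quadratic_iterate_Suc quadratic_forms_def poly_sum mult.assoc)
qed

lemma degree_line_iterate: "degree (line_iterate c \<kappa> n i) \<le> 2 ^ n"
proof (induction n arbitrary: i)
  case (Suc n)
  have "degree (line_iterate c \<kappa> n j * line_iterate c \<kappa> n k) \<le> 2 ^ Suc n" for j k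
    using degree_mult_le[of "line_iterate c \<kappa> n j" "line_iterate c \<kappa> n k"] Suc[of j] Suc[of k] by simp
  then show ?case
    by (auto intro!: degree_sum_le order_trans[OF degree_smult_le])
qed auto

lemma coeff_mult_top:
  fixes p q :: "'a::comm_semiring_0 poly"
  assumes "degree p \<le> a" "degree q \<le> b"
  shows "coeff (p * q) (a + b) = coeff p a * coeff q b"
proof -
  have "coeff p i * coeff q (a + b - i) = 0" if "i \<in> {..a + b} - {a}" for i
  proof (cases "i < a")
    case True
    then have "coeff q (a + b - i) = 0" using assms(2) by (intro coeff_eq_0) auto
    then show ?thesis by simp
  next
    case False
    then have "coeff p i = 0" using that assms(1) by (intro coeff_eq_0) auto
    then show ?thesis by simp
  qed
  then have "(\<Sum>i\<le>a + b. coeff p i * coeff q (a + b - i)) = coeff p a * coeff q (a + b - a) + 0"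
    by (subst sum.remove[of _ a]) (auto intro!: sum.neutral)
  then show ?thesis by (simp add: coeff_mult)
qed

text \<open>Homogenized, the parametrization is \<open>(t, \<kappa> s - t, s)\<close>. The
  coefficient of the highest possible power of \<open>s\<close> is the value at
  \<open>t = 0\<close>, \<open>s = 1\<close>, that is, at the missed point.\<close>

lemma coeff_line_iterate: "coeff (line_iterate c \<kappa> n i) (2 ^ n) = quadratic_iterate c n (vector [0, \<kappa>, 1]) $ i"
proof (induction n arbitrary: i)
  case 0
  have "i = 1 \<or> i = 2 \<or> i = 3" by (rule exhaust_3)
  then show ?case by auto
next
  case (Suc n)
  have "coeff (line_iterate c \<kappa> n j * line_iterate c \<kappa> n k) (2 ^ Suc n) =
     coeff (line_iterate c \<kappa> n j) (2 ^ n) * coeff (line_iterate c \<kappa> n k) (2 ^ n)" for j k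
    using coeff_mult_top[OF degree_line_iterate[of c \<kappa> n j] degree_line_iterate[of c \<kappa> n k]] by (simp add: mult_2)
  then show ?case using Suc by (simp add: quadratic_iterate_Suc quadratic_forms_def coeff_sum mult.assoc)
qed

text \<open>The exponent is the degree in the coefficients: it starts with 0, and one step doubles
  it and adds 1.\<close>

lemma line_iterate_scale:
  "line_iterate (t *s c) \<kappa> n i = smult (t ^ (2 ^ n - 1)) (line_iterate c \<kappa> n i)"
proof (induction n arbitrary: i)
  case (Suc n)
  obtain m where m: "(2 :: nat) ^ n = Suc m" using not0_implies_Suc[of "2 ^ n"] by auto
  define u where "u = t ^ (2 ^ n - 1)"
  have v: "t ^ (2 ^ Suc n - 1) = t * (u * u)" by (simp add: u_def m power_add mult_2)
  have IH: "line_iterate (t *s c) \<kappa> n j = smult u (line_iterate c \<kappa> n j)" for j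
    using Suc by (simp add: u_def)
  have sum: "smult a (\<Sum>i\<in>UNIV. f i) = (\<Sum>i\<in>UNIV. smult a (f i))" for a and f :: "3 \<Rightarrow> complex poly"
    by (simp add: sum_3 smult_add_right)
  show ?case unfolding line_iterate.simps v sum
    by (intro sum.cong refl) (simp add: IH ac_simps)
qed simp

section \<open>Sylvester resultants\<close>

text \<open>Rows are the multiples of \<open>A\<close> by \<open>1, ..., x^N\<close> and of
  \<open>B\<close> by \<open>1, ..., x^(N-1)\<close>: the Sylvester matrix for formal degrees
  \<open>N\<close> and \<open>N + 1\<close>. The actual degrees may drop, so the entries stay
  polynomial in all parameters, and a drop of both degrees counts as a common root at
  infinity.\<close>

definition sylvester :: "nat \<Rightarrow> complex poly \<Rightarrow> complex poly \<Rightarrow> complex mat" where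
  "sylvester N A B = mat (2 * N + 1) (2 * N + 1)
     (\<lambda>(i, l). if i \<le> N then coeff (monom 1 i * A) l else coeff (monom 1 (i - (N + 1)) * B) l)"

lemma sylvester_carrier: "sylvester N A B \<in> carrier_mat (2 * N + 1) (2 * N + 1)"
  by (simp add: sylvester_def)

lemma sylvester_kernel:
  assumes "\<And>i. i \<le> N \<Longrightarrow> (\<Sum>l = 0..<2 * N + 1. coeff (monom 1 i * A) l * v l) = 0"
    "\<And>j. j < N \<Longrightarrow> (\<Sum>l = 0..<2 * N + 1. coeff (monom 1 j * B) l * v l) = 0"
    "m < 2 * N + 1" "v m \<noteq> 0"
  shows "Determinant.det (sylvester N A B) = 0"
proof -
  let ?v = "Matrix.vec (2 * N + 1) v"
  have "sylvester N A B *\<^sub>v ?v = 0\<^sub>v (2 * N + 1)"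
  proof (rule eq_vecI)
    fix i assume "i < dim_vec (0\<^sub>v (2 * N + 1) :: complex Matrix.vec)"
    then have i: "i < 2 * N + 1" by simp
    show "vec_index (sylvester N A B *\<^sub>v ?v) i = vec_index (0\<^sub>v (2 * N + 1)) i"
    proof (cases "i \<le> N")
      case True
      then show ?thesis using assms(1)[OF True] i by (simp add: sylvester_def scalar_prod_def)
    next
      case False
      then have "i - Suc N < N" using i by auto
      then show ?thesis using assms(2)[of "i - Suc N"] i False by (simp add: sylvester_def scalar_prod_def)
    qed
  qed (simp add: sylvester_def)
  moreover have "?v \<noteq> 0\<^sub>v (2 * N + 1)"
  proof
    assume "?v = 0\<^sub>v (2 * N + 1)"
    then have "vec_index ?v m = vec_index (0\<^sub>v (2 * N + 1)) m" by simp
    then show False using assms(3,4) by simp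
  qed
  moreover have "?v \<in> carrier_vec (2 * N + 1)" by simp
  ultimately show ?thesis using det_0_iff_vec_prod_zero_field[OF sylvester_carrier] by blast
qed

lemma poly_as_sum:
  fixes p :: "complex poly"
  assumes "degree p < n"
  shows "poly p s = (\<Sum>i = 0..<n. coeff p i * s ^ i)"
proof -
  have "(\<Sum>i\<le>degree p. coeff p i * s ^ i) = (\<Sum>i = 0..<n. coeff p i * s ^ i)"
    using assms by (intro sum.mono_neutral_left) (auto simp: coeff_eq_0)
  then show ?thesis by (simp add: poly_altdef)
qed

lemma degree_monom_mult_le: "degree p \<le> d \<Longrightarrow> degree (monom (1 :: complex) i * p) \<le> i + d"
  using degree_mult_le[of "monom 1 i" p] degree_monom_le[of "1 :: complex" i] by linarith

text \<open>The vector of powers of \<open>s\<close> lies in the kernel, since multiplying a row by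
  it evaluates that row at \<open>s\<close>.\<close>

lemma sylvester_common_root:
  assumes "degree A \<le> N" "degree B \<le> N + 1" "poly A s = 0" "poly B s = 0"
  shows "Determinant.det (sylvester N A B) = 0"
proof (rule sylvester_kernel[where v = "\<lambda>l. s ^ l" and m = 0])
  fix i assume "i \<le> N"
  then have "degree (monom 1 i * A) < 2 * N + 1" using degree_monom_mult_le[OF assms(1), of i] by linarith
  from poly_as_sum[OF this, of s] show "(\<Sum>l = 0..<2 * N + 1. coeff (monom 1 i * A) l * s ^ l) = 0"
    using assms(3) by simp
next
  fix i assume "i < N"
  then have "degree (monom 1 i * B) < 2 * N + 1" using degree_monom_mult_le[OF assms(2), of i] by linarith
  from poly_as_sum[OF this, of s] show "(\<Sum>l = 0..<2 * N + 1. coeff (monom 1 i * B) l * s ^ l) = 0"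
    using assms(4) by simp
qed simp_all

text \<open>The last column holds only formal leading coefficients and zeros, so it
  vanishes.\<close>

lemma sylvester_common_root_infinity:
  assumes "degree A \<le> N" "degree B \<le> N + 1" "coeff A N = 0" "coeff B (N + 1) = 0"
  shows "Determinant.det (sylvester N A B) = 0"
proof (rule sylvester_kernel[where v = "\<lambda>l. if l = 2 * N then 1 else 0" and m = "2 * N"])
  fix i assume i: "i \<le> N"
  have "coeff A (2 * N - i) = 0"
    using assms(1,3) i coeff_eq_0[of A "2 * N - i"] by (cases "i = N") auto
  then show "(\<Sum>l = 0..<2 * N + 1. coeff (monom 1 i * A) l * (if l = 2 * N then 1 else 0)) = 0"
    using i by (simp add: coeff_monom_mult)
next
  fix i assume i: "i < N"
  have "coeff B (2 * N - i) = 0"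
    using assms(2,4) i coeff_eq_0[of B "2 * N - i"] by (cases "i = N - 1") auto
  then show "(\<Sum>l = 0..<2 * N + 1. coeff (monom 1 i * B) l * (if l = 2 * N then 1 else 0)) = 0"
    using i by (simp add: coeff_monom_mult)
qed simp_all

lemma coprime_of_no_common_root:
  fixes A B :: "complex poly"
  assumes "A \<noteq> 0" "\<And>s. poly A s = 0 \<Longrightarrow> poly B s \<noteq> 0"
  shows "coprime A B"
proof (rule coprimeI)
  fix d assume d: "d dvd A" "d dvd B"
  show "is_unit d"
  proof (rule ccontr)
    assume "\<not> is_unit d"
    moreover have "d \<noteq> 0" using d assms(1) by auto
    ultimately have "degree d \<noteq> 0" by (simp add: is_unit_iff_degree)
    then have "\<not> constant (poly d)" by (simp add: constant_degree)
    then obtain s where "poly d s = 0" using fundamental_theorem_of_algebra by blast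
    then have "poly A s = 0" "poly B s = 0" using d by (auto elim!: dvdE)
    then show False using assms(2) by blast
  qed
qed

text \<open>A vector in the left kernel gives \<open>U * A + V * B = 0\<close> with
  \<open>degree V < N\<close> or \<open>V = 0\<close>. As \<open>A\<close> is coprime to
  \<open>B\<close> it divides \<open>V\<close>, and its degree is exactly \<open>N\<close>, so
  \<open>V\<close> and then \<open>U\<close> vanish.\<close>

lemma sylvester_nonzero:
  assumes A: "degree A = N" "A \<noteq> 0" and B: "degree B \<le> N + 1"
    and root: "\<And>s. poly A s = 0 \<Longrightarrow> poly B s \<noteq> 0"
  shows "Determinant.det (sylvester N A B) \<noteq> 0"
proof
  assume "Determinant.det (sylvester N A B) = 0"
  then have "Determinant.det (transpose_mat (sylvester N A B)) = 0"
    using det_transpose[OF sylvester_carrier] by simp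
  moreover have "transpose_mat (sylvester N A B) \<in> carrier_mat (2 * N + 1) (2 * N + 1)"
    using sylvester_carrier by simp
  ultimately obtain v where v: "v \<in> carrier_vec (2 * N + 1)" "v \<noteq> 0\<^sub>v (2 * N + 1)"
    "transpose_mat (sylvester N A B) *\<^sub>v v = 0\<^sub>v (2 * N + 1)"
    using det_0_iff_vec_prod_zero_field by blast
  define w where "w = vec_index v"
  define U where "U = (\<Sum>i\<in>{0..<N + 1}. monom (w i) i)"
  define V where "V = (\<Sum>j\<in>{0..<N}. monom (w (N + 1 + j)) j)"
  have dU: "degree U \<le> N" unfolding U_def by (intro degree_sum_le) (auto intro: order_trans[OF degree_monom_le])
  have dV: "V \<noteq> 0 \<Longrightarrow> degree V < N"
  proof -
    assume "V \<noteq> 0"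
    then have "N \<noteq> 0" by (intro notI) (simp add: V_def)
    moreover have "degree V \<le> N - 1" unfolding V_def
      by (intro degree_sum_le) (auto intro: order_trans[OF degree_monom_le])
    ultimately show ?thesis by linarith
  qed
  have m: "monom a i * p = smult a (monom 1 i * p)" for a i and p :: "complex poly"
    by (metis mult.right_neutral mult_smult_left smult_monom)
  have "coeff (U * A + V * B) l = 0" for l
  proof (cases "l < 2 * N + 1")
    case l: True
    have "vec_index (transpose_mat (sylvester N A B) *\<^sub>v v) l = 0" using v(3) l by simp
    then have "(\<Sum>i = 0..<2 * N + 1. (if i \<le> N then coeff (monom 1 i * A) l else coeff (monom 1 (i - (N + 1)) * B) l) * w i) = 0"
      using l v(1) by (simp add: sylvester_def scalar_prod_def w_def)
    moreover have "(\<Sum>i = 0..<2 * N + 1. h i) = (\<Sum>i = 0..<N + 1. h i) + (\<Sum>i = N + 1..<2 * N + 1. h i)"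
      for h :: "nat \<Rightarrow> complex"
      by (rule sum.atLeastLessThan_concat[symmetric]) auto
    moreover have "(\<Sum>i = 0..<N + 1. (if i \<le> N then coeff (monom 1 i * A) l else coeff (monom 1 (i - (N + 1)) * B) l) * w i) =
        (\<Sum>i = 0..<N + 1. coeff (monom 1 i * A) l * w i)"
      by (intro sum.cong refl) auto
    moreover have "(\<Sum>i = N + 1..<2 * N + 1. (if i \<le> N then coeff (monom 1 i * A) l else coeff (monom 1 (i - (N + 1)) * B) l) * w i) =
        (\<Sum>i = N + 1..<2 * N + 1. coeff (monom 1 (i - (N + 1)) * B) l * w i)"
      by (intro sum.cong refl) auto
    ultimately have "(\<Sum>i = 0..<N + 1. coeff (monom 1 i * A) l * w i) +
        (\<Sum>i = N + 1..<2 * N + 1. coeff (monom 1 (i - (N + 1)) * B) l * w i) = 0"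
      by (simp only:)
    moreover have "(\<Sum>i = N + 1..<2 * N + 1. coeff (monom 1 (i - (N + 1)) * B) l * w i) =
        (\<Sum>j = 0..<N. coeff (monom 1 j * B) l * w (N + 1 + j))"
      by (rule sum.reindex_bij_witness[of _ "\<lambda>j. N + 1 + j" "\<lambda>i. i - (N + 1)"]) auto
    moreover have "coeff (U * A) l = (\<Sum>i = 0..<N + 1. coeff (monom 1 i * A) l * w i)"
      unfolding U_def sum_distrib_right coeff_sum by (intro sum.cong refl) (subst m, simp)
    moreover have "coeff (V * B) l = (\<Sum>j = 0..<N. coeff (monom 1 j * B) l * w (N + 1 + j))"
      unfolding V_def sum_distrib_right coeff_sum by (intro sum.cong refl) (subst m, simp)
    ultimately show ?thesis by (simp only: coeff_add)
  next
    case False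
    have "degree (U * A) \<le> 2 * N" using degree_mult_le[of U A] dU A(1) by linarith
    moreover have "degree (V * B) \<le> 2 * N"
    proof (cases "V = 0")
      case False
      then show ?thesis using degree_mult_le[of V B] dV B by linarith
    qed simp
    ultimately show ?thesis using False by (simp add: coeff_eq_0)
  qed
  then have 0: "U * A + V * B = 0" by (simp add: poly_eq_iff)
  then have "A dvd V * B" by (metis add_eq_0_iff dvd_minus_iff dvd_triv_right)
  then have "A dvd V" using coprime_of_no_common_root[OF A(2) root] coprime_dvd_mult_left_iff by blast
  then have V0: "V = 0" using dV A(1) dvd_imp_degree_le by (metis leD)
  then have U0: "U = 0" using 0 A(2) by simp
  have "vec_index v i = 0" if "i < 2 * N + 1" for i
  proof (cases "i < N + 1")
    case True
    have "coeff U i = w i" unfolding U_def using True by (simp add: coeff_sum del: sum.op_ivl_Suc)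
    then show ?thesis using U0 by (simp add: w_def)
  next
    case False
    have "coeff V (i - (N + 1)) = w i" unfolding V_def using False that by (simp add: coeff_sum)
    then show ?thesis using V0 by (simp add: w_def)
  qed
  then have "v = 0\<^sub>v (2 * N + 1)" using v(1) by (intro eq_vecI) auto
  then show False using v(2) by simp
qed

lemma polynomial_fun_det_sylvester:
  assumes "\<And>l. polynomial_fun (\<lambda>x. coeff (A x) l)" "\<And>l. polynomial_fun (\<lambda>x. coeff (B x) l)"
  shows "polynomial_fun (\<lambda>x. Determinant.det (sylvester N (A x) (B x)))"
proof -
  have "polynomial_fun (\<lambda>x. index_mat (sylvester N (A x) (B x)) (i, l))" if "i < 2 * N + 1" "l < 2 * N + 1" for i l
  proof (cases "i \<le> N")
    case True
    then show ?thesis using that assms(1)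
      by (cases "l < i") (simp_all add: sylvester_def coeff_monom_mult polynomial_fun.const)
  next
    case False
    then show ?thesis using that assms(2)
      by (cases "l < i - (N + 1)") (simp_all add: sylvester_def coeff_monom_mult polynomial_fun.const)
  qed
  moreover have "p i < 2 * N + 1" if "p permutes {0..<2 * N + 1}" "i \<in> {0..<2 * N + 1}" for p i
    using permutes_in_image[OF that(1), of i] that(2) by simp
  ultimately show ?thesis
    unfolding det_def'[OF sylvester_carrier]
    by (intro polynomial_fun_sum polynomial_fun.mult polynomial_fun.const polynomial_fun_prod) auto
qed

lemma sylvester_smult:
  "sylvester N (smult t A) (smult t B) = t \<cdot>\<^sub>m sylvester N A B"
  by (rule eq_matI) (auto simp: sylvester_def)

text \<open>On the line \<open>x + y = \<kappa> z\<close>, a vector \<open>F\<close> is proportional to \<open>(x, y, z)\<close> iff it lies on the line,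
  \<open>F\<^sub>1 + F\<^sub>2 = \<kappa> F\<^sub>3\<close>, and \<open>z F\<^sub>1 = x F\<^sub>3\<close>.\<close>

definition fixed_resultant :: "complex^(3 \<times> 3 \<times> 3) \<Rightarrow> nat \<Rightarrow> complex \<Rightarrow> complex" where
  "fixed_resultant c n \<kappa> = Determinant.det (sylvester (2 ^ n)
     (line_iterate c \<kappa> n 1 + line_iterate c \<kappa> n 2 - smult \<kappa> (line_iterate c \<kappa> n 3))
     ([:0, 1:] * line_iterate c \<kappa> n 1 - line_iterate c \<kappa> n 3))"

lemma fixed_resultant_scale: "t \<noteq> 0 \<Longrightarrow> fixed_resultant (t *s c) n \<kappa> = 0 \<longleftrightarrow> fixed_resultant c n \<kappa> = 0"
proof -
  assume t: "t \<noteq> 0"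
  let ?t = "t ^ (2 ^ n - 1)"
  let ?L = "line_iterate c \<kappa> n"
  have "smult ?t (?L 1) + smult ?t (?L 2) - smult \<kappa> (smult ?t (?L 3)) =
      smult ?t (?L 1 + ?L 2 - smult \<kappa> (?L 3))"
    "[:0, 1:] * smult ?t (?L 1) - smult ?t (?L 3) = smult ?t ([:0, 1:] * ?L 1 - ?L 3)"
    by (simp_all add: smult_add_right smult_diff_right mult.commute)
  then show ?thesis using t by (simp add: fixed_resultant_def line_iterate_scale sylvester_smult)
qed

lemma polynomial_fun_line_iterate:
  assumes "\<And>t. polynomial_fun (\<lambda>x. cc x $ t)" "polynomial_fun k"
  shows "polynomial_fun (\<lambda>x. coeff (line_iterate (cc x) (k x) n i) l)"
proof (induction n arbitrary: i l)
  case 0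
  have "coeff [:-1, k x:] l = (if l = 0 then -1 else if l = 1 then k x else 0)" for x
    by (simp add: coeff_pCons split: nat.splits)
  then have "polynomial_fun (\<lambda>x. coeff [:-1, k x:] l)"
    using assms(2) by (cases "l = 0"; cases "l = 1") (simp_all add: polynomial_fun.const)
  then show ?case by (cases "i = 1"; cases "i = 2") (simp_all add: polynomial_fun.const)
next
  case (Suc n)
  then show ?case by (simp add: coeff_sum coeff_mult)
    (intro polynomial_fun_sum polynomial_fun.mult assms(1))
qed

lemma polynomial_fun_fixed_resultant:
  assumes "\<And>t. polynomial_fun (\<lambda>x. cc x $ t)" "polynomial_fun k"
  shows "polynomial_fun (\<lambda>x. fixed_resultant (cc x) n (k x))"
  unfolding fixed_resultant_def
proof (rule polynomial_fun_det_sylvester)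
  note L = polynomial_fun_line_iterate[of cc k, OF assms]
  fix l
  show "polynomial_fun (\<lambda>x. coeff (line_iterate (cc x) (k x) n 1 + line_iterate (cc x) (k x) n 2 -
      smult (k x) (line_iterate (cc x) (k x) n 3)) l)"
    by (simp only: coeff_add coeff_diff coeff_smult) (intro polynomial_fun.intros polynomial_fun_diff L assms(2))
  show "polynomial_fun (\<lambda>x. coeff ([:0, 1:] * line_iterate (cc x) (k x) n 1 - line_iterate (cc x) (k x) n 3) l)"
  proof (cases l)
    case 0
    then show ?thesis using polynomial_fun_uminus[OF L[of n 3 0]] by simp
  next
    case (Suc m)
    then show ?thesis using polynomial_fun_diff[OF L[of n 1 m] L[of n 3 "Suc m"]] by (simp add: coeff_pCons)
  qed
qed

text \<open>A fixed point would be a common root of the two polynomials: at the parameter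
  \<open>x $ 3 / x $ 1\<close> if \<open>x $ 1\<close> is nonzero, and at infinity
  otherwise.\<close>

lemma fixed_resultant_no_fixed_point:
  assumes R: "fixed_resultant c n \<kappa> \<noteq> 0" and x: "x \<noteq> 0" "x $ 1 + x $ 2 = \<kappa> * x $ 3"
  shows "\<not> parallel x (quadratic_iterate c n x)"
proof
  assume par: "parallel x (quadratic_iterate c n x)"
  let ?L = "line_iterate c \<kappa> n"
  let ?A = "?L 1 + ?L 2 - smult \<kappa> (?L 3)" and ?B = "[:0, 1:] * ?L 1 - ?L 3"
  have dA: "degree ?A \<le> 2 ^ n"
    using degree_line_iterate[of c \<kappa> n]
    by (intro degree_diff_le degree_add_le order_trans[OF degree_smult_le]) auto
  have dB: "degree ?B \<le> 2 ^ n + 1"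
    using degree_line_iterate[of c \<kappa> n 1] degree_line_iterate[of c \<kappa> n 3] degree_mult_le[of "[:0, 1:]" "?L 1"]
    by (intro degree_diff_le) auto
  show False
  proof (cases "x $ 1 = 0")
    case False
    define s where "s = x $ 3 / x $ 1"
    define y :: "complex^3" where "y = vector [1, \<kappa> * s - 1, s]"
    have xy: "x = x $ 1 *s y" using False x(2)
      by (simp add: y_def s_def vec_eq_iff forall_3 field_simps)
    have "parallel y (quadratic_iterate c n y)"
      using par False unfolding xy[symmetric]
      by (subst (asm) xy, subst (asm) (2) xy) (simp add: quadratic_iterate_scale parallel_scale)
    then have *: "y $ 1 * quadratic_iterate c n y $ 2 = y $ 2 * quadratic_iterate c n y $ 1"
      "y $ 1 * quadratic_iterate c n y $ 3 = y $ 3 * quadratic_iterate c n y $ 1" by (auto simp: parallel_def)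
    have "poly ?A s = 0" "poly ?B s = 0"
      using * by (simp_all add: poly_line_iterate y_def[symmetric]) (simp_all add: y_def algebra_simps)
    then show False using R sylvester_common_root[OF dA dB] unfolding fixed_resultant_def by blast
  next
    case True
    define y :: "complex^3" where "y = vector [0, \<kappa>, 1]"
    have xy: "x = x $ 3 *s y" using True x(2)
      by (simp add: y_def vec_eq_iff forall_3 mult.commute)
    then have x3: "x $ 3 \<noteq> 0" using x(1) by auto
    have "parallel y (quadratic_iterate c n y)"
      using par x3
      by (subst (asm) xy, subst (asm) (2) xy) (simp add: quadratic_iterate_scale parallel_scale)
    then have *: "y $ 3 * quadratic_iterate c n y $ 1 = y $ 1 * quadratic_iterate c n y $ 3"
      "y $ 3 * quadratic_iterate c n y $ 2 = y $ 2 * quadratic_iterate c n y $ 3" by (auto simp: parallel_def)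
    have "coeff ?A (2 ^ n) = 0"
      using * by (simp add: coeff_line_iterate y_def[symmetric]) (simp add: y_def)
    moreover have "coeff (?L 3) (Suc (2 ^ n)) = 0"
      using degree_line_iterate[of c \<kappa> n 3] by (intro coeff_eq_0) auto
    then have "coeff ?B (2 ^ n + 1) = 0"
      using * by (simp add: coeff_line_iterate y_def[symmetric]) (simp add: y_def)
    ultimately show False
      using R sylvester_common_root_infinity[OF dA dB] unfolding fixed_resultant_def by blast
  qed
qed

lemma fixed_resultant_poly: "\<exists>P. \<forall>\<kappa>. fixed_resultant c n \<kappa> = poly P \<kappa>"
proof -
  \<comment> \<open>A univariate polynomial is reached through \<open>complex^1\<close>, which is
    itself a line.\<close>
  have "polynomial_fun (\<lambda>v :: complex^1. fixed_resultant c n (v $ 1))"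
    by (intro polynomial_fun_fixed_resultant polynomial_fun.intros)
  then obtain P where "\<forall>t. fixed_resultant c n ((0 + t *s (1 :: complex^1)) $ 1) = poly P t"
    using polynomial_fun_line[of "\<lambda>v :: complex^1. fixed_resultant c n (v $ 1)" 0 1] by blast
  then show ?thesis by auto
qed

lemma finite_fixed_resultant_roots:
  assumes "fixed_resultant c n \<kappa>0 \<noteq> 0"
  shows "finite {\<kappa>. fixed_resultant c n \<kappa> = 0}"
proof -
  obtain P where P: "\<forall>\<kappa>. fixed_resultant c n \<kappa> = poly P \<kappa>" using fixed_resultant_poly by blast
  then have "P \<noteq> 0" using assms by auto
  then show ?thesis using poly_roots_finite P by auto
qed

text \<open>A zero of the iterate is parallel to everything, so it would count as a fixed point on
  the line. The second claim is the same at the point that the parametrization misses.\<close>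

lemma line_iterate_no_common_root:
  assumes "fixed_resultant c n \<kappa> \<noteq> 0"
  shows "\<exists>i. poly (line_iterate c \<kappa> n i) s \<noteq> 0" "\<exists>i. coeff (line_iterate c \<kappa> n i) (2 ^ n) \<noteq> 0"
proof -
  let ?y = "vector [1, \<kappa> * s - 1, s] :: complex^3"
  have "?y $ 1 \<noteq> (0 :: complex^3) $ 1" by simp
  then have "?y \<noteq> 0" by (rule contrapos_nn) (simp only:)
  moreover have "?y $ 1 + ?y $ 2 = \<kappa> * ?y $ 3" by simp
  ultimately have "\<not> parallel ?y (quadratic_iterate c n ?y)" by (rule fixed_resultant_no_fixed_point[OF assms])
  then show "\<exists>i. poly (line_iterate c \<kappa> n i) s \<noteq> 0"     unfolding parallel_def poly_line_iterate by (metis mult_zero_right)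
  let ?z = "vector [0, \<kappa>, 1] :: complex^3"
  have "?z $ 3 \<noteq> (0 :: complex^3) $ 3" by simp
  then have "?z \<noteq> 0" by (rule contrapos_nn) (simp only:)
  moreover have "?z $ 1 + ?z $ 2 = \<kappa> * ?z $ 3" by simp
  ultimately have "\<not> parallel ?z (quadratic_iterate c n ?z)" by (rule fixed_resultant_no_fixed_point[OF assms])
  then show "\<exists>i. coeff (line_iterate c \<kappa> n i) (2 ^ n) \<noteq> 0"     unfolding parallel_def coeff_line_iterate by (metis mult_zero_right)
qed

text \<open>The relations show that \<open>L k\<close> divides every \<open>L i * P k\<close>, hence
  \<open>d * P k\<close> for the gcd \<open>d\<close> of the \<open>L i\<close>; and
  \<open>d\<close> is constant because the \<open>L i\<close> have no common root.\<close>

lemma coprime_family_degree_le: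
  fixes L P :: "'i::finite \<Rightarrow> complex poly"
  assumes L: "\<And>s. \<exists>i. poly (L i) s \<noteq> 0" and eq: "\<And>i j. P i * L j = P j * L i"
    and k: "L k \<noteq> 0" and P: "P m \<noteq> 0"
  shows "degree (L k) \<le> degree (P k)"
proof -
  obtain d where d: "\<forall>i. d dvd L i" "\<forall>c x. (\<forall>i. c dvd L i * x) \<longrightarrow> c dvd d * x"
    using finite_family_gcd[of UNIV L] by auto
  have d0: "d \<noteq> 0" using d(1) k by (metis dvd_0_left_iff)
  have "degree d = 0"
  proof (rule ccontr)
    assume "degree d \<noteq> 0"
    then have "\<not> constant (poly d)" by (simp add: constant_degree)
    then obtain s where "poly d s = 0" using fundamental_theorem_of_algebra by blast
    then have "poly (L i) s = 0" for i using d(1) by (metis dvdE mult_eq_0_iff poly_mult)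
    then show False using L by blast
  qed
  have "L k dvd L i * P k" for i using eq[of k i] by (metis dvd_triv_right mult.commute)
  then have "L k dvd d * P k" using d(2) by blast
  moreover have Pk: "P k \<noteq> 0" using eq[of m k] k P by auto
  ultimately have "degree (L k) \<le> degree (d * P k)" using d0 by (intro dvd_imp_degree_le) auto
  also have "\<dots> = degree (P k)" using d0 Pk \<open>degree d = 0\<close> by (simp add: degree_mult_eq)
  finally show ?thesis .
qed

text \<open>On a line without fixed points the components of the \<open>n\<close>-th iterate restrict to polynomials
  without common root whose maximal degree is exactly \<open>2\<^sup>n\<close>.\<close>

lemma proportional_degree_bound:
  assumes R: "fixed_resultant c n \<kappa>0 \<noteq> 0" and g: "\<And>i. poly_deg_le K (\<lambda>x. g x $ i)"
    and par: "\<And>x. parallel (g x) (quadratic_iterate c n x)" and ne: "g y0 \<noteq> 0"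
  shows "2 ^ n \<le> K"
proof -
  obtain m where "g y0 $ m \<noteq> 0" using ne by (auto simp: vec_eq_iff)
  moreover have pm: "polynomial_fun (\<lambda>x. g x $ m)" using g poly_deg_le_polynomial_fun by blast
  moreover have "polynomial_fun (\<lambda>x :: complex^3. x $ 1 * x $ 3)" by (intro polynomial_fun.intros)
  moreover have "(1 :: complex^3) $ 1 * (1 :: complex^3) $ 3 \<noteq> 0" by simp
  ultimately obtain y1 where y1: "g y1 $ m \<noteq> 0" "y1 $ 1 * y1 $ 3 \<noteq> 0"
    using polynomial_fun_mult_nonzero[of "\<lambda>x. g x $ m" "\<lambda>x. x $ 1 * x $ 3" y0 1] by blast
  obtain Q where Q: "\<forall>t. g (y1 + t *s axis 2 1) $ m = poly Q t" using polynomial_fun_line[OF pm] by blast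
  have "poly Q 0 \<noteq> 0" using Q[rule_format, of 0, symmetric] y1(1) by simp
  then have "Q \<noteq> 0" by auto
  \<comment> \<open>Moving the second coordinate by \<open>t\<close> runs through the pencil
    injectively. So all but finitely many \<open>t\<close> give a line with nonzero resultant
    through a point where \<open>g\<close> does not vanish.\<close>
  let ?\<kappa> = "\<lambda>t. (y1 $ 1 + y1 $ 2 + t) / y1 $ 3"
  have "finite {t. fixed_resultant c n (?\<kappa> t) = 0}"
  proof -
    have "inj ?\<kappa>" using y1(2) by (auto simp: inj_on_def)
    moreover have "{t. fixed_resultant c n (?\<kappa> t) = 0} = ?\<kappa> -` {\<kappa>. fixed_resultant c n \<kappa> = 0}" by auto
    ultimately show ?thesis using finite_fixed_resultant_roots[OF R] finite_vimageI by metis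
  qed
  then have "finite ({t. poly Q t = 0} \<union> {t. fixed_resultant c n (?\<kappa> t) = 0})"
    using poly_roots_finite[OF \<open>Q \<noteq> 0\<close>] by simp
  then obtain t where t: "poly Q t \<noteq> 0" "fixed_resultant c n (?\<kappa> t) \<noteq> 0"
    using infinite_UNIV_char_0[where 'a = complex] ex_new_if_finite by (metis (mono_tags, lifting) UnCI mem_Collect_eq)
  define y where "y = y1 + t *s axis 2 1"
  define \<kappa> where "\<kappa> = ?\<kappa> t"
  have y: "g y $ m \<noteq> 0" "y $ 1 \<noteq> 0" "y $ 3 \<noteq> 0" "y $ 1 + y $ 2 = \<kappa> * y $ 3"
    using t(1) Q y1(2) by (auto simp: y_def \<kappa>_def axis_def)
  note R' = t(2)[folded \<kappa>_def]
  define a where "a = y $ 1 *s (vector [1, -1, 0] :: complex^3)"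
  define b where "b = y $ 1 *s (vector [0, \<kappa>, 1] :: complex^3)"
  have ab: "a + s *s b = y $ 1 *s (vector [1, \<kappa> * s - 1, s] :: complex^3)" for s
    by (simp add: a_def b_def vec_eq_iff forall_3 algebra_simps)
  have ys: "a + (y $ 3 / y $ 1) *s b = y"
    using y by (simp add: ab vec_eq_iff forall_3 field_simps)
  have "\<forall>i. \<exists>P. degree P \<le> K \<and> (\<forall>s. g (a + s *s b) $ i = poly P s)" using poly_deg_le_line[OF g] by blast
  from choice[OF this] obtain P where P: "\<And>i. degree (P i) \<le> K" "\<And>i s. g (a + s *s b) $ i = poly (P i) s" by blast
  let ?L = "line_iterate c \<kappa> n"
  have "P i * ?L j = P j * ?L i" for i j
  proof (rule poly_eq_poly_eq_iff[THEN iffD1], rule ext)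
    fix s
    have "parallel (g (a + s *s b)) (quadratic_iterate c n (vector [1, \<kappa> * s - 1, s]))"
      using par[of "a + s *s b"] y(2) unfolding ab by (simp add: quadratic_iterate_scale parallel_scale)
    then have "poly (P i) s * poly (?L j) s = poly (P j) s * poly (?L i) s"
      unfolding parallel_def P(2) poly_line_iterate by blast
    then show "poly (P i * ?L j) s = poly (P j * ?L i) s" by simp
  qed
  moreover obtain k where k: "coeff (?L k) (2 ^ n) \<noteq> 0" using line_iterate_no_common_root(2)[OF R'] by blast
  moreover have "P m \<noteq> 0"
  proof
    assume "P m = 0"
    then have "g y $ m = 0" using P(2)[of "y $ 3 / y $ 1" m] unfolding ys by simp
    then show False using y(1) by simp
  qed
  ultimately have "degree (?L k) \<le> degree (P k)"
    by (intro coprime_family_degree_le[where m = m] line_iterate_no_common_root(1)[OF R']) auto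
  moreover have "2 ^ n \<le> degree (?L k)" using k by (rule le_degree)
  ultimately show ?thesis using P(1)[of k] by linarith
qed

section \<open>The Henon map\<close>

text \<open>The homogenization of \<open>(x, y) \<mapsto> (y, x + y\<^sup>2)\<close>. The entries
  1/2 split each mixed term between \<open>(i, j, k)\<close> and \<open>(i, k, j)\<close>, as
  symmetry demands.\<close>

definition henon_coeffs :: "complex^(3 \<times> 3 \<times> 3)" where
  "henon_coeffs = (\<chi> t. if t \<in> {(1, 2, 3), (1, 3, 2), (2, 1, 3), (2, 3, 1)} then 1 / 2
     else if t \<in> {(2, 2, 2), (3, 3, 3)} then 1 else 0)"

lemma quadratic_forms_henon:
  "quadratic_forms henon_coeffs x = vector [x $ 2 * x $ 3, x $ 1 * x $ 3 + x $ 2 ^ 2, x $ 3 ^ 2]"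
  by (simp add: quadratic_forms_def henon_coeffs_def sum_3 vec_eq_iff forall_3 power2_eq_square)

lemma symmetric_henon: "symmetric_coeffs henon_coeffs"
  by (simp add: symmetric_coeffs_def henon_coeffs_def forall_3)

text \<open>Along a periodic affine orbit of \<open>(x, y) \<mapsto> (y, x + y\<^sup>2)\<close> the largest \<open>\<bar>y\<bar>\<close> satisfies
  \<open>\<bar>y\<bar>\<^sup>2 \<le> 2 \<bar>y\<bar>\<close>, hence all periodic points satisfy \<open>\<bar>x + y\<bar> \<le> 4 < 5\<close>.\<close>

lemma henon_periodic_bound:
  assumes n: "n > 0" and x3: "x $ 3 = 1" and per: "quadratic_iterate henon_coeffs n x = x"
  shows "norm (x $ 1 + x $ 2) \<le> 4"
proof -
  define u where "u k = quadratic_iterate henon_coeffs k x" for k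
  have u0: "u 0 = x" by (simp add: u_def)
  have uS: "u (Suc k) = vector [u k $ 2 * u k $ 3, u k $ 1 * u k $ 3 + u k $ 2 ^ 2, u k $ 3 ^ 2]" for k
    by (simp add: u_def quadratic_iterate_Suc quadratic_forms_henon)
  have u3: "u k $ 3 = 1" for k by (induction k) (simp_all add: u0 x3 uS)
  have u1: "u (Suc k) $ 1 = u k $ 2" and u2: "u (Suc k) $ 2 = u k $ 1 + u k $ 2 ^ 2" for k
    by (simp_all add: uS u3)
  have per': "u (k + n) = u k" for k
  proof (induction k)
    case 0
    then show ?case using per by (simp add: u_def)
  next
    case (Suc k)
    then show ?case by (simp add: uS)
  qed
  define R where "R = Max ((\<lambda>k. norm (u k $ 2)) ` {..<n})"
  have ne: "(\<lambda>k. norm (u k $ 2)) ` {..<n} \<noteq> {}" using n by auto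
  have R1: "norm (u k $ 2) \<le> R" if "k < n" for k unfolding R_def using that by (intro Max_ge) auto
  have mod: "u k = u (k mod n)" for k
  proof -
    have "u (m + j * n) = u m" for m j
    proof (induction j)
      case (Suc j)
      then show ?case using per'[of "m + j * n"] by (simp add: algebra_simps)
    qed simp
    from this[of "k mod n" "k div n"] show ?thesis by (simp add: mult.commute)
  qed
  have R2: "norm (u k $ 2) \<le> R" for k using R1[of "k mod n"] mod[of k] n by simp
  have R3: "norm (u k $ 1) \<le> R" for k
  proof -
    have "u k = u (Suc (k + n - 1))" using per'[of k] n by simp
    then show ?thesis using R2[of "k + n - 1"] by (simp add: u1)
  qed
  have "R \<in> (\<lambda>k. norm (u k $ 2)) ` {..<n}" unfolding R_def using ne by (intro Max_in) auto
  then obtain j where j: "R = norm (u j $ 2)" by auto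
  have "R ^ 2 = norm (u (Suc j) $ 2 - u j $ 1)" by (simp add: j u2 norm_power)
  also have "\<dots> \<le> norm (u (Suc j) $ 2) + norm (u j $ 1)" by (rule norm_triangle_ineq4)
  also have "\<dots> \<le> 2 * R" using R2[of "Suc j"] R3[of j] by simp
  finally have "R * (R - 2) \<le> 0" by (simp add: power2_eq_square algebra_simps)
  moreover have "R \<ge> 0" by (simp add: j)
  ultimately have "R \<le> 2" by (metis linorder_not_le mult_pos_pos diff_gt_0_iff_gt less_le_not_le order_le_less zero_less_numeral order.strict_trans)
  moreover have "norm (x $ 1 + x $ 2) \<le> norm (x $ 1) + norm (x $ 2)" by (rule norm_triangle_ineq)
  ultimately show ?thesis using R2[of 0] R3[of 0] by (simp add: u0)
qed

text \<open>A common root on \<open>x + y = 5 z\<close> is excluded in three places: at infinity by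
  the orbit of \<open>(0, 5, 1)\<close>; at \<open>s = 0\<close>, the point \<open>[1:-1:0]\<close>,
  by direct computation; and elsewhere by \<open>henon_periodic_bound\<close>, since an affine point
  of the line has \<open>x + y = 5\<close>.\<close>

lemma henon_resultant:
  assumes n: "n > 0"
  shows "fixed_resultant henon_coeffs n 5 \<noteq> 0"
proof -
  let ?L = "line_iterate henon_coeffs 5 n"
  let ?A = "?L 1 + ?L 2 - smult 5 (?L 3)" and ?B = "[:0, 1:] * ?L 1 - ?L 3"
  let ?F = "quadratic_iterate henon_coeffs n"
  have dA: "degree ?A \<le> 2 ^ n"
    using degree_line_iterate[of henon_coeffs 5 n]
    by (intro degree_diff_le degree_add_le order_trans[OF degree_smult_le]) auto
  have dB: "degree ?B \<le> 2 ^ n + 1"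
    using degree_line_iterate[of henon_coeffs 5 n 1] degree_line_iterate[of henon_coeffs 5 n 3]
      degree_mult_le[of "[:0, 1:]" "?L 1"]
    by (intro degree_diff_le) auto
  \<comment> \<open>The orbit of \<open>(0, 5, 1)\<close> stays real and large, starting with
    \<open>(5, 25, 1)\<close>. The leading coefficient \<open>a + b - 5\<close> of \<open>?A\<close>
    is therefore positive.\<close>
  have "\<exists>a b. a \<ge> 5 \<and> b \<ge> 25 \<and> quadratic_iterate henon_coeffs (Suc k) (vector [0, 5, 1]) = vector [of_real a, of_real b, 1]" for k
  proof (induction k)
    case 0
    show ?case by (rule exI[of _ 5], rule exI[of _ 25]) (simp add: quadratic_iterate_Suc quadratic_forms_henon)
  next
    case (Suc k)
    then obtain a b where ab: "a \<ge> 5" "b \<ge> 25"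
      "quadratic_iterate henon_coeffs (Suc k) (vector [0, 5, 1]) = vector [of_real a, of_real b, 1]" by blast
    have "25 * 1 \<le> b * b" using ab(2) by (intro mult_mono) auto
    then show ?case unfolding quadratic_iterate_Suc[of _ "Suc k"] ab(3) quadratic_forms_henon using ab
      by (intro exI[of _ b] exI[of _ "a + b ^ 2"]) (simp add: power2_eq_square)
  qed
  from this[of "n - 1"] n obtain a b :: real where ab: "a \<ge> 5" "b \<ge> 25" "?F (vector [0, 5, 1]) = vector [of_real a, of_real b, 1]"
    by auto
  have "coeff ?A (2 ^ n) = of_real (a + b - 5)" using ab(3) by (simp add: coeff_line_iterate)
  moreover have "a + b - 5 \<noteq> 0" using ab by linarith
  ultimately have lead: "coeff ?A (2 ^ n) \<noteq> 0" by (metis of_real_eq_0_iff)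
  then have A: "degree ?A = 2 ^ n" using dA le_degree by (meson antisym)
  have A0: "?A \<noteq> 0" using lead by (metis coeff_0)
  have "poly ?B s \<noteq> 0" if As: "poly ?A s = 0" for s
  proof
    assume Bs: "poly ?B s = 0"
    let ?x = "vector [1, 5 * s - 1, s] :: complex^3"
    have eq: "?F ?x $ 1 + ?F ?x $ 2 = 5 * ?F ?x $ 3" "?F ?x $ 3 = s * ?F ?x $ 1"
      using As Bs by (simp_all add: poly_line_iterate)
    have F3: "quadratic_iterate henon_coeffs k x $ 3 = x $ 3 ^ (2 ^ k)" for k x
      by (induction k) (simp_all add: quadratic_iterate_Suc quadratic_forms_henon power_mult[symmetric] mult.commute)
    show False
    proof (cases "s = 0")
      case True
      have "quadratic_iterate henon_coeffs (Suc k) (vector [1, -1, 0]) = vector [0, 1, 0]" for k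
        by (induction k) (simp_all add: quadratic_iterate_Suc quadratic_forms_henon)
      from this[of "n - 1"] n have "?F (vector [1, -1, 0]) = vector [0, 1, 0]" by simp
      then show False using eq(1) True by simp
    next
      case False
      define y where "y = ?F ?x $ 1"
      have sy: "s ^ (2 ^ n) = s * y" using eq(2) F3[of n ?x] by (simp add: y_def)
      have Fx: "?F ?x = y *s ?x" using eq
        by (simp add: y_def vec_eq_iff forall_3 algebra_simps)
      \<comment> \<open>The representative with third coordinate 1. The third component of the
        iterate is a pure power, so this vector is itself fixed and not only up to a factor.\<close>
      define z where "z = (1 / s) *s ?x"
      have y0: "y \<noteq> 0" using sy False by auto
      have "?F z = ((1 / s) ^ (2 ^ n) * y) *s ?x" unfolding z_def quadratic_iterate_scale Fx by simp
      also have "(1 / s) ^ (2 ^ n) * y = 1 / s" using sy False y0 by (simp add: power_one_over field_simps)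
      finally have "?F z = z" by (simp add: z_def)
      moreover have "z $ 3 = 1" using False by (simp add: z_def)
      ultimately have "norm (z $ 1 + z $ 2) \<le> 4" using henon_periodic_bound[OF n] by blast
      moreover have "z $ 1 + z $ 2 = 5" using False by (simp add: z_def field_simps)
      ultimately show False by simp
    qed
  qed
  then show ?thesis unfolding fixed_resultant_def by (intro sylvester_nonzero[OF A A0 dB]) auto
qed

section \<open>A quadratic transformation with few periodic points\<close>

definition plane_domain :: "(complex^3 \<Rightarrow> complex^3) \<Rightarrow> (complex^3) set set" where
  "plane_domain F = proj_point ` {x. F x \<noteq> 0}"

definition plane_fun :: "(complex^3 \<Rightarrow> complex^3) \<Rightarrow> (complex^3) set \<Rightarrow> (complex^3) set" where
  "plane_fun F s = proj_point (F (SOME x. proj_point x = s \<and> F x \<noteq> 0))"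

lemma proj_point_homogeneous:
  assumes "\<And>t x. F (t *s x) = t ^ d *s F x" "proj_point x = proj_point y"
  shows "F x \<noteq> 0 \<longleftrightarrow> F y \<noteq> 0" "F x \<noteq> 0 \<Longrightarrow> proj_point (F x) = proj_point (F y)"
proof -
  obtain t where t: "t \<noteq> 0" "y = t *s x" using assms(2) unfolding proj_point_eq_iff by blast
  then have y: "F y = t ^ d *s F x" using assms(1) by simp
  then show "F x \<noteq> 0 \<longleftrightarrow> F y \<noteq> 0" using t by simp
  show "F x \<noteq> 0 \<Longrightarrow> proj_point (F x) = proj_point (F y)"
    unfolding proj_point_eq_iff using t y by (intro exI[of _ "t ^ d"]) simp
qed

lemma plane_fun_proj_point:
  assumes "\<And>t x. F (t *s x) = t ^ d *s F x" "F x \<noteq> 0"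
  shows "plane_fun F (proj_point x) = proj_point (F x)"
proof -
  let ?y = "SOME y. proj_point y = proj_point x \<and> F y \<noteq> 0"
  have "proj_point ?y = proj_point x \<and> F ?y \<noteq> 0" by (rule someI[of _ x]) (simp add: assms(2))
  then show ?thesis using proj_point_homogeneous(2)[OF assms(1), of ?y x] by (simp add: plane_fun_def)
qed

lemma proj_point_mem_plane_domain:
  assumes "\<And>t x. F (t *s x) = t ^ d *s F x"
  shows "proj_point x \<in> plane_domain F \<longleftrightarrow> F x \<noteq> 0"
  using proj_point_homogeneous(1)[OF assms] unfolding plane_domain_def by blast

lemma regular_P2:
  "regular P2 W f \<longleftrightarrow> W \<subseteq> proj_point ` (- {0}) \<and> openin zariski {x \<in> - {0}. proj_point x \<in> W} \<and>
     locally_rational {x \<in> - {0}. proj_point x \<in> W} (f \<circ> proj_point)"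
  unfolding P2_quotient by (rule regular_quotient_variety[OF openin_zariski_nonzero_vec])

lemma plane_fun_partial_morphism:
  assumes F: "polynomial_map F" and hom: "\<And>t x. F (t *s x) = t ^ d *s F x" and d: "d > 0" and ne: "F x0 \<noteq> 0"
  shows "(plane_domain F, plane_fun F) \<in> partial_morphisms P2 P2"
proof -
  have F0: "F 0 = 0" using hom[of 0 0] d by (simp add: power_0_left)
  note dom = proj_point_mem_plane_domain[OF hom] and fn = plane_fun_proj_point[OF hom]
  have sub: "plane_domain F \<subseteq> proj_point ` (- {0})" using F0 by (auto simp: plane_domain_def)
  have pre: "{x \<in> - {0}. proj_point x \<in> {s \<in> plane_domain F. plane_fun F s \<in> V}} = {x. F x \<in> {y \<in> - {0}. proj_point y \<in> V}}" for V
    using dom fn F0 by auto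
  show ?thesis
    unfolding partial_morphisms_iff[OF irreducible_space_P2]
  proof (intro conjI allI impI)
    have "{x \<in> - {0}. proj_point x \<in> plane_domain F} = {x. F x \<in> - {0}}" using dom F0 by auto
    then show "openin (zar P2) (plane_domain F)"
      unfolding openin_P2 using sub openin_zariski_vimage[OF openin_zariski_nonzero_vec F] by simp
    show "plane_domain F \<noteq> {}" using ne by (auto simp: plane_domain_def)
    show "plane_fun F ` plane_domain F \<subseteq> points P2"
      using fn unfolding points_P2 plane_domain_def by auto
  next
    fix V assume "openin (zar P2) V"
    then have "openin zariski {y \<in> - {0}. proj_point y \<in> V}" unfolding openin_P2 by blast
    from openin_zariski_vimage[OF this F]
    show "openin (zar P2) {s \<in> plane_domain F. plane_fun F s \<in> V}"
      unfolding openin_P2 pre using sub by blast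
  next
    fix V g assume g: "regular P2 V g"
    then have V: "openin zariski {y \<in> - {0}. proj_point y \<in> V}"
      and lr: "locally_rational {y \<in> - {0}. proj_point y \<in> V} (g \<circ> proj_point)" unfolding regular_P2 by blast+
    show "regular P2 {s \<in> plane_domain F. plane_fun F s \<in> V} (g \<circ> plane_fun F)"
      unfolding regular_P2 pre
    proof (intro conjI)
      show "{s \<in> plane_domain F. plane_fun F s \<in> V} \<subseteq> proj_point ` (- {0})" using sub by blast
      show "openin zariski {x. F x \<in> {y \<in> - {0}. proj_point y \<in> V}}" by (rule openin_zariski_vimage[OF V F])
      show "locally_rational {x. F x \<in> {y \<in> - {0}. proj_point y \<in> V}} (g \<circ> plane_fun F \<circ> proj_point)"
        unfolding locally_rational_def
      proof
        fix x assume "x \<in> {x. F x \<in> {y \<in> - {0}. proj_point y \<in> V}}"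
        then have "F x \<in> {y \<in> - {0}. proj_point y \<in> V}" by blast
        from lr[unfolded locally_rational_def, rule_format, OF this] obtain V' p q where
          V': "openin zariski V'" "F x \<in> V'" "V' \<subseteq> {y \<in> - {0}. proj_point y \<in> V}" "polynomial_fun p" "polynomial_fun q"
            "\<forall>y\<in>V'. q y \<noteq> 0 \<and> (g \<circ> proj_point) y = p y / q y" by blast
        show "\<exists>W p q. openin zariski W \<and> x \<in> W \<and> W \<subseteq> {x. F x \<in> {y \<in> - {0}. proj_point y \<in> V}} \<and>
            polynomial_fun p \<and> polynomial_fun q \<and> (\<forall>y\<in>W. q y \<noteq> 0 \<and> (g \<circ> plane_fun F \<circ> proj_point) y = p y / q y)"
        proof (rule exI[of _ "{x. F x \<in> V'}"], rule exI[of _ "\<lambda>x. p (F x)"], rule exI[of _ "\<lambda>x. q (F x)"], intro conjI ballI)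
          show "openin zariski {x. F x \<in> V'}" by (rule openin_zariski_vimage[OF V'(1) F])
          show "polynomial_fun (\<lambda>x. p (F x))" "polynomial_fun (\<lambda>x. q (F x))"
            using polynomial_map_comp_fun[OF _ F] V'(4,5) by auto
          fix y assume "y \<in> {x. F x \<in> V'}"
          then have y: "F y \<in> V'" "F y \<noteq> 0" using V'(3) by auto
          then show "q (F y) \<noteq> 0" "(g \<circ> plane_fun F \<circ> proj_point) y = p (F y) / q (F y)"
            using V'(6) fn[OF y(2)] by auto
        qed (use V'(2,3) in auto)
      qed
    qed
  qed
qed

lemma plane_map_eq_rat_class:
  assumes "\<And>t x. F (t *s x) = t ^ d *s F x"
  shows "plane_map F = rat_class P2 P2 (plane_domain F) (plane_fun F)"
proof -
  have "(\<forall>x. proj_point x \<in> V \<and> F x \<noteq> 0 \<longrightarrow> g (proj_point x) = proj_point (F x)) \<longleftrightarrow>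
      (\<forall>s\<in>plane_domain F \<inter> V. plane_fun F s = g s)" for V g
    unfolding plane_domain_def using plane_fun_proj_point[OF assms] by auto
  then show ?thesis by (simp add: plane_map_def rat_class_def)
qed

lemma plane_map_birational_inverses:
  assumes F: "polynomial_map F" "\<And>t x. F (t *s x) = t ^ d *s F x" "d > 0"
    and G: "polynomial_map G" "\<And>t x. G (t *s x) = t ^ e *s G x" "e > 0"
    and GF: "\<And>x. G (F x) = b x *s x" "polynomial_fun b" "b x0 \<noteq> 0"
    and FG: "\<And>x. F (G x) = a x *s x" "polynomial_fun a" "a x1 \<noteq> 0"
  shows "birational_inverses P2 P2 (plane_map F) (plane_map G)"
proof -
  note i = irreducible_space_P2
  have one: "(1 :: complex^3) \<noteq> 0" by (simp add: vec_eq_iff)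
  \<comment> \<open>Stated for arbitrary forms, so that it can be used again with \<open>F\<close>
    and \<open>G\<close> exchanged.\<close>
  have half: "(plane_domain F, plane_fun F) \<in> partial_morphisms P2 P2 \<and> dominant_map P2 (plane_domain F) (plane_fun F) \<and>
      (\<exists>x. x \<noteq> 0 \<and> G (F x) \<noteq> 0)"
    if F: "polynomial_map F" "\<And>t x. F (t *s x) = t ^ d *s F x" "d > 0"
      and G: "polynomial_map G" "\<And>t x. G (t *s x) = t ^ e *s G x" "e > 0"
      and GF: "\<And>x. G (F x) = b x *s x" "polynomial_fun b" "b x0 \<noteq> 0"
      and FG: "\<And>x. F (G x) = a x *s x" "polynomial_fun a" "a x1 \<noteq> 0"
    for F G :: "complex^3 \<Rightarrow> complex^3" and a b d e x0 x1
  proof (intro conjI)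
    have G0: "G 0 = 0" "F 0 = 0" using G(2)[of 0 0] G(3) F(2)[of 0 0] F(3) by (auto simp: power_0_left)
    have "- {0} \<inter> {x. b x \<noteq> 0} \<noteq> {}"
      using zariski_opens_meet[OF openin_zariski_nonzero_vec openin_zariski_nonzero[OF GF(2)]] one GF(3) by auto
    then obtain x where x: "x \<noteq> 0" "b x \<noteq> 0" by auto
    then have GFx: "G (F x) \<noteq> 0" using GF(1) by simp
    then show "\<exists>x. x \<noteq> 0 \<and> G (F x) \<noteq> 0" using x by blast
    have "F x \<noteq> 0" using GFx G0 by auto
    then show "(plane_domain F, plane_fun F) \<in> partial_morphisms P2 P2"
      by (rule plane_fun_partial_morphism[OF F])
    show "dominant_map P2 (plane_domain F) (plane_fun F)"
      unfolding dominant_map_def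
    proof (intro allI impI)
      fix V assume V: "openin (zar P2) V \<and> V \<noteq> {}"
      then have "{x \<in> - {0}. proj_point x \<in> V} \<inter> {x. a x \<noteq> 0} \<noteq> {}"
        using openin_P2[of V] FG(3) openin_zariski_nonzero[OF FG(2)]
        by (intro zariski_opens_meet) auto
      then obtain y where y: "y \<noteq> 0" "proj_point y \<in> V" "a y \<noteq> 0" by auto
      have FGy: "F (G y) \<noteq> 0" using FG(1) y by simp
      have "proj_point y = proj_point (F (G y))"
        unfolding proj_point_eq_iff FG(1) using y(3) by blast
      then have "plane_fun F (proj_point (G y)) \<in> V" using plane_fun_proj_point[OF F(2) FGy] y(2) by simp
      then show "\<exists>x\<in>plane_domain F. plane_fun F x \<in> V"
        using FGy proj_point_mem_plane_domain[OF F(2)] by blast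
    qed
  qed
  have comp: "rat_comp P2 P2 (plane_map G) (plane_map F) = rat_id P2"
    if F: "polynomial_map F" "\<And>t x. F (t *s x) = t ^ d *s F x" "d > 0"
      and G: "polynomial_map G" "\<And>t x. G (t *s x) = t ^ e *s G x" "e > 0"
      and GF: "\<And>x. G (F x) = b x *s x" "polynomial_fun b" "b x0 \<noteq> 0"
      and FG: "\<And>x. F (G x) = a x *s x" "polynomial_fun a" "a x1 \<noteq> 0"
    for F G :: "complex^3 \<Rightarrow> complex^3" and a b d e x0 x1
  proof -
    note hF = half[OF F G GF FG] and hG = half[OF G F FG GF]
    have G0: "G 0 = 0" using G(2)[of 0 0] G(3) by (auto simp: power_0_left)
    let ?W = "{x \<in> plane_domain F. plane_fun F x \<in> plane_domain G}"
    obtain x where x: "x \<noteq> 0" "G (F x) \<noteq> 0" using hF by blast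
    then have Fx: "F x \<noteq> 0" using G0 by auto
    have "proj_point x \<in> ?W"
      using x Fx plane_fun_proj_point[OF F(2) Fx] proj_point_mem_plane_domain[OF F(2)] proj_point_mem_plane_domain[OF G(2)] by simp
    then have pm: "(?W, plane_fun G \<circ> plane_fun F) \<in> partial_morphisms P2 P2"
      using hF hG by (intro partial_morphisms_comp[OF i i]) auto
    have "(plane_fun G \<circ> plane_fun F) s = s" if "s \<in> ?W" for s
    proof -
      obtain x where x: "s = proj_point x" "F x \<noteq> 0" using \<open>s \<in> ?W\<close> unfolding plane_domain_def by blast
      have 1: "plane_fun F s = proj_point (F x)" using plane_fun_proj_point[OF F(2) x(2)] x(1) by simp
      then have 2: "G (F x) \<noteq> 0" using \<open>s \<in> ?W\<close> proj_point_mem_plane_domain[OF G(2)] by auto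
      have "proj_point x = proj_point (G (F x))"
        unfolding proj_point_eq_iff using GF(1) 2 by (intro exI[of _ "b x"]) auto
      then show ?thesis using 1 plane_fun_proj_point[OF G(2) 2] x(1) by simp
    qed
    then have mem: "(?W, plane_fun G \<circ> plane_fun F) \<in> rat_id P2"
      using pm by (auto simp: rat_id_def rat_class_def)
    have "rat_id P2 \<in> rational_maps P2 P2"
      unfolding rat_id_def by (rule rat_class_rational_maps[OF partial_morphisms_id[OF i]])
    from rat_class_eq[OF separated_space_P2 this mem] show ?thesis
      unfolding plane_map_eq_rat_class[OF F(2)] plane_map_eq_rat_class[OF G(2)]
      using rat_comp_rat_class[OF separated_space_P2] hF hG by simp
  qed
  show ?thesis
    unfolding birational_inverses_def
  proof (intro conjI)
    show "plane_map F \<in> rational_maps P2 P2" unfolding plane_map_eq_rat_class[OF F(2)]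
      using half[OF F G GF FG] by (intro rat_class_rational_maps) simp
    show "plane_map G \<in> rational_maps P2 P2" unfolding plane_map_eq_rat_class[OF G(2)]
      using half[OF G F FG GF] by (intro rat_class_rational_maps) simp
  qed (rule comp[OF F G GF FG] comp[OF G F FG GF])+
qed

lemma henon_birational: "plane_map (quadratic_forms henon_coeffs) \<in> carrier (Bir P2)"
proof -
  \<comment> \<open>The homogenization of the inverse map
    \<open>(x, y) \<mapsto> (y - x\<^sup>2, x)\<close>.\<close>
  let ?G = "\<lambda>x :: complex^3. vector [x $ 2 * x $ 3 - x $ 1 ^ 2, x $ 1 * x $ 3, x $ 3 ^ 2] :: complex^3"
  have "birational_inverses P2 P2 (plane_map (quadratic_forms henon_coeffs)) (plane_map ?G)"
  proof (rule plane_map_birational_inverses)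
    show "polynomial_map (quadratic_forms henon_coeffs)" by (rule polynomial_map_quadratic_forms)
    show "quadratic_forms henon_coeffs (t *s x) = t ^ 2 *s quadratic_forms henon_coeffs x" for t x
      by (rule quadratic_forms_scale)
    show "polynomial_map ?G"
      by (simp add: polynomial_map_def forall_3 polynomial_fun.intros polynomial_fun_power polynomial_fun_diff)
    show "?G (t *s x) = t ^ 2 *s ?G x" for t x
      by (simp add: vec_eq_iff forall_3 power2_eq_square algebra_simps)
    show "?G (quadratic_forms henon_coeffs x) = x $ 3 ^ 3 *s x" for x
      by (simp add: quadratic_forms_henon vec_eq_iff forall_3 power2_eq_square power3_eq_cube algebra_simps)
    show "quadratic_forms henon_coeffs (?G x) = x $ 3 ^ 3 *s x" for x
      by (simp add: quadratic_forms_henon vec_eq_iff forall_3 power2_eq_square power3_eq_cube algebra_simps)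
    show "polynomial_fun (\<lambda>x :: complex^3. x $ 3 ^ 3)" "polynomial_fun (\<lambda>x :: complex^3. x $ 3 ^ 3)"
      by (intro polynomial_fun_intros)+
    show "(1 :: complex^3) $ 3 ^ 3 \<noteq> 0" "(1 :: complex^3) $ 3 ^ 3 \<noteq> 0" by simp_all
  qed simp_all
  then show ?thesis by (auto simp: Bir_def)
qed

text \<open>A common factor can vanish only where the last two components do, that is, on
  \<open>x $ 2 = x $ 3 = 0\<close>. This has codimension two, so the factor is constant off it and
  then everywhere.\<close>

lemma henon_no_common_factor: "no_common_factor (quadratic_forms henon_coeffs)"
  unfolding no_common_factor_def
proof (intro allI impI)
  fix h :: "complex^3 \<Rightarrow> complex" and g :: "3 \<Rightarrow> complex^3 \<Rightarrow> complex"
  assume *: "polynomial_fun h \<and> (\<forall>i. polynomial_fun (g i)) \<and> (\<forall>i x. quadratic_forms henon_coeffs x $ i = h x * g i x)"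
  have hz: "h x \<noteq> 0" if "\<And>i j. (i, j) \<in> {(2 :: 3, 3 :: 3)} \<Longrightarrow> x $ i \<noteq> 0 \<or> x $ j \<noteq> 0" for x
  proof
    assume "h x = 0"
    then have "quadratic_forms henon_coeffs x $ i = 0" for i using * by simp
    from this[of 2] this[of 3] have "x $ 3 = 0" "x $ 2 = 0" by (simp_all add: quadratic_forms_henon)
    then show False using that by auto
  qed
  have "h x = h 1" for x
  proof (rule polynomial_fun_eq_on_open[where U = "{x :: complex^3. x $ 3 \<noteq> 0}" and p = h and q = "\<lambda>_. h 1"])
    show "openin zariski {x :: complex^3. x $ 3 \<noteq> 0}" by (intro openin_zariski_nonzero polynomial_fun.coord)
    have "(1 :: complex^3) \<in> {x. x $ 3 \<noteq> 0}" by simp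
    then show "{x :: complex^3. x $ 3 \<noteq> 0} \<noteq> {}" by blast
    show "h y = h 1" if "y \<in> {x. x $ 3 \<noteq> 0}" for y
      by (rule nowhere_zero_imp_const[where P = "{(2, 3)}", OF _ _ _ hz]) (use * that in auto)
  qed (use * in \<open>auto intro: polynomial_fun.const\<close>)
  then show "\<exists>a. \<forall>x. h x = a" by blast
qed

lemma henon_quadratic_birational: "proj_point henon_coeffs \<in> quadratic_birational"
  unfolding quadratic_birational_def
  using symmetric_henon henon_no_common_factor henon_birational by blast

text \<open>If all forms were zero, the nonconstant function \<open>x $ 1\<close> would be a common
  factor.\<close>

lemma quadratic_birational_nonzero: "no_common_factor (quadratic_forms c) \<Longrightarrow> c \<noteq> 0"
proof
  assume n: "no_common_factor (quadratic_forms c)" and "c = 0"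
  then have "quadratic_forms c x $ i = x $ 1 * 0" for i x by (simp add: quadratic_forms_def)
  then have "\<exists>a. \<forall>x :: complex^3. x $ 1 = a"
    using n unfolding no_common_factor_def
    by (elim allE[of _ "\<lambda>x. x $ 1"] allE[of _ "\<lambda>_ _. 0"] impE) (auto intro: polynomial_fun.intros)
  then obtain a where a: "\<And>x :: complex^3. x $ 1 = a" by blast
  from a[of 0] a[of 1] show False by simp
qed

lemma plane_map_scale: "t \<noteq> 0 \<Longrightarrow> plane_map (quadratic_forms (t *s c)) = plane_map (quadratic_forms c)"
proof -
  assume t: "t \<noteq> 0"
  have "proj_point (t *s v) = proj_point v" for v :: "complex^3"
    by (subst eq_commute) (use t in \<open>auto simp: proj_point_eq_iff\<close>)
  then show ?thesis using t by (simp add: plane_map_def quadratic_forms_scale_coeffs)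
qed

lemma closedin_fixed_resultant:
  "closedin (zar projective_space) {proj_point c |c. c \<noteq> 0 \<and> fixed_resultant c n 5 = 0}" (is "closedin ?T ?Z")
proof -
  have T: "topspace ?T = proj_point ` (- {0 :: complex^(3 \<times> 3 \<times> 3)})"
    unfolding projective_space_def by (rule points_quotient_variety[OF openin_zariski_nonzero_vec])
  have "{c \<in> - {0}. proj_point c \<in> topspace ?T - ?Z} = - {0} \<inter> {c. fixed_resultant c n 5 \<noteq> 0}"
  proof (intro Set.set_eqI iffI)
    fix c :: "complex^(3 \<times> 3 \<times> 3)"
    assume "c \<in> - {0} \<inter> {c. fixed_resultant c n 5 \<noteq> 0}"
    then have c: "c \<noteq> 0" "fixed_resultant c n 5 \<noteq> 0" by auto
    have "proj_point c \<notin> ?Z"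
      using c(2) fixed_resultant_scale by (auto simp: proj_point_eq_iff)
    then show "c \<in> {c \<in> - {0}. proj_point c \<in> topspace ?T - ?Z}" using c T by auto
  qed auto
  moreover have "openin zariski {c. fixed_resultant c n 5 \<noteq> 0}"
    by (intro openin_zariski_nonzero polynomial_fun_fixed_resultant polynomial_fun.intros)
  from openin_Int[OF openin_zariski_nonzero_vec this]
  have "openin zariski (- {0} \<inter> {c. fixed_resultant c n 5 \<noteq> 0})" .
  ultimately have "openin zariski {c \<in> - {0}. proj_point c \<in> topspace ?T - ?Z}" by (simp only:)
  then have "openin ?T (topspace ?T - ?Z)"
    unfolding projective_space_def openin_quotient_variety[OF openin_zariski_nonzero_vec]
    unfolding projective_space_def[symmetric] using T by blast
  moreover have "?Z \<subseteq> topspace ?T" unfolding T by auto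
  ultimately show ?thesis by (simp add: closedin_def)
qed

section \<open>Curves of fixed points\<close>

text \<open>Agreement is asked only on some nonempty open set. So \<open>H\<close> may have base
  points and common factors, and iterated forms represent iterated maps without any analysis of
  indeterminacy.\<close>

definition represented_by :: "((complex^3) set, (complex^3) set) ratmap \<Rightarrow> (complex^3 \<Rightarrow> complex^3) \<Rightarrow> bool" where
  "represented_by \<phi> H \<longleftrightarrow> (\<forall>(U, g)\<in>\<phi>. \<exists>W. openin (zar P2) W \<and> W \<noteq> {} \<and> W \<subseteq> U \<and>
     (\<forall>x. x \<noteq> 0 \<and> proj_point x \<in> W \<longrightarrow> H x \<noteq> 0 \<and> g (proj_point x) = proj_point (H x)))"

lemma represented_byD:
  assumes "represented_by \<phi> H" "(U, g) \<in> \<phi>"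
  obtains W where "openin (zar P2) W" "W \<noteq> {}" "W \<subseteq> U"
    "\<And>x. x \<noteq> 0 \<Longrightarrow> proj_point x \<in> W \<Longrightarrow> H x \<noteq> 0 \<and> g (proj_point x) = proj_point (H x)"
  using assms unfolding represented_by_def by fastforce

lemma Bir_dominant:
  assumes "\<phi> \<in> carrier (Bir P2)" "(U, f) \<in> \<phi>"
  shows "(U, f) \<in> partial_morphisms P2 P2" "dominant_map P2 U f"
proof -
  obtain \<psi> where b: "birational_inverses P2 P2 \<phi> \<psi>" using assms(1) by (auto simp: Bir_def)
  then show "(U, f) \<in> partial_morphisms P2 P2"
    using rational_maps_partial_morphisms assms(2) by (auto simp: birational_inverses_def)
  show "dominant_map P2 U f"
    by (rule birational_inverses_dominant[OF irreducible_space_P2 irreducible_space_P2 b assms(2)])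
qed

lemma dominant_preimage:
  assumes "irreducible_space X" "(U, f) \<in> partial_morphisms X Y" "dominant_map Y U f" "openin (zar Y) V" "V \<noteq> {}"
  shows "openin (zar X) {x \<in> U. f x \<in> V}" "{x \<in> U. f x \<in> V} \<noteq> {}"
  using partial_morphismsD(5)[OF assms(1,2,4)] assms(3-5) by (auto simp: dominant_map_def)

lemma P2_opens_meet:
  "openin (zar P2) U \<Longrightarrow> openin (zar P2) V \<Longrightarrow> U \<noteq> {} \<Longrightarrow> V \<noteq> {} \<Longrightarrow> U \<inter> V \<noteq> {}"
  by (rule irreducible_spaceD(2)[OF irreducible_space_P2])

lemma represented_by_id: "represented_by (rat_id P2) (\<lambda>x. x)"
  unfolding represented_by_def
proof (intro ballI, clarify)
  fix U g assume g: "(U, g) \<in> rat_id P2"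
  then have pm: "(U, g) \<in> partial_morphisms P2 P2" and gs: "\<forall>x\<in>points P2 \<inter> U. x = g x"
    by (auto simp: rat_id_def rat_class_def)
  note D = partial_morphismsD[OF irreducible_space_P2 pm]
  show "\<exists>W. openin (zar P2) W \<and> W \<noteq> {} \<and> W \<subseteq> U \<and>
     (\<forall>x. x \<noteq> 0 \<and> proj_point x \<in> W \<longrightarrow> x \<noteq> 0 \<and> g (proj_point x) = proj_point x)"
    using D(1,2,4) gs by (intro exI[of _ U]) auto
qed

text \<open>Dominance of \<open>\<phi>\<close> makes the preimage of the good open set of
  \<open>\<psi>\<close> nonempty.\<close>

lemma represented_by_comp:
  assumes \<phi>: "\<phi> \<in> carrier (Bir P2)" "represented_by \<phi> F" and \<psi>: "represented_by \<psi> H"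
  shows "represented_by (rat_comp P2 P2 \<psi> \<phi>) (\<lambda>x. H (F x))"
  unfolding represented_by_def
proof (intro ballI, clarify)
  fix U g assume "(U, g) \<in> rat_comp P2 P2 \<psi> \<phi>"
  then obtain U1 f1 V1 g1 where g: "(U, g) \<in> partial_morphisms P2 P2" and f1: "(U1, f1) \<in> \<phi>" and g1: "(V1, g1) \<in> \<psi>"
    and eq: "\<forall>x\<in>U1 \<inter> U. f1 x \<in> V1 \<longrightarrow> g x = g1 (f1 x)"
    unfolding rat_comp_def by blast
  obtain W where W: "openin (zar P2) W" "W \<noteq> {}" "W \<subseteq> U1"
    "\<And>x. x \<noteq> 0 \<Longrightarrow> proj_point x \<in> W \<Longrightarrow> F x \<noteq> 0 \<and> f1 (proj_point x) = proj_point (F x)"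
    by (rule represented_byD[OF \<phi>(2) f1]) (rule that)
  obtain W' where W': "openin (zar P2) W'" "W' \<noteq> {}" "W' \<subseteq> V1"
    "\<And>x. x \<noteq> 0 \<Longrightarrow> proj_point x \<in> W' \<Longrightarrow> H x \<noteq> 0 \<and> g1 (proj_point x) = proj_point (H x)"
    by (rule represented_byD[OF \<psi> g1]) (rule that)
  note pre = dominant_preimage[OF irreducible_space_P2 Bir_dominant[OF \<phi>(1) f1] W'(1,2)]
  note D = partial_morphismsD[OF irreducible_space_P2 g]
  let ?W = "W \<inter> {x \<in> U1. f1 x \<in> W'} \<inter> U"
  have o: "openin (zar P2) ?W" using W pre D by (intro openin_Int)
  moreover have "?W \<noteq> {}"
    using W pre D by (intro P2_opens_meet openin_Int)
  moreover have "?W \<subseteq> U" by blast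
  moreover have "H (F x) \<noteq> 0 \<and> g (proj_point x) = proj_point (H (F x))" if "x \<noteq> 0" "proj_point x \<in> ?W" for x
  proof -
    have F: "F x \<noteq> 0" "f1 (proj_point x) = proj_point (F x)" using W(4) that by auto
    then have "proj_point (F x) \<in> W'" using that by auto
    then have "H (F x) \<noteq> 0" "g1 (proj_point (F x)) = proj_point (H (F x))" "proj_point (F x) \<in> V1"
      using W'(3,4) F(1) by auto
    then show ?thesis using eq that F(2) by auto
  qed
  ultimately show "\<exists>W. openin (zar P2) W \<and> W \<noteq> {} \<and> W \<subseteq> U \<and>
     (\<forall>x. x \<noteq> 0 \<and> proj_point x \<in> W \<longrightarrow> H (F x) \<noteq> 0 \<and> g (proj_point x) = proj_point (H (F x)))"
    by blast
qed

lemma represented_by_plane_map: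
  assumes F: "polynomial_map F" "F x0 \<noteq> 0" "\<And>t x. F (t *s x) = t ^ d *s F x" "d > 0"
  shows "represented_by (plane_map F) F"
  unfolding represented_by_def
proof (intro ballI, clarify)
  fix U g assume "(U, g) \<in> plane_map F"
  then have pm: "(U, g) \<in> partial_morphisms P2 P2"
    and eq: "\<forall>x. proj_point x \<in> U \<and> F x \<noteq> 0 \<longrightarrow> g (proj_point x) = proj_point (F x)"
    by (auto simp: plane_map_def)
  note D = partial_morphismsD[OF irreducible_space_P2 pm]
  note D' = partial_morphismsD[OF irreducible_space_P2 plane_fun_partial_morphism[OF F(1,3,4,2)]]
  have "openin (zar P2) (U \<inter> plane_domain F)" "U \<inter> plane_domain F \<noteq> {}"
    by (rule openin_Int[OF D(1) D'(1)], rule P2_opens_meet[OF D(1) D'(1) D(2) D'(2)])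
  then show "\<exists>W. openin (zar P2) W \<and> W \<noteq> {} \<and> W \<subseteq> U \<and>
     (\<forall>x. x \<noteq> 0 \<and> proj_point x \<in> W \<longrightarrow> F x \<noteq> 0 \<and> g (proj_point x) = proj_point (F x))"
    using eq proj_point_mem_plane_domain[OF F(3)] by (intro exI[of _ "U \<inter> plane_domain F"]) auto
qed

lemma parallel_on_open:
  assumes "openin zariski V" "V \<noteq> {}" "polynomial_map a" "polynomial_map b"
    "\<And>x. x \<in> V \<Longrightarrow> parallel (a x) (b x)"
  shows "parallel (a x) (b x)"
  unfolding parallel_def
proof (intro allI)
  fix i j
  show "a x $ i * b x $ j = a x $ j * b x $ i"
    by (rule polynomial_fun_eq_on_open[OF assms(1,2), where p = "\<lambda>x. a x $ i * b x $ j" and q = "\<lambda>x. a x $ j * b x $ i"])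
      (use assms(3-5) in \<open>auto simp: polynomial_map_def parallel_def intro!: polynomial_fun.mult\<close>)
qed

lemma cone_open:
  assumes "openin (zar P2) W" "W \<noteq> {}"
  shows "openin zariski {x \<in> - {0}. proj_point x \<in> W}" "{x \<in> - {0}. proj_point x \<in> W} \<noteq> {}"
  using assms unfolding openin_P2 by auto

text \<open>Lift and forms are proportional on a common open set, and the minors vanish identically
  once they vanish there. So a local lift can be compared with \<open>H\<close> even at base points
  of \<open>H\<close>.\<close>

lemma represented_by_lift_parallel:
  assumes \<phi>: "represented_by \<phi> H" "(U, g) \<in> \<phi>" "polynomial_map H"
    and V: "openin zariski V" "V \<noteq> {}" "polynomial_map a"
      "\<And>x. x \<in> V \<Longrightarrow> x \<noteq> 0 \<and> a x \<noteq> 0 \<and> g (proj_point x) = proj_point (a x)"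
  shows "parallel (a x) (H x)"
proof -
  obtain W where W: "openin (zar P2) W" "W \<noteq> {}" "W \<subseteq> U"
    "\<And>x. x \<noteq> 0 \<Longrightarrow> proj_point x \<in> W \<Longrightarrow> H x \<noteq> 0 \<and> g (proj_point x) = proj_point (H x)"
    by (rule represented_byD[OF \<phi>(1,2)]) (rule that)
  note c = cone_open[OF W(1,2)]
  show ?thesis
  proof (rule parallel_on_open[OF _ _ V(3) \<phi>(3)])
    show "openin zariski (V \<inter> {x \<in> - {0}. proj_point x \<in> W})" using V c by (intro openin_Int)
    show "V \<inter> {x \<in> - {0}. proj_point x \<in> W} \<noteq> {}" by (rule zariski_opens_meet[OF V(1) c(1) V(2) c(2)])
    fix x assume "x \<in> V \<inter> {x \<in> - {0}. proj_point x \<in> W}"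
    then have "a x \<noteq> 0" "H x \<noteq> 0" "proj_point (a x) = proj_point (H x)" using V(4)[of x] W(4)[of x] by auto
    then show "parallel (a x) (H x)" using proj_point_parallel by blast
  qed
qed

lemma fixed_point_parallel:
  assumes \<phi>: "represented_by \<phi> H" "(U, g) \<in> \<phi>" "polynomial_map H" and pm: "(U, g) \<in> partial_morphisms P2 P2"
    and x: "x \<noteq> 0" "proj_point x \<in> U" "g (proj_point x) = proj_point x"
  shows "parallel x (H x)"
proof -
  obtain V a where V: "openin zariski V" "x \<in> V" "V \<subseteq> - {0}" "polynomial_map a"
    "\<And>x. x \<in> V \<Longrightarrow> proj_point x \<in> U \<and> a x \<noteq> 0 \<and> g (proj_point x) = proj_point (a x)"
    using local_lift_P2_P2[OF pm x(1,2)] by blast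
  have "parallel (a x) (H x)"
    by (rule represented_by_lift_parallel[OF \<phi> V(1) _ V(4)]) (use V in auto)
  moreover have "proj_point (a x) = proj_point x" using V(5)[OF V(2)] x(3) by simp
  then obtain t where "t \<noteq> 0" "x = t *s a x" unfolding proj_point_eq_iff by blast
  ultimately show ?thesis using parallel_scale(1) by metis
qed

text \<open>For a local lift \<open>a\<close> of \<open>\<psi>\<close>, the identity
  \<open>\<phi> \<circ> \<psi> = id\<close> makes \<open>H (a y)\<close> parallel to
  \<open>y\<close> generically, hence everywhere. At a fixed point \<open>a x\<close> is a multiple
  of \<open>x\<close>, and homogeneity of \<open>H\<close> removes the factor. In this way the forms
  of a positive power detect the fixed points of the negative one.\<close>

lemma inverse_fixed_point_parallel:
  assumes \<phi>: "represented_by \<phi> H" "polynomial_map H" "\<And>t x. H (t *s x) = t ^ d *s H x"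
    and \<psi>: "\<psi> \<in> carrier (Bir P2)" "rat_comp P2 P2 \<phi> \<psi> = rat_id P2" "(U, g) \<in> \<psi>"
    and x: "x \<noteq> 0" "proj_point x \<in> U" "g (proj_point x) = proj_point x"
  shows "parallel x (H x)"
proof -
  note i = irreducible_space_P2
  note pm = Bir_dominant(1)[OF \<psi>(1,3)]
  have rm: "\<psi> \<in> rational_maps P2 P2" using \<psi>(1) by (auto simp: Bir_def birational_inverses_def)
  obtain U1 g1 V1 h1 where 1: "(U1, g1) \<in> \<psi>" "(V1, h1) \<in> \<phi>"
    "\<forall>y\<in>U1 \<inter> points P2. g1 y \<in> V1 \<longrightarrow> h1 (g1 y) = y"
    using rat_comp_eq_idD[OF i \<psi>(2)] by blast
  obtain W where W: "openin (zar P2) W" "W \<noteq> {}" "W \<subseteq> V1"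
    "\<And>x. x \<noteq> 0 \<Longrightarrow> proj_point x \<in> W \<Longrightarrow> H x \<noteq> 0 \<and> h1 (proj_point x) = proj_point (H x)"
    by (rule represented_byD[OF \<phi>(1) 1(2)]) (rule that)
  note pre = dominant_preimage[OF i Bir_dominant[OF \<psi>(1) 1(1)] W(1,2)]
  obtain A where A: "openin (zar P2) A" "A \<noteq> {}" "\<forall>x\<in>U \<inter> U1 \<inter> A. g x = g1 x"
    using rational_maps_agree[OF i rm \<psi>(3) 1(1)] by blast
  obtain V a where V: "openin zariski V" "x \<in> V" "V \<subseteq> - {0}" "polynomial_map a"
    "\<And>x. x \<in> V \<Longrightarrow> proj_point x \<in> U \<and> a x \<noteq> 0 \<and> g (proj_point x) = proj_point (a x)"
    using local_lift_P2_P2[OF pm x(1,2)] by blast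
  let ?W = "{x \<in> U1. g1 x \<in> W} \<inter> A"
  have "openin (zar P2) ?W" "?W \<noteq> {}"
    by (rule openin_Int[OF pre(1) A(1)], rule P2_opens_meet[OF pre(1) A(1) pre(2) A(2)])
  note c = cone_open[OF this]
  have par: "parallel y (H (a y))" for y
  proof (rule parallel_on_open[where a = "\<lambda>y. y" and b = "\<lambda>y. H (a y)"])
    show "openin zariski (V \<inter> {x \<in> - {0}. proj_point x \<in> ?W})" using V c by (intro openin_Int)
    show "V \<inter> {x \<in> - {0}. proj_point x \<in> ?W} \<noteq> {}" by (rule zariski_opens_meet[OF V(1) c(1) _ c(2)]) (use V in auto)
    show "polynomial_map (\<lambda>y :: complex^3. y)" by (simp add: polynomial_map_def polynomial_fun.coord)
    show "polynomial_map (\<lambda>y. H (a y))" by (rule polynomial_map_comp[OF \<phi>(2) V(4)])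
    fix y assume y: "y \<in> V \<inter> {x \<in> - {0}. proj_point x \<in> ?W}"
    then have "a y \<noteq> 0" "g1 (proj_point y) = proj_point (a y)" "proj_point y \<in> U1" "y \<noteq> 0"
      using V(5)[of y] A(3) by auto
    moreover from this have "proj_point (a y) \<in> W" using y by auto
    ultimately have "H (a y) \<noteq> 0" "proj_point (H (a y)) = proj_point y"
      using W(3) W(4)[of "a y"] 1(3)[rule_format, of "proj_point y"] by (auto simp: points_P2)
    then show "parallel y (H (a y))" using proj_point_parallel \<open>y \<noteq> 0\<close> by metis
  qed
  have "proj_point x = proj_point (a x)" using V(5)[OF V(2)] x(3) by simp
  then obtain t where t: "t \<noteq> 0" "a x = t *s x" unfolding proj_point_eq_iff by blast
  show ?thesis using par[of x] t by (simp add: \<phi>(3) parallel_scale)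
qed

section \<open>Closed subsets and curves in the plane\<close>

lemma irreducible_subset_finite_Union:
  assumes "finite A" "irreducible_subset T C" "\<And>B. B \<in> A \<Longrightarrow> closedin T B" "C \<subseteq> \<Union>A"
  shows "\<exists>B\<in>A. C \<subseteq> B"
  using assms
proof (induction A rule: finite_induct)
  case empty
  then show ?case by (simp add: irreducible_subset_def)
next
  case (insert B A)
  have "closedin T (\<Union>A)" using insert by (intro closedin_Union) auto
  then have "C \<subseteq> B \<or> C \<subseteq> \<Union>A"
    using insert.prems unfolding irreducible_subset_def by auto
  then show ?case using insert by auto
qed

lemma closedin_P2:
  assumes "Z \<subseteq> proj_point ` (- {0})" "openin zariski {x \<in> - {0}. proj_point x \<notin> Z}"
  shows "closedin (zar P2) Z"
proof -
  have "{x \<in> - {0}. proj_point x \<in> proj_point ` (- {0}) - Z} = {x \<in> - {0}. proj_point x \<notin> Z}" by auto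
  then have "openin (zar P2) (points P2 - Z)" unfolding points_P2 openin_P2 using assms(2) by auto
  then show ?thesis using assms(1) by (simp add: closedin_def points_P2)
qed

lemma closedin_parallel:
  assumes "polynomial_map H" "\<And>t x. H (t *s x) = t ^ d *s H x"
  shows "closedin (zar P2) {proj_point x |x. x \<noteq> 0 \<and> parallel x (H x)}"
proof (rule closedin_P2)
  let ?Z = "{proj_point x |x. x \<noteq> 0 \<and> parallel x (H x)}"
  show "?Z \<subseteq> proj_point ` (- {0})" by auto
  have mem: "proj_point x \<in> ?Z \<longleftrightarrow> parallel x (H x)" if x: "x \<noteq> 0" for x
  proof
    assume "proj_point x \<in> ?Z"
    then obtain y where "proj_point x = proj_point y" "parallel y (H y)" by auto
    then show "parallel x (H x)" unfolding proj_point_eq_iff by (auto simp: assms(2) parallel_scale)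
  qed (use x in blast)
  have "openin zariski (- {0} \<inter> {x. \<not> parallel x (H x)})"
  proof (rule openin_Int[OF openin_zariski_nonzero_vec])
    show "openin zariski {x. \<not> parallel x (H x)}"
      unfolding openin_zariski_iff
    proof
      fix x assume "x \<in> {x. \<not> parallel x (H x)}"
      then obtain i j where "x $ i * H x $ j \<noteq> x $ j * H x $ i" by (auto simp: parallel_def)
      then show "\<exists>p. polynomial_fun p \<and> p x \<noteq> 0 \<and> (\<forall>y. p y \<noteq> 0 \<longrightarrow> y \<in> {x. \<not> parallel x (H x)})"
        using assms(1) by (intro exI[of _ "\<lambda>x. x $ i * H x $ j - x $ j * H x $ i"])
          (auto simp: parallel_def polynomial_map_def intro!: polynomial_fun_diff polynomial_fun.intros)
    qed
  qed
  moreover have "- {0} \<inter> {x. \<not> parallel x (H x)} = {x \<in> - {0}. proj_point x \<notin> ?Z}" using mem by auto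
  ultimately show "openin zariski {x \<in> - {0}. proj_point x \<notin> ?Z}" by simp
qed

lemma closedin_line:
  "closedin (zar P2) {proj_point x |x. x \<noteq> 0 \<and> a * x $ 1 + b * x $ 2 + c * x $ 3 = 0}"
proof (rule closedin_P2)
  let ?l = "\<lambda>x :: complex^3. a * x $ 1 + b * x $ 2 + c * x $ 3"
  let ?Z = "{proj_point x |x. x \<noteq> 0 \<and> ?l x = 0}"
  show "?Z \<subseteq> proj_point ` (- {0})" by auto
  have sc: "?l (t *s x) = t * ?l x" for t x by (simp add: algebra_simps)
  have "proj_point x \<in> ?Z \<longleftrightarrow> ?l x = 0" if x: "x \<noteq> 0" for x
  proof
    assume "proj_point x \<in> ?Z"
    then obtain y where y: "proj_point y = proj_point x" "?l y = 0" by auto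
    then obtain t where "x = t *s y" unfolding proj_point_eq_iff by blast
    then show "?l x = 0" using sc y(2) by simp
  qed (use x in blast)
  then have "{x \<in> - {0}. proj_point x \<notin> ?Z} = - {0} \<inter> {x. ?l x \<noteq> 0}" by auto
  moreover have "openin zariski (- {0} \<inter> {x. ?l x \<noteq> 0})"
    by (intro openin_Int openin_zariski_nonzero_vec openin_zariski_nonzero polynomial_fun.intros)
  ultimately show "openin zariski {x \<in> - {0}. proj_point x \<notin> ?Z}" by simp
qed

lemma closedin_P2_point: "x \<noteq> 0 \<Longrightarrow> closedin (zar P2) {proj_point x}"
proof (rule closedin_P2)
  assume x: "x \<noteq> 0"
  then show "{proj_point x} \<subseteq> proj_point ` (- {0})" by auto
  have "{y \<in> - {0}. proj_point y \<notin> {proj_point x}} = - {0} \<inter> {y. \<not> parallel x y}"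
    using proj_point_parallel[OF x] by auto
  moreover have "openin zariski {y. \<not> parallel x y}"
    unfolding openin_zariski_iff
  proof
    fix z assume "z \<in> {y. \<not> parallel x y}"
    then obtain i j where "x $ i * z $ j \<noteq> x $ j * z $ i" by (auto simp: parallel_def)
    then show "\<exists>p. polynomial_fun p \<and> p z \<noteq> 0 \<and> (\<forall>y. p y \<noteq> 0 \<longrightarrow> y \<in> {y. \<not> parallel x y})"
      by (intro exI[of _ "\<lambda>z. x $ i * z $ j - x $ j * z $ i"])
        (auto simp: parallel_def intro!: polynomial_fun_diff polynomial_fun.intros)
  qed
  ultimately show "openin zariski {y \<in> - {0}. proj_point y \<notin> {proj_point x}}"
    using openin_Int[OF openin_zariski_nonzero_vec] by simp
qed

text \<open>Points are closed, so a finite irreducible set is a single point and admits no chain of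
  length one.\<close>

lemma finite_not_curve:
  assumes C: "curve_in P2 C" "finite C"
  shows False
proof -
  have irr: "irreducible_subset (zar P2) C" and dim: "krull_dim (zar P2) C = 1"
    using C(1) by (auto simp: curve_in_def)
  have sub: "C \<subseteq> proj_point ` (- {0})" using irr by (auto simp: irreducible_subset_def points_P2)
  have "\<exists>B\<in>(\<lambda>s. {s}) ` C. C \<subseteq> B"
    by (rule irreducible_subset_finite_Union[OF _ irr]) (use C(2) sub closedin_P2_point in auto)
  then obtain s where s: "C \<subseteq> {s}" by blast
  have "krull_dim (zar P2) C \<le> 0"
    unfolding krull_dim_def
  proof (rule Sup_least)
    fix e assume "e \<in> {enat n |n. \<exists>Z :: nat \<Rightarrow> (complex^3) set set.
      (\<forall>i\<le>n. closedin (zar P2) (Z i) \<and> irreducible_subset (zar P2) (Z i) \<and> Z i \<subseteq> C) \<and> (\<forall>i<n. Z i \<subset> Z (Suc i))}"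
    then obtain n and Z :: "nat \<Rightarrow> (complex^3) set set" where e: "e = enat n"
      and Z: "\<And>i. i \<le> n \<Longrightarrow> irreducible_subset (zar P2) (Z i) \<and> Z i \<subseteq> C" "\<And>i. i < n \<Longrightarrow> Z i \<subset> Z (Suc i)" by blast
    have "n = 0"
    proof (rule ccontr)
      assume "n \<noteq> 0"
      then have "Z 0 \<noteq> {}" "Z 1 \<subseteq> {s}" "Z 0 \<subset> Z 1"
        using Z(1)[of 0] Z(1)[of 1] Z(2)[of 0] s by (auto simp: irreducible_subset_def)
      then show False by auto
    qed
    then show "e \<le> 0" using e by (simp add: zero_enat_def)
  qed
  then show False using dim by simp
qed

text \<open>The line is parametrized by \<open>b + t v\<close>, missing only the point of
  \<open>v\<close>. A polynomial that is nonzero at \<open>b\<close> and vanishes on the cone over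
  \<open>C\<close> restricts to a nonzero polynomial in \<open>t\<close>, which has finitely many
  roots.\<close>

lemma finite_in_line:
  fixes v b :: "complex^3"
  assumes C: "closedin (zar P2) C" "proj_point b \<notin> C" "b \<noteq> 0"
    and M: "\<And>s. s \<in> C \<Longrightarrow> \<exists>\<alpha> \<beta>. \<alpha> *s v + \<beta> *s b \<noteq> 0 \<and> s = proj_point (\<alpha> *s v + \<beta> *s b)"
  shows "finite C"
proof -
  have "openin (zar P2) (points P2 - C)" using C(1) by (simp add: closedin_def)
  then have "openin zariski {x \<in> - {0}. proj_point x \<in> points P2 - C}" unfolding openin_P2 by blast
  moreover have "b \<in> {x \<in> - {0}. proj_point x \<in> points P2 - C}" using C by (simp add: points_P2)
  ultimately obtain p where p: "polynomial_fun p" "p b \<noteq> 0"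
    "\<And>y. p y \<noteq> 0 \<Longrightarrow> y \<in> {x \<in> - {0}. proj_point x \<in> points P2 - C}"
    unfolding openin_zariski_iff by blast
  obtain P where P: "\<forall>t. p (b + t *s v) = poly P t" using polynomial_fun_line[OF p(1)] by blast
  have "poly P 0 \<noteq> 0" using P[rule_format, of 0, symmetric] p(2) by simp
  then have "P \<noteq> 0" by auto
  have "C \<subseteq> insert (proj_point v) ((\<lambda>t. proj_point (b + t *s v)) ` {t. poly P t = 0})"
  proof
    fix s assume s: "s \<in> C"
    then obtain \<alpha> \<beta> where ab: "\<alpha> *s v + \<beta> *s b \<noteq> 0" "s = proj_point (\<alpha> *s v + \<beta> *s b)" using M by blast
    show "s \<in> insert (proj_point v) ((\<lambda>t. proj_point (b + t *s v)) ` {t. poly P t = 0})"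
    proof (cases "\<beta> = 0")
      case True
      then have "\<alpha> \<noteq> 0" using ab(1) by auto
      then have "proj_point v = s" unfolding ab(2) proj_point_eq_iff using True by (intro exI[of _ \<alpha>]) simp
      then show ?thesis by simp
    next
      case False
      have eq: "\<alpha> *s v + \<beta> *s b = \<beta> *s (b + (\<alpha> / \<beta>) *s v)"
        using False by (simp add: vec_eq_iff field_simps)
      have s': "s = proj_point (b + (\<alpha> / \<beta>) *s v)"
        unfolding ab(2) eq by (subst eq_commute) (use False in \<open>auto simp: proj_point_eq_iff\<close>)
      then have "p (b + (\<alpha> / \<beta>) *s v) = 0" using p(3) s by auto
      then show ?thesis using s' P by auto
    qed
  qed
  then show ?thesis using poly_roots_finite[OF \<open>P \<noteq> 0\<close>] finite_subset by blast
qed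

lemma no_fixed_curve:
  assumes R: "fixed_resultant c n 5 \<noteq> 0" and C: "curve_in P2 C"
    and fx: "C \<subseteq> {proj_point x |x. x \<noteq> 0 \<and> parallel x (quadratic_iterate c n x)}"
  shows False
proof -
  let ?F = "quadratic_iterate c n"
  let ?line = "\<lambda>\<kappa>. {proj_point x |x :: complex^3. x \<noteq> 0 \<and> 1 * x $ 1 + 1 * x $ 2 + (- \<kappa>) * x $ 3 = 0}"
  let ?inf = "{proj_point x |x :: complex^3. x \<noteq> 0 \<and> 0 * x $ 1 + 0 * x $ 2 + 1 * x $ 3 = 0}"
  let ?K = "{\<kappa>. fixed_resultant c n \<kappa> = 0}"
  have irr: "irreducible_subset (zar P2) C" and cl: "closedin (zar P2) C" using C by (auto simp: curve_in_def)
  have "C \<subseteq> \<Union>(insert ?inf (?line ` ?K))"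
  proof
    fix s assume "s \<in> C"
    then obtain x where x: "s = proj_point x" "x \<noteq> 0" "parallel x (?F x)" using fx by blast
    show "s \<in> \<Union>(insert ?inf (?line ` ?K))"
    proof (cases "x $ 3 = 0")
      case True
      then have "s \<in> ?inf" using x by auto
      then show ?thesis by blast
    next
      case False
      let ?\<kappa> = "(x $ 1 + x $ 2) / x $ 3"
      have e: "x $ 1 + x $ 2 = ?\<kappa> * x $ 3" using False by simp
      have "fixed_resultant c n ?\<kappa> = 0" using fixed_resultant_no_fixed_point[OF _ x(2) e] x(3) by blast
      moreover have "s \<in> ?line ?\<kappa>" using x e by force
      ultimately show ?thesis by blast
    qed
  qed
  moreover have "finite (insert ?inf (?line ` ?K))" using finite_fixed_resultant_roots[OF R] by simp
  moreover have "closedin (zar P2) B" if "B \<in> insert ?inf (?line ` ?K)" for B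
    using that by (elim insertE imageE) (simp_all only: closedin_line)
  ultimately have "\<exists>B\<in>insert ?inf (?line ` ?K). C \<subseteq> B"
    using irreducible_subset_finite_Union[OF _ irr] by blast
  \<comment> \<open>Each of the lines contains \<open>[1:-1:0]\<close>, so it is spanned by this
    vector and one other vector \<open>v\<close>.\<close>
  then obtain v :: "complex^3" where v: "\<And>s. s \<in> C \<Longrightarrow> \<exists>\<alpha> \<beta>. \<alpha> *s v + \<beta> *s vector [1, -1, 0] \<noteq> 0 \<and>
      s = proj_point (\<alpha> *s v + \<beta> *s vector [1, -1, 0])"
  proof (elim bexE insertE imageE)
    fix B assume B: "C \<subseteq> B" "B = ?inf"
    show ?thesis
    proof (rule that[of "vector [0, 1, 0]"])
      fix s assume "s \<in> C"
      then obtain x :: "complex^3" where x: "s = proj_point x" "x \<noteq> 0" "x $ 3 = 0" using B by auto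
      have "(x $ 1 + x $ 2) *s vector [0, 1, 0] + x $ 1 *s vector [1, -1, 0] = x"
        using x(3) by (simp add: vec_eq_iff forall_3)
      then show "\<exists>\<alpha> \<beta>. \<alpha> *s vector [0, 1, 0] + \<beta> *s vector [1, -1, 0] \<noteq> (0 :: complex^3) \<and>
          s = proj_point (\<alpha> *s vector [0, 1, 0] + \<beta> *s vector [1, -1, 0])" using x by metis
    qed
  next
    fix B \<kappa> assume B: "C \<subseteq> B" "B = ?line \<kappa>"
    show ?thesis
    proof (rule that[of "vector [\<kappa>, 0, 1]"])
      fix s assume "s \<in> C"
      then obtain x :: "complex^3" where x: "s = proj_point x" "x \<noteq> 0" "x $ 1 + x $ 2 - \<kappa> * x $ 3 = 0" using B by auto
      have "x $ 2 = \<kappa> * x $ 3 - x $ 1" using x(3) by (simp add: eq_diff_eq add.commute)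
      then have "x $ 3 *s vector [\<kappa>, 0, 1] + (x $ 1 - \<kappa> * x $ 3) *s vector [1, -1, 0] = x"
        by (simp add: vec_eq_iff forall_3 mult.commute)
      then show "\<exists>\<alpha> \<beta>. \<alpha> *s vector [\<kappa>, 0, 1] + \<beta> *s vector [1, -1, 0] \<noteq> (0 :: complex^3) \<and>
          s = proj_point (\<alpha> *s vector [\<kappa>, 0, 1] + \<beta> *s vector [1, -1, 0])" using x by metis
    qed
  qed
  let ?b = "vector [1, -1, 0] :: complex^3"
  have "?b $ 1 \<noteq> (0 :: complex^3) $ 1" by simp
  then have b0: "?b \<noteq> 0" by (rule contrapos_nn) (simp only:)
  \<comment> \<open>The base point of the pencil also lies on the line with
    \<open>\<kappa> = 5\<close>, whose resultant is nonzero.\<close>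
  have "proj_point ?b \<notin> C"
  proof
    assume "proj_point ?b \<in> C"
    then obtain x where x: "proj_point x = proj_point ?b" "x \<noteq> 0" "parallel x (?F x)" using fx by auto
    then obtain t where t: "t \<noteq> 0" "?b = t *s x" unfolding proj_point_eq_iff by blast
    have "parallel ?b (?F ?b)" unfolding t(2) using t(1) x(3) by (simp add: quadratic_iterate_scale parallel_scale)
    moreover have "?b $ 1 + ?b $ 2 = 5 * ?b $ 3" by simp
    ultimately show False using fixed_resultant_no_fixed_point[OF R b0] by blast
  qed
  then have "finite C" by (rule finite_in_line[OF cl _ b0 v])
  then show False using finite_not_curve[OF C] by blast
qed

section \<open>Conjugation to automorphism groups\<close>

lemma polynomial_map_deg_le:
  fixes g :: "complex^'n \<Rightarrow> complex^'m"
  assumes "polynomial_map g"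
  shows "\<exists>d. \<forall>i. poly_deg_le d (\<lambda>x. g x $ i)"
proof -
  have "\<forall>i. \<exists>d. poly_deg_le d (\<lambda>x. g x $ i)"
    using assms polynomial_fun_poly_deg_le by (auto simp: polynomial_map_def)
  from choice[OF this] obtain d where d: "\<And>i. poly_deg_le (d i) (\<lambda>x. g x $ i)" by blast
  have "poly_deg_le (\<Sum>i\<in>UNIV. d i) (\<lambda>x. g x $ i)" for i
    by (rule poly_deg_le_mono[OF d]) (rule member_le_sum, auto)
  then show ?thesis by blast
qed

lemma polynomial_map_of_deg_le: "(\<And>i. poly_deg_le d (\<lambda>x. g x $ i)) \<Longrightarrow> polynomial_map g"
  using poly_deg_le_polynomial_fun by (auto simp: polynomial_map_def)

lemma morphism_partial_morphism:
  assumes X: "irreducible_space X" and f: "morphism X X f"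
  shows "(points X, f) \<in> partial_morphisms X X"
  unfolding partial_morphisms_iff[OF X]
  using f irreducible_spaceD(1)[OF X] by (auto simp: morphism_def continuous_map)

text \<open>If all \<open>\<phi> n\<close> become automorphisms of bounded degree after conjugation with \<open>\<Phi>\<close>, their
  representatives \<open>\<Psi> \<circ> G\<^sub>n \<circ> \<Phi>\<close> have bounded degree. The map \<open>\<tau>\<close> moves a point along its fibre
  to ensure that this representative does not vanish identically.\<close>

lemma not_conjugate_to_automorphisms:
  fixes X :: "(complex^'n) set" and \<pi> :: "complex^'n \<Rightarrow> 'b"
  assumes L: "liftable X \<pi>"
    and fibres: "\<And>x x'. x \<in> X \<Longrightarrow> x' \<in> X \<Longrightarrow> \<pi> x = \<pi> x' \<Longrightarrow> \<exists>\<tau>. (\<forall>i. poly_deg_le 1 (\<lambda>z. \<tau> z $ i)) \<and>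
        \<tau> x = x' \<and> (\<forall>z\<in>X. \<tau> z \<in> X \<and> \<pi> (\<tau> z) = \<pi> z)"
    and aut: "\<And>f g. inverse_morphisms (quot X \<pi>) f g \<Longrightarrow> \<exists>G. (\<forall>i. poly_deg_le D (\<lambda>x. G x $ i)) \<and>
        (\<forall>x\<in>X. G x \<in> X \<and> f (\<pi> x) = \<pi> (G x))"
    and \<phi>: "\<And>n. \<phi> n \<in> G" "\<And>n. \<phi> n \<in> carrier (Bir P2)" "\<And>n. represented_by (\<phi> n) (F n)" "\<And>n. polynomial_map (F n)"
    and deg: "\<And>n K g y0. (\<And>i. poly_deg_le K (\<lambda>x. g x $ i)) \<Longrightarrow> (\<And>x. parallel (g x) (F n x)) \<Longrightarrow> g y0 \<noteq> 0 \<Longrightarrow> n \<le> K"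
  shows "\<not> conjugate_to_automorphisms G (quot X \<pi>)"
proof
  let ?S = "quot X \<pi>"
  note oX = liftable_open[OF L]
  note iP = irreducible_space_P2 and iS = irreducible_space_quotient[OF oX, of \<pi>]
  have pS: "points ?S = \<pi> ` X" by (rule points_quotient_variety[OF oX(1)])
  assume "conjugate_to_automorphisms G ?S"
  then obtain \<Phi> \<Psi> where b: "birational_inverses P2 ?S \<Phi> \<Psi>"
    and conj: "\<And>g. g \<in> G \<Longrightarrow> rat_comp ?S ?S \<Phi> (rat_comp ?S P2 g \<Psi>) \<in> Aut ?S"
    unfolding conjugate_to_automorphisms_def birationally_conjugate_def by blast
  have r\<Phi>: "\<Phi> \<in> rational_maps P2 ?S" and r\<Psi>: "\<Psi> \<in> rational_maps ?S P2" and id: "rat_comp P2 P2 \<Psi> \<Phi> = rat_id P2"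
    using b by (auto simp: birational_inverses_def)
  obtain U2 f2 V2 p2 where 2: "(U2, f2) \<in> \<Phi>" "(V2, p2) \<in> \<Psi>"
    "\<forall>y\<in>U2 \<inter> points P2. f2 y \<in> V2 \<longrightarrow> p2 (f2 y) = y"
    using rat_comp_eq_idD[OF iP id] by blast
  note f2 = rational_maps_partial_morphisms[OF r\<Phi> 2(1)] and p2 = rational_maps_partial_morphisms[OF r\<Psi> 2(2)]
  note Df = partial_morphismsD[OF iP f2] and Dp = partial_morphismsD[OF iS p2]
  have domf: "dominant_map ?S U2 f2" by (rule birational_inverses_dominant[OF iP iS b 2(1)])
  obtain x1 where x1: "x1 \<noteq> 0" "proj_point x1 \<in> U2" using Df(2,4) unfolding points_P2 by blast
  obtain V\<^sub>\<Phi> l\<^sub>\<Phi> where l\<Phi>: "openin zariski V\<^sub>\<Phi>" "x1 \<in> V\<^sub>\<Phi>" "V\<^sub>\<Phi> \<subseteq> - {0}" "polynomial_map l\<^sub>\<Phi>"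
    "\<And>x. x \<in> V\<^sub>\<Phi> \<Longrightarrow> proj_point x \<in> U2 \<and> l\<^sub>\<Phi> x \<in> X \<and> f2 (proj_point x) = \<pi> (l\<^sub>\<Phi> x)"
    using local_lift_P2[OF L f2 x1] by blast
  have liftp: "\<exists>V l. openin zariski V \<and> x \<in> V \<and> V \<subseteq> X \<and> polynomial_map l \<and>
      (\<forall>x\<in>V. \<pi> x \<in> V2 \<and> l x \<noteq> 0 \<and> p2 (\<pi> x) = proj_point (l x))" if "x \<in> X" "\<pi> x \<in> V2" for x
  proof -
    have "(V2, p2) \<in> partial_morphisms ?S (quot (- {0 :: complex^3}) proj_point)"
      using p2 by (simp only: P2_quotient)
    from local_lift[OF liftable_proj_point oX this that] show ?thesis by simp
  qed
  obtain x2 where x2: "x2 \<in> X" "\<pi> x2 \<in> V2" using Dp(2,4) unfolding pS by blast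
  obtain V\<^sub>\<Psi> l\<^sub>\<Psi> where l\<Psi>: "openin zariski V\<^sub>\<Psi>" "x2 \<in> V\<^sub>\<Psi>" "V\<^sub>\<Psi> \<subseteq> X" "polynomial_map l\<^sub>\<Psi>"
    "\<And>x. x \<in> V\<^sub>\<Psi> \<Longrightarrow> \<pi> x \<in> V2 \<and> l\<^sub>\<Psi> x \<noteq> 0 \<and> p2 (\<pi> x) = proj_point (l\<^sub>\<Psi> x)"
    using liftp[OF x2] by blast
  obtain d1 where d1: "\<And>i. poly_deg_le d1 (\<lambda>x. l\<^sub>\<Phi> x $ i)" using polynomial_map_deg_le[OF l\<Phi>(4)] by blast
  obtain d2 where d2: "\<And>i. poly_deg_le d2 (\<lambda>x. l\<^sub>\<Psi> x $ i)" using polynomial_map_deg_le[OF l\<Psi>(4)] by blast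
  \<comment> \<open>A bound for the degree of \<open>g\<close> below; the factor 1 belongs to the
    motion \<open>\<tau>\<close> along the fibre. It does not depend on \<open>n\<close>, so
    \<open>n\<close> can be taken larger.\<close>
  define K where "K = d2 * (1 * (D * d1))"
  define n where "n = Suc K"
  obtain \<alpha> \<beta> where \<alpha>: "rat_comp ?S ?S \<Phi> (rat_comp ?S P2 (\<phi> n) \<Psi>) = rat_class ?S ?S (points ?S) \<alpha>"
    "morphism ?S ?S \<alpha>" "morphism ?S ?S \<beta>" "\<forall>x\<in>points ?S. \<beta> (\<alpha> x) = x \<and> \<alpha> (\<beta> x) = x"
    using conj[OF \<phi>(1)[of n]] unfolding Aut_def by auto
  note pm\<alpha> = morphism_partial_morphism[OF iS \<alpha>(2)]
  have "inverse_morphisms ?S \<alpha> \<beta>"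
    unfolding inverse_morphisms_def using pm\<alpha> morphism_partial_morphism[OF iS \<alpha>(3)] \<alpha>(4) by blast
  from aut[OF this] obtain A where A: "\<And>i. poly_deg_le D (\<lambda>x. A x $ i)"
    "\<And>x. x \<in> X \<Longrightarrow> A x \<in> X \<and> \<alpha> (\<pi> x) = \<pi> (A x)" by blast
  have "(points ?S, \<alpha>) \<in> rat_comp ?S ?S \<Phi> (rat_comp ?S P2 (\<phi> n) \<Psi>)"
    unfolding \<alpha>(1) by (rule rat_class_mem[OF pm\<alpha>])
  then obtain U u V v where uv: "(U, u) \<in> rat_comp ?S P2 (\<phi> n) \<Psi>" "(V, v) \<in> \<Phi>"
    "\<forall>x\<in>U \<inter> points ?S. u x \<in> V \<longrightarrow> \<alpha> x = v (u x)"
    unfolding rat_comp_def[of ?S ?S] by blast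
  then obtain U1 p V1 h where ph: "(U, u) \<in> partial_morphisms ?S P2" "(U1, p) \<in> \<Psi>" "(V1, h) \<in> \<phi> n"
    "\<forall>x\<in>U1 \<inter> U. p x \<in> V1 \<longrightarrow> u x = h (p x)"
    unfolding rat_comp_def by blast
  note Du = partial_morphismsD[OF iS ph(1)]
  note Dv = partial_morphismsD[OF iP rational_maps_partial_morphisms[OF r\<Phi> uv(2)]]
  note Dp1 = partial_morphismsD[OF iS rational_maps_partial_morphisms[OF r\<Psi> ph(2)]]
  obtain A1 where A1: "openin (zar ?S) A1" "A1 \<noteq> {}" "\<forall>x\<in>U1 \<inter> V2 \<inter> A1. p x = p2 x"
    using rational_maps_agree[OF iS r\<Psi> ph(2) 2(2)] by blast
  obtain A2 where A2: "openin (zar P2) A2" "A2 \<noteq> {}" "\<forall>x\<in>V \<inter> U2 \<inter> A2. v x = f2 x"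
    using rational_maps_agree[OF iP r\<Phi> uv(2) 2(1)] by blast
  obtain W where W: "openin (zar P2) W" "W \<noteq> {}" "W \<subseteq> V1"
    "\<And>x. x \<noteq> 0 \<Longrightarrow> proj_point x \<in> W \<Longrightarrow> F n x \<noteq> 0 \<and> h (proj_point x) = proj_point (F n x)"
    by (rule represented_byD[OF \<phi>(3) ph(3)]) (rule that)
  \<comment> \<open>The saturation of \<open>V\<^sub>\<Psi>\<close> is open because it is covered by
    preimages of \<open>V\<^sub>\<Psi>\<close> under the motions along the fibres.\<close>
  have O: "openin (zar ?S) (\<pi> ` V\<^sub>\<Psi>)" "\<pi> ` V\<^sub>\<Psi> \<noteq> {}"
  proof -
    show "\<pi> ` V\<^sub>\<Psi> \<noteq> {}" using l\<Psi>(2) by blast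
    have "openin zariski {x \<in> X. \<pi> x \<in> \<pi> ` V\<^sub>\<Psi>}"
    proof (subst openin_subopen, intro ballI)
      fix x assume "x \<in> {x \<in> X. \<pi> x \<in> \<pi> ` V\<^sub>\<Psi>}"
      then obtain x' where x': "x \<in> X" "x' \<in> V\<^sub>\<Psi>" "\<pi> x = \<pi> x'" by blast
      then have "x' \<in> X" using l\<Psi>(3) by blast
      from fibres[OF x'(1) this x'(3)] obtain \<tau> where \<tau>: "\<And>i. poly_deg_le 1 (\<lambda>z. \<tau> z $ i)" "\<tau> x = x'"
        "\<And>z. z \<in> X \<Longrightarrow> \<tau> z \<in> X \<and> \<pi> (\<tau> z) = \<pi> z" by blast
      have "openin zariski (X \<inter> {z. \<tau> z \<in> V\<^sub>\<Psi>})"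
        by (rule openin_Int[OF oX(1) openin_zariski_vimage[OF l\<Psi>(1) polynomial_map_of_deg_le[OF \<tau>(1)]]])
      moreover have "x \<in> X \<inter> {z. \<tau> z \<in> V\<^sub>\<Psi>}" using x' \<tau>(2) by simp
      moreover have "X \<inter> {z. \<tau> z \<in> V\<^sub>\<Psi>} \<subseteq> {x \<in> X. \<pi> x \<in> \<pi> ` V\<^sub>\<Psi>}"
      proof
        fix z assume z: "z \<in> X \<inter> {z. \<tau> z \<in> V\<^sub>\<Psi>}"
        then have "\<pi> z = \<pi> (\<tau> z)" using \<tau>(3)[of z] by simp
        then show "z \<in> {x \<in> X. \<pi> x \<in> \<pi> ` V\<^sub>\<Psi>}" using z by blast
      qed
      ultimately show "\<exists>T. openin zariski T \<and> x \<in> T \<and> T \<subseteq> {x \<in> X. \<pi> x \<in> \<pi> ` V\<^sub>\<Psi>}" by blast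
    qed
    then show "openin (zar ?S) (\<pi> ` V\<^sub>\<Psi>)"
      unfolding openin_quotient_variety[OF oX(1)] using l\<Psi>(3) by blast
  qed
  \<comment> \<open>\<open>\<Omega>1\<close> collects the conditions on the image point,
    \<open>\<Omega>2\<close> those on the starting point, and \<open>\<Omega>3\<close> is the cone
    over \<open>\<Omega>2\<close> inside the domain of the lift. Dominance and irreducibility keep
    them nonempty.\<close>
  define \<Omega>1 where "\<Omega>1 = {w \<in> U2. f2 w \<in> \<pi> ` V\<^sub>\<Psi>} \<inter> (V \<inter> A2)"
  have VA: "openin (zar P2) (V \<inter> A2)" "V \<inter> A2 \<noteq> {}"
    by (rule openin_Int[OF Dv(1) A2(1)], rule P2_opens_meet[OF Dv(1) A2(1) Dv(2) A2(2)])
  note pre1 = dominant_preimage[OF iP f2 domf O]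
  have \<Omega>1: "openin (zar P2) \<Omega>1" "\<Omega>1 \<noteq> {}" unfolding \<Omega>1_def
    by (rule openin_Int[OF pre1(1) VA(1)], rule P2_opens_meet[OF pre1(1) VA(1) pre1(2) VA(2)])
  note S_meet = irreducible_spaceD(2)[OF iS]
  define O' where "O' = (V2 \<inter> U1) \<inter> (U \<inter> A1)"
  have a: "openin (zar ?S) (V2 \<inter> U1)" "V2 \<inter> U1 \<noteq> {}"
    by (rule openin_Int[OF Dp(1) Dp1(1)], rule S_meet[OF Dp(1) Dp1(1) Dp(2) Dp1(2)])
  have a': "openin (zar ?S) (U \<inter> A1)" "U \<inter> A1 \<noteq> {}"
    by (rule openin_Int[OF Du(1) A1(1)], rule S_meet[OF Du(1) A1(1) Du(2) A1(2)])
  have O': "openin (zar ?S) O'" "O' \<noteq> {}" unfolding O'_def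
    by (rule openin_Int[OF a(1) a'(1)], rule S_meet[OF a(1) a'(1) a(2) a'(2)])
  note pre2 = dominant_preimage[OF iP f2 domf O']
  note pre3 = dominant_preimage[OF iP Bir_dominant[OF \<phi>(2) ph(3)] \<Omega>1]
  define \<Omega>2 where "\<Omega>2 = ({t \<in> V1. h t \<in> \<Omega>1} \<inter> W) \<inter> {t \<in> U2. f2 t \<in> O'}"
  have c: "openin (zar P2) ({t \<in> V1. h t \<in> \<Omega>1} \<inter> W)" "{t \<in> V1. h t \<in> \<Omega>1} \<inter> W \<noteq> {}"
    by (rule openin_Int[OF pre3(1) W(1)], rule P2_opens_meet[OF pre3(1) W(1) pre3(2) W(2)])
  have \<Omega>2: "openin (zar P2) \<Omega>2" "\<Omega>2 \<noteq> {}" unfolding \<Omega>2_def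
    by (rule openin_Int[OF c(1) pre2(1)], rule P2_opens_meet[OF c(1) pre2(1) c(2) pre2(2)])
  define \<Omega>3 where "\<Omega>3 = V\<^sub>\<Phi> \<inter> {x \<in> - {0}. proj_point x \<in> \<Omega>2}"
  note cone = cone_open[OF \<Omega>2]
  have \<Omega>3: "openin zariski \<Omega>3" unfolding \<Omega>3_def by (rule openin_Int[OF l\<Phi>(1) cone(1)])
  have \<Omega>3_ne: "\<Omega>3 \<noteq> {}"
    unfolding \<Omega>3_def by (rule zariski_opens_meet[OF l\<Phi>(1) cone(1) _ cone(2)]) (use l\<Phi>(2) in blast)
  \<comment> \<open>On \<open>\<Omega>3\<close> the automorphism \<open>\<alpha>\<close> is followed
    through all representatives: \<open>p2\<close> sends the point
    \<open>\<pi> (A (l\<^sub>\<Phi> y))\<close> to the image under \<open>\<phi> n\<close>.\<close>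
  have key: "A (l\<^sub>\<Phi> y) \<in> X \<and> F n y \<noteq> 0 \<and> \<pi> (A (l\<^sub>\<Phi> y)) \<in> \<pi> ` V\<^sub>\<Psi> \<and> p2 (\<pi> (A (l\<^sub>\<Phi> y))) = proj_point (F n y)"
    if y: "y \<in> \<Omega>3" for y
  proof -
    define t where "t = proj_point y"
    define s where "s = f2 t"
    have y0: "y \<noteq> 0" "t \<in> \<Omega>2" "y \<in> V\<^sub>\<Phi>" using y by (auto simp: \<Omega>3_def t_def)
    have t: "t \<in> V1" "h t \<in> \<Omega>1" "t \<in> W" "t \<in> U2" "s \<in> O'" using y0(2) by (auto simp: \<Omega>2_def s_def)
    have s: "l\<^sub>\<Phi> y \<in> X" "s = \<pi> (l\<^sub>\<Phi> y)" using l\<Phi>(5)[OF y0(3)] by (auto simp: s_def t_def)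
    have sO: "s \<in> V2" "s \<in> U1" "s \<in> U" "s \<in> A1" using t(5) by (auto simp: O'_def)
    have "p s = p2 s" using A1(3) sO by blast
    also have "p2 s = t" using 2(3) t(4) sO(1) Df(4) unfolding s_def by blast
    finally have "u s = h t" using ph(4) sO t(1) by auto
    moreover have w: "F n y \<noteq> 0" "h t = proj_point (F n y)" using W(4)[OF y0(1)] t(3) by (auto simp: t_def)
    moreover have w': "h t \<in> U2" "f2 (h t) \<in> \<pi> ` V\<^sub>\<Psi>" "h t \<in> V" "h t \<in> A2" using t(2) by (auto simp: \<Omega>1_def)
    ultimately have "\<alpha> s = v (h t)" using uv(3) sO(3) Du(4) by auto
    also have "\<dots> = f2 (h t)" using A2(3) w' by blast
    finally have e: "\<pi> (A (l\<^sub>\<Phi> y)) = f2 (h t)" using A(2)[OF s(1)] s(2) by simp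
    have "f2 (h t) \<in> V2" using w'(2) l\<Psi>(5) by auto
    then have "p2 (f2 (h t)) = h t" using 2(3) w'(1) Df(4) by blast
    then show ?thesis using e w w' A(2)[OF s(1)] by simp
  qed
  obtain y0 where y0: "y0 \<in> \<Omega>3" using \<Omega>3_ne by blast
  obtain v0 where v0: "v0 \<in> V\<^sub>\<Psi>" "\<pi> (A (l\<^sub>\<Phi> y0)) = \<pi> v0" using key[OF y0] by blast
  have "A (l\<^sub>\<Phi> y0) \<in> X" "v0 \<in> X" using key[OF y0] v0(1) l\<Psi>(3) by auto
  from fibres[OF this v0(2)] obtain \<tau> where \<tau>: "\<And>i. poly_deg_le 1 (\<lambda>z. \<tau> z $ i)" "\<tau> (A (l\<^sub>\<Phi> y0)) = v0"
    "\<And>z. z \<in> X \<Longrightarrow> \<tau> z \<in> X \<and> \<pi> (\<tau> z) = \<pi> z" by blast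
  \<comment> \<open>The polynomial representative of \<open>\<phi> n\<close> of bounded degree. By
    the choice of \<open>\<tau>\<close> the argument of \<open>l\<^sub>\<Psi>\<close> at
    \<open>y0\<close> is \<open>v0\<close>, where this lift is nonzero.\<close>
  define g where "g y = l\<^sub>\<Psi> (\<tau> (A (l\<^sub>\<Phi> y)))" for y
  have gdeg: "poly_deg_le K (\<lambda>y. g y $ i)" for i
    unfolding g_def K_def by (intro poly_deg_le_comp[OF d2] poly_deg_le_comp[OF \<tau>(1)] poly_deg_le_comp[OF A(1)] d1)
  have "g y0 \<noteq> 0" using l\<Psi>(5)[OF v0(1)] \<tau>(2) by (simp add: g_def)
  moreover have "parallel (g y) (F n y)" for y
  proof (rule parallel_on_open[OF \<Omega>3 \<Omega>3_ne polynomial_map_of_deg_le[of K g, OF gdeg] \<phi>(4)])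
    fix y assume y: "y \<in> \<Omega>3"
    define z where "z = \<tau> (A (l\<^sub>\<Phi> y))"
    have k: "A (l\<^sub>\<Phi> y) \<in> X" "F n y \<noteq> 0" "\<pi> (A (l\<^sub>\<Phi> y)) \<in> \<pi> ` V\<^sub>\<Psi>" "p2 (\<pi> (A (l\<^sub>\<Phi> y))) = proj_point (F n y)"
      using key[OF y] by auto
    have z: "z \<in> X" "\<pi> z = \<pi> (A (l\<^sub>\<Phi> y))" using \<tau>(3)[OF k(1)] by (auto simp: z_def)
    have "\<pi> z \<in> V2" using z(2) k(3) l\<Psi>(5) by auto
    from liftp[OF z(1) this] obtain V' a where a: "openin zariski V'" "z \<in> V'" "polynomial_map a"
      "\<And>x. x \<in> V' \<Longrightarrow> a x \<noteq> 0 \<and> p2 (\<pi> x) = proj_point (a x)" by blast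
    \<comment> \<open>\<open>l\<^sub>\<Psi>\<close> was built near \<open>x2\<close> and may vanish
      at \<open>z\<close>; it is compared with a lift \<open>a\<close> that is valid near
      \<open>z\<close>.\<close>
    have "parallel (l\<^sub>\<Psi> z) (a z)"
    proof (rule parallel_on_open[OF _ _ l\<Psi>(4) a(3)])
      show "openin zariski (V\<^sub>\<Psi> \<inter> V')" by (rule openin_Int[OF l\<Psi>(1) a(1)])
      show "V\<^sub>\<Psi> \<inter> V' \<noteq> {}" by (rule zariski_opens_meet[OF l\<Psi>(1) a(1)]) (use l\<Psi>(2) a(2) in auto)
      fix x assume "x \<in> V\<^sub>\<Psi> \<inter> V'"
      then show "parallel (l\<^sub>\<Psi> x) (a x)" using l\<Psi>(5)[of x] a(4)[of x] proj_point_parallel[of "l\<^sub>\<Psi> x" "a x"] by auto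
    qed
    moreover have "proj_point (a z) = proj_point (F n y)" using a(4)[OF a(2)] z(2) k(4) by simp
    then obtain t where "t \<noteq> 0" "F n y = t *s a z" unfolding proj_point_eq_iff by blast
    ultimately show "parallel (g y) (F n y)" by (simp add: g_def z_def parallel_scale)
  qed
  ultimately have "n \<le> K" using deg[OF gdeg] by blast
  then show False by (simp add: n_def)
qed

lemma not_property_M:
  assumes \<phi>: "\<And>n. \<phi> n \<in> G" "\<And>n. \<phi> n \<in> carrier (Bir P2)" "\<And>n. represented_by (\<phi> n) (F n)" "\<And>n. polynomial_map (F n)"
    and deg: "\<And>n K g y0. (\<And>i. poly_deg_le K (\<lambda>x. g x $ i)) \<Longrightarrow> (\<And>x. parallel (g x) (F n x)) \<Longrightarrow> g y0 \<noteq> 0 \<Longrightarrow> n \<le> K"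
  shows "\<not> property_M G"
proof -
  have P2: "\<not> conjugate_to_automorphisms G P2"
    unfolding P2_quotient
  proof (rule not_conjugate_to_automorphisms[OF liftable_proj_point _ _ \<phi> deg, where D = 1])
    fix x x' :: "complex^3" assume "x \<in> - {0}" "x' \<in> - {0}" "proj_point x = proj_point x'"
    then obtain c where c: "c \<noteq> 0" "x' = c *s x" unfolding proj_point_eq_iff by blast
    have "poly_deg_le 1 (\<lambda>z. (c *s z) $ i)" for i :: 3
      using poly_deg_le.mult[OF poly_deg_le.const[of 0 c] poly_deg_le.coord[of 1 i]] by simp
    moreover have "c *s z \<in> - {0} \<and> proj_point (c *s z) = proj_point z" if "z \<in> - {0}" for z :: "complex^3"
      using that c(1) by (subst eq_commute[of "proj_point _"]) (auto simp: proj_point_eq_iff)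
    ultimately show "\<exists>\<tau>. (\<forall>i. poly_deg_le 1 (\<lambda>z. \<tau> z $ i)) \<and> \<tau> x = x' \<and> (\<forall>z\<in>- {0}. \<tau> z \<in> - {0} \<and> proj_point (\<tau> z) = proj_point z)"
      using c(2) by (intro exI[of _ "\<lambda>z. c *s z"]) auto
  next
    fix f g assume "inverse_morphisms (quot (- {0 :: complex^3}) proj_point) f g"
    then have "inverse_morphisms P2 f g" by (simp only: P2_quotient)
    from Aut_lift_P2[OF this] show "\<exists>G. (\<forall>i. poly_deg_le 1 (\<lambda>x. G x $ i)) \<and>
        (\<forall>x\<in>- {0}. G x \<in> - {0} \<and> f (proj_point x) = proj_point (G x))"
      by (simp only: Ball_def Compl_iff singleton_iff)
  qed
  have H: "\<not> conjugate_to_automorphisms G (hirzebruch n)" for n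
    unfolding hirzebruch_quotient
  proof (rule not_conjugate_to_automorphisms[OF liftable_hirzebruch _ _ \<phi> deg, where D = "n + 1"])
    fix x x' :: "complex^4" assume "x \<in> plane_pairs" "x' \<in> plane_pairs" "hirzebruch_point n x = hirzebruch_point n x'"
    then obtain \<mu> \<rho> where c: "\<mu> \<noteq> 0" "\<rho> \<noteq> 0" "x' = hirzebruch_act n \<mu> \<rho> x" unfolding hirzebruch_point_eq_iff_act by blast
    have m: "poly_deg_le 1 (\<lambda>z. c * z $ i)" for c and i :: 4
      using poly_deg_le.mult[OF poly_deg_le.const[of 0 c] poly_deg_le.coord[of 1 i]] by simp
    have "\<forall>i. poly_deg_le 1 (\<lambda>z. hirzebruch_act n \<mu> \<rho> z $ i)"
      using m[of "\<mu> / \<rho> ^ n" 1] m[of \<mu> 2] m[of \<rho> 3] m[of \<rho> 4] unfolding forall_4 by simp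
    moreover have "hirzebruch_act n \<mu> \<rho> z \<in> plane_pairs \<and> hirzebruch_point n (hirzebruch_act n \<mu> \<rho> z) = hirzebruch_point n z"
      if "z \<in> plane_pairs" for z
      using that c plane_pairs_act[OF c(1,2)] hirzebruch_point_eq_iff_act[of n z "hirzebruch_act n \<mu> \<rho> z"] by auto
    ultimately show "\<exists>\<tau>. (\<forall>i. poly_deg_le 1 (\<lambda>z. \<tau> z $ i)) \<and> \<tau> x = x' \<and>
        (\<forall>z\<in>plane_pairs. \<tau> z \<in> plane_pairs \<and> hirzebruch_point n (\<tau> z) = hirzebruch_point n z)"
      using c(3) by (intro exI[of _ "hirzebruch_act n \<mu> \<rho>"]) auto
  next
    fix f g assume "inverse_morphisms (quot plane_pairs (hirzebruch_point n)) f g"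
    then have "inverse_morphisms (hirzebruch n) f g" by (simp only: hirzebruch_quotient)
    from Aut_lift_hirzebruch[OF this] show "\<exists>G. (\<forall>i. poly_deg_le (n + 1) (\<lambda>x. G x $ i)) \<and>
        (\<forall>x\<in>plane_pairs. G x \<in> plane_pairs \<and> f (hirzebruch_point n x) = hirzebruch_point n (G x))" by simp
  qed
  show ?thesis using P2 H H[of 0] unfolding property_M_def P1xP1_hirzebruch by blast
qed

section \<open>Very general quadratic transformations\<close>

lemma quadratic_power_represented_by:
  assumes \<phi>: "plane_map (quadratic_forms c) \<in> carrier (Bir P2)" and ne: "quadratic_forms c x0 \<noteq> 0"
  shows "represented_by (plane_map (quadratic_forms c) [^]\<^bsub>Bir P2\<^esub> (n :: nat)) (quadratic_iterate c n)"
proof (induction n)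
  case 0
  then show ?case using represented_by_id by (simp add: Bir_def nat_pow_def)
next
  case (Suc n)
  have "represented_by (plane_map (quadratic_forms c)) (quadratic_forms c)"
    by (rule represented_by_plane_map[OF polynomial_map_quadratic_forms ne quadratic_forms_scale]) simp
  from represented_by_comp[OF \<phi> this Suc] show ?case
    unfolding quadratic_iterate_Suc'[abs_def] nat_pow_Suc by (simp add: Bir_def)
qed

lemma quadratic_group_properties:
  assumes \<phi>: "plane_map (quadratic_forms c) \<in> carrier (Bir P2)"
    and R: "\<And>n. n > 0 \<Longrightarrow> fixed_resultant c n 5 \<noteq> 0"
  defines "G \<equiv> subgroup_generated (Bir P2) {plane_map (quadratic_forms c)}"
  shows "group G \<and> cyclic_group G \<and> infinite (carrier G) \<and> property_F (carrier G) \<and> \<not> property_M (carrier G)"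
proof -
  let ?\<phi> = "plane_map (quadratic_forms c)" and ?B = "Bir P2"
  interpret B: group "Bir P2" by (rule group_Bir_P2)
  have carr: "carrier G = range (\<lambda>k :: int. ?\<phi> [^]\<^bsub>?B\<^esub> k)"
    unfolding G_def by (rule B.carrier_subgroup_generated_by_singleton[OF \<phi>])
  let ?b = "vector [1, -1, 0] :: complex^3"
  have "?b $ 1 \<noteq> (0 :: complex^3) $ 1" by simp
  then have b0: "?b \<noteq> 0" by (rule contrapos_nn) (simp only:)
  \<comment> \<open>The base point of the pencil lies on the line with \<open>\<kappa> = 5\<close>.
    It alone shows that no positive power is the identity.\<close>
  have b: "\<not> parallel ?b (quadratic_iterate c n ?b)" if "n > 0" for n
    by (rule fixed_resultant_no_fixed_point[OF R[OF that] b0]) simp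
  have ne: "quadratic_forms c ?b \<noteq> 0"
    using b[of 1] by (auto simp: quadratic_iterate_Suc parallel_def)
  have rep: "represented_by (?\<phi> [^]\<^bsub>?B\<^esub> n) (quadratic_iterate c n)" for n :: nat
    by (rule quadratic_power_represented_by[OF \<phi> ne])
  have pow: "?\<phi> [^]\<^bsub>?B\<^esub> n \<in> carrier ?B" for n :: nat using \<phi> by simp
  have one: "\<one>\<^bsub>?B\<^esub> = rat_id P2" by (simp add: Bir_def)
  have "?\<phi> [^]\<^bsub>?B\<^esub> n \<noteq> \<one>\<^bsub>?B\<^esub>" if n: "n > 0" for n :: nat
  proof
    assume "?\<phi> [^]\<^bsub>?B\<^esub> n = \<one>\<^bsub>?B\<^esub>"
    then have id: "(points P2, \<lambda>x. x) \<in> ?\<phi> [^]\<^bsub>?B\<^esub> n"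
      using rat_id_mem[OF irreducible_space_P2] by (simp add: one)
    have "proj_point ?b \<in> points P2" using b0 by (simp add: points_P2)
    from fixed_point_parallel[OF rep id polynomial_map_quadratic_iterate partial_morphisms_id[OF irreducible_space_P2] b0 this]
    show False using b[OF n] by simp
  qed
  then have "B.ord ?\<phi> = 0" using \<phi> B.pow_ord_eq_1 by blast
  then have inf: "infinite (carrier G)"
    unfolding G_def using B.infinite_cyclic_subgroup_order[OF \<phi>] by blast
  have F: "property_F (carrier G)"
    unfolding property_F_def
  proof (intro ballI impI notI)
    fix \<psi> assume \<psi>: "\<psi> \<in> carrier G" "\<psi> \<noteq> \<one>\<^bsub>?B\<^esub>"
      and "\<exists>C. curve_in P2 C \<and> geometric_genus P2 C > 0 \<and> fixes_pointwise \<psi> C"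
    then obtain C U g where C: "curve_in P2 C" and g: "(U, g) \<in> \<psi>" "U \<inter> C \<noteq> {}" "\<forall>x\<in>U \<inter> C. g x = x"
      unfolding fixes_pointwise_def by blast
    obtain k :: int where k: "\<psi> = ?\<phi> [^]\<^bsub>?B\<^esub> k" using \<psi>(1) carr by blast
    then have "k \<noteq> 0" using \<psi>(2) by auto
    define n where "n = nat \<bar>k\<bar>"
    have n: "n > 0" using \<open>k \<noteq> 0\<close> by (simp add: n_def)
    have \<psi>B: "\<psi> \<in> carrier ?B" using k \<phi> by simp
    note pm = Bir_dominant(1)[OF \<psi>B g(1)]
    have par: "parallel x (quadratic_iterate c n x)" if x: "x \<noteq> 0" "proj_point x \<in> U" "g (proj_point x) = proj_point x" for x
    proof (cases "k > 0")
      case True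
      then have "\<psi> = ?\<phi> [^]\<^bsub>?B\<^esub> n" using k int_pow_int[of ?B ?\<phi> n] by (simp add: n_def)
      then show ?thesis
        using fixed_point_parallel[OF rep _ polynomial_map_quadratic_iterate pm x] g(1) by simp
    next
      case False
      then have "k = - int n" using \<open>k \<noteq> 0\<close> by (simp add: n_def)
      then have "\<psi> = inv\<^bsub>?B\<^esub> (?\<phi> [^]\<^bsub>?B\<^esub> n)" using k B.int_pow_neg_int[OF \<phi>] by simp
      then have "?\<phi> [^]\<^bsub>?B\<^esub> n \<otimes>\<^bsub>?B\<^esub> \<psi> = \<one>\<^bsub>?B\<^esub>" using B.r_inv[OF pow] by simp
      then have "rat_comp P2 P2 (?\<phi> [^]\<^bsub>?B\<^esub> n) \<psi> = rat_id P2" by (simp add: Bir_def)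
      from inverse_fixed_point_parallel[OF rep polynomial_map_quadratic_iterate quadratic_iterate_scale \<psi>B this g(1) x]
      show ?thesis .
    qed
    let ?Fix = "{proj_point x |x. x \<noteq> 0 \<and> parallel x (quadratic_iterate c n x)}"
    have irr: "irreducible_subset (zar P2) C" using C by (simp add: curve_in_def)
    then have sub: "C \<subseteq> points P2" by (simp add: irreducible_subset_def)
    have clF: "closedin (zar P2) ?Fix"
      by (rule closedin_parallel[OF polynomial_map_quadratic_iterate quadratic_iterate_scale])
    have oU: "openin (zar P2) U" by (rule partial_morphismsD(1)[OF irreducible_space_P2 pm])
    have "closedin (zar P2) (points P2 - U)" by (rule closedin_diff[OF closedin_topspace oU])
    moreover have "C \<subseteq> ?Fix \<union> (points P2 - U)"
    proof
      fix s assume s: "s \<in> C"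
      then obtain x where x: "s = proj_point x" "x \<noteq> 0" using sub unfolding points_P2 by blast
      show "s \<in> ?Fix \<union> (points P2 - U)"
      proof (cases "s \<in> U")
        case True
        then have "g s = s" using g(3) s by blast
        then have "parallel x (quadratic_iterate c n x)" using par[OF x(2)] True x(1) by simp
        then show ?thesis using x by blast
      next
        case False
        then show ?thesis using s sub by blast
      qed
    qed
    \<comment> \<open>Irreducibility: \<open>C\<close> meets \<open>U\<close>, so fixing the points
      of \<open>U \<inter> C\<close> puts all of \<open>C\<close> into the closed set
      \<open>?Fix\<close>.\<close>
    ultimately have "C \<subseteq> ?Fix \<or> C \<subseteq> points P2 - U" using irr clF unfolding irreducible_subset_def by blast
    then have "C \<subseteq> ?Fix" using g(2) by blast
    then show False by (rule no_fixed_curve[OF R[OF n] C])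
  qed
  have M: "\<not> property_M (carrier G)"
  proof (rule not_property_M[where \<phi> = "\<lambda>n. ?\<phi> [^]\<^bsub>?B\<^esub> n" and F = "quadratic_iterate c", OF _ pow rep polynomial_map_quadratic_iterate])
    fix n :: nat
    show "?\<phi> [^]\<^bsub>?B\<^esub> n \<in> carrier G" unfolding carr using int_pow_int[of ?B ?\<phi> n] by (metis rangeI)
    fix K and g :: "complex^3 \<Rightarrow> complex^3" and y0
    assume g: "\<And>i. poly_deg_le K (\<lambda>x. g x $ i)" "\<And>x. parallel (g x) (quadratic_iterate c n x)" "g y0 \<noteq> 0"
    show "n \<le> K"
    proof (cases "n = 0")
      case False
      then have "2 ^ n \<le> K" using proportional_degree_bound[OF R g] by simp
      then show ?thesis using less_exp[of n] by linarith
    qed simp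
  qed
  have "group G" unfolding G_def by (rule B.group_subgroup_generated)
  moreover have "cyclic_group G" unfolding G_def by (rule B.cyclic_group_generated)
  ultimately show ?thesis using inf F M by blast
qed

theorem corollary11p2:
  shows "very_general quadratic_topology (\<lambda>q. \<forall>c\<in>q.
    let G = subgroup_generated (Bir P2) {plane_map (quadratic_forms c)} in
      group G \<and> cyclic_group G \<and> infinite (carrier G) \<and>
      property_F (carrier G) \<and> \<not> property_M (carrier G))"
proof -
  let ?K = "\<lambda>n. {proj_point c |c :: complex^(3 \<times> 3 \<times> 3). c \<noteq> 0 \<and> fixed_resultant c n 5 = 0}"
  \<comment> \<open>The index starts with \<open>Suc n\<close>: the iterate number 0 is the
    identity, whose resultant vanishes for every map.\<close>
  let ?Z = "\<lambda>n. ?K (Suc n) \<inter> quadratic_birational"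
  have top: "topspace quadratic_topology = quadratic_birational"
  proof -
    have "quadratic_birational \<subseteq> proj_point ` (- {0})"
      unfolding quadratic_birational_def using quadratic_birational_nonzero by auto
    then show ?thesis
      unfolding quadratic_topology_def topspace_subtopology projective_space_def
        points_quotient_variety[OF openin_zariski_nonzero_vec] by blast
  qed
  \<comment> \<open>One map outside all exceptional sets shows that each of them is proper.\<close>
  have henon: "proj_point henon_coeffs \<notin> ?K (Suc n)" for n
  proof
    assume "proj_point henon_coeffs \<in> ?K (Suc n)"
    then obtain c where c: "proj_point henon_coeffs = proj_point c" "fixed_resultant c (Suc n) 5 = 0" by blast
    then obtain t where "t \<noteq> 0" "c = t *s henon_coeffs" unfolding proj_point_eq_iff by blast
    then show False using c(2) henon_resultant[of "Suc n"] fixed_resultant_scale by simp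
  qed
  show ?thesis
    unfolding very_general_def
  proof (rule exI[of _ ?Z], intro conjI allI ballI)
    fix n
    show "closedin quadratic_topology (?Z n)"
      unfolding quadratic_topology_def closedin_subtopology using closedin_fixed_resultant[of "Suc n"] by blast
    show "?Z n \<noteq> topspace quadratic_topology"
      using henon henon_quadratic_birational unfolding top by blast
  next
    fix q c assume q: "q \<in> topspace quadratic_topology - (\<Union>n. ?Z n)" and c: "c \<in> q"
    then have qb: "q \<in> quadratic_birational" and qn: "\<And>n. q \<notin> ?K (Suc n)" unfolding top by auto
    obtain d where d: "q = proj_point d" "no_common_factor (quadratic_forms d)" "plane_map (quadratic_forms d) \<in> carrier (Bir P2)"
      using qb unfolding quadratic_birational_def by blast
    \<comment> \<open>The claim concerns every coefficient vector \<open>c\<close> in the class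
      \<open>q\<close>, so what is known for \<open>d\<close> is transported along the
      scaling.\<close>
    obtain t where t: "t \<noteq> 0" "c = t *s d" using c unfolding d(1) proj_point_def by blast
    have d0: "d \<noteq> 0" by (rule quadratic_birational_nonzero[OF d(2)])
    have R: "fixed_resultant c n 5 \<noteq> 0" if "n > 0" for n
    proof -
      have "fixed_resultant d n 5 \<noteq> 0" using qn[of "n - 1"] that d0 unfolding d(1) by auto
      then show ?thesis using t fixed_resultant_scale by simp
    qed
    have B: "plane_map (quadratic_forms c) \<in> carrier (Bir P2)" using d(3) plane_map_scale[OF t(1)] t(2) by simp
    show "let G = subgroup_generated (Bir P2) {plane_map (quadratic_forms c)} in
      group G \<and> cyclic_group G \<and> infinite (carrier G) \<and> property_F (carrier G) \<and> \<not> property_M (carrier G)"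
      unfolding Let_def by (rule quadratic_group_properties[OF B R])
  qed
qed

end
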